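(* Let $\Theta:\mathcal{L}(A,A')\to\mathcal{L}(C,C')$ be a superchannel in the class $\mathsf{SCT}$, and let $\mathcal{N},\mathcal{M}\in\mathcal{L}(A,A')$ be quantum channels. Let $\widetilde A\simeq A$, $\widetilde C\simeq C$, and let $\Psi_{\widetilde A A}$, $\Phi_{\widetilde C C}$ be pure states with full-rank marginals $\Psi_{\widetilde A}$, $\Phi_{\widetilde C}$ that realize the supremum in $D[\mathcal{N}\|\mathcal{M}]$ and $D[\Theta(\mathcal{N})\|\Theta(\mathcal{M})]$, respectively. If $D[\mathcal{N}\|\mathcal{M}]=D[\Theta(\mathcal{N})\|\Theta(\mathcal{M})]$, then there exists a completely CP-preserving supermap $\Theta^{\mathrm R}:\mathcal{L}(C,C')\to\mathcal{L}(A,A')$ such that $$\Theta^{\mathrm R}\circ\Theta(\mathcal{N})=\mathcal{N}\quad\text{and}\quad\Theta^{\mathrm R}\circ\Theta(\mathcal{M})=\mathcal{M}.$$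
   Context: All Hilbert spaces are finite-dimensional. $\mathcal{L}(A)$ is the space of linear operators on $A$, $\mathcal{L}(A,B)$ the space of linear maps $\mathcal{L}(A)\to\mathcal{L}(B)$. A quantum channel is a CPTP map. A supermap is a linear map $\Theta:\mathcal{L}(A,B)\to\mathcal{L}(C,D)$; it is CP-preserving if it maps CP maps to CP maps, completely CP-preserving if $\mathrm{id}\otimes\Theta$ is CP-preserving on $\mathcal{L}(E,E')\otimes\mathcal{L}(A,B)$ for all $E,E'$, and TP-preserving if it maps trace-preserving maps to trace-preserving maps. A superchannel is a completely CP-preserving and TP-preserving supermap. For $\rho$ a state and $\sigma\ge0$, $D(\rho\|\sigma)=\mathrm{tr}(\rho(\log\rho-\log\sigma))$ if $\mathrm{supp}\,\rho\subseteq\mathrm{supp}\,\sigma$ and $+\infty$ otherwise. For channels, $D[\mathcal{N}\|\mathcal{M}]=\sup_{\Psi_{RA}}D(\mathrm{id}_R\otimes\mathcal{N}(\Psi_{RA})\|\mathrm{id}_R\otimes\mathcal{M}(\Psi_{RA}))$ over reference systems $R$ and pure (equivalently, all) states on $R\otimes A$; a state realizes the supremum if it attains it. Class $\mathsf{SCT}$: the Choi operator of $\mathcal{N}\in\mathcal{L}(A,B)$ is $\widehat{\mathsf C}_{\mathcal N}=\sum_{i,j}e_{ij}\otimes\mathcal{N}(e_{ij})$ ($e_{ij}$ matrix units of $\mathcal{L}(A)$). The representing map of a supermap $\Theta:\mathcal{L}(A,B)\to\mathcal{L}(C,D)$ is the linear map $\mathsf{T}:\mathcal{L}(A\otimes B)\to\mathcal{L}(C\otimes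 D)$ with $\mathsf{T}(\widehat{\mathsf C}_{\mathcal N})=\widehat{\mathsf C}_{\Theta(\mathcal N)}$ for all $\mathcal{N}$. $\mathsf{SCT}$ is the set of superchannels $\Theta$ for which there is $\sigma_0\in\mathcal{L}(C\otimes D)$, $\mathrm{tr}(\sigma_0)=1$, such that $\mathsf{T}'(X)=\mathsf{T}(X)+[\mathrm{tr}(X)-\mathrm{tr}(\mathsf{T}(X))]\sigma_0$ is CPTP. As part of the setting, the paper also takes the analogous modification to be CPTP for the representing map $\mathfrak{T}:\mathcal{L}(\widetilde A\otimes A')\to\mathcal{L}(\widetilde C\otimes C')$ of $\Theta$ with respect to $\Psi,\Phi$, i.e. the linear map determined by $\mathfrak{T}((\mathrm{id}_{\widetilde A}\otimes\mathcal{K})(\Psi))=(\mathrm{id}_{\widetilde C}\otimes\Theta(\mathcal{K}))(\Phi)$ for all $\mathcal{K}\in\mathcal{L}(A,A')$: there is $\sigma_0\in\mathcal{L}(\widetilde C\otimes C')$ with $\mathrm{tr}(\sigma_0)=1$ such that $\mathfrak{T}'(X)=\mathfrak{T}(X)+[\mathrm{tr}(X)-\mathrm{tr}(\mathfrak{T}(X))]\sigma_0$ is CPTP.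
   Formalization: The formal theorem additionally assumes that D[N‖M] is finite; without this, when both divergences equal +∞, the claim fails (for example for a classical coarse-graining of states on C^3 whose supports are not nested). *)

theory Defs
  imports
    "HOL-Library.Extended_Real"
    "Jordan_Normal_Form.Matrix_Kernel"
    "Jordan_Normal_Form.DL_Rank"
    "Jordan_Normal_Form.Schur_Decomposition"
begin

text \<open>
  A finite-dimensional Hilbert space is \<open>\<complex>^n\<close> with its standard orthonormal basis, and operators on
  it are the elements of \<open>carrier_mat n n\<close>. The tensor product of spaces of dimensions \<open>m\<close> and \<open>n\<close>
  has dimension \<open>m * n\<close>; its basis vector \<open>(i, k)\<close> has index \<open>i * n + k\<close>. Numbers appearing as
  arguments below are dimensions.
\<close>

subsection \<open>Operators\<close>

definition mtrace :: "complex mat \<Rightarrow> complex" where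
  "mtrace A = (\<Sum>i<dim_row A. A $$ (i, i))"

text \<open>The order on \<^typ>\<open>complex\<close> makes \<open>0 \<le> z\<close> include that \<open>z\<close> is real, so Hermiticity is implied.\<close>

definition psd :: "nat \<Rightarrow> complex mat \<Rightarrow> bool" where
  "psd n A \<longleftrightarrow> A \<in> carrier_mat n n \<and> (\<forall>v\<in>carrier_vec n. 0 \<le> (A *\<^sub>v v) \<bullet>c v)"

definition pure_state :: "nat \<Rightarrow> complex mat \<Rightarrow> bool" where
  "pure_state n P \<longleftrightarrow>
     (\<exists>v\<in>carrier_vec n. v \<bullet>c v = 1 \<and> P = mat n n (\<lambda>(i, j). v $ i * cnj (v $ j)))"

definition unit_op :: "nat \<Rightarrow> nat \<Rightarrow> nat \<Rightarrow> complex mat" where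
  "unit_op n i j = mat n n (\<lambda>(k, l). if k = i \<and> l = j then 1 else 0)"

definition kron :: "complex mat \<Rightarrow> complex mat \<Rightarrow> complex mat" where
  "kron A B = mat (dim_row A * dim_row B) (dim_col A * dim_col B)
     (\<lambda>(i, j). A $$ (i div dim_row B, j div dim_col B) * B $$ (i mod dim_row B, j mod dim_col B))"

definition partial_trace2 :: "nat \<Rightarrow> nat \<Rightarrow> complex mat \<Rightarrow> complex mat" where
  "partial_trace2 m n X = mat m m (\<lambda>(i, j). \<Sum>k<n. X $$ (i * n + k, j * n + k))"

definition full_rank :: "nat \<Rightarrow> complex mat \<Rightarrow> bool" where
  "full_rank n A \<longleftrightarrow> vec_space.rank n A = n"


subsection \<open>Relative entropy\<close>

text \<open>
  Functional calculus for Hermitian operators, through any unitary diagonalization; the result does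
  not depend on the diagonalization chosen. Since \<open>ln 0 = 0\<close>, the operator \<open>herm_fun n ln A\<close>
  is the logarithm of \<open>A \<ge> 0\<close> on its support, extended by zero.
\<close>

definition herm_fun :: "nat \<Rightarrow> (real \<Rightarrow> real) \<Rightarrow> complex mat \<Rightarrow> complex mat" where
  "herm_fun n f A = (THE B. \<exists>U d. U \<in> carrier_mat n n \<and> mat_adjoint U * U = 1\<^sub>m n \<and>
     A = U * mat_diag n (\<lambda>i. complex_of_real (d i)) * mat_adjoint U \<and>
     B = U * mat_diag n (\<lambda>i. complex_of_real (f (d i))) * mat_adjoint U)"

definition supp :: "nat \<Rightarrow> complex mat \<Rightarrow> complex vec set" where
  "supp n A = {v \<in> carrier_vec n. \<forall>w\<in>mat_kernel A. v \<bullet>c w = 0}"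

definition rel_entropy :: "nat \<Rightarrow> complex mat \<Rightarrow> complex mat \<Rightarrow> ereal" where
  "rel_entropy n \<rho> \<sigma> =
     (if supp n \<rho> \<subseteq> supp n \<sigma>
      then ereal (Re (mtrace (\<rho> * (herm_fun n ln \<rho> - herm_fun n ln \<sigma>))))
      else \<infinity>)"


subsection \<open>Linear maps between operator spaces\<close>

text \<open>
  The space \<open>\<L>(A, B)\<close>. Its elements are extensional (\<^term>\<open>undefined\<close> outside \<open>\<L>(A)\<close>), so that
  equality of functions is equality of linear maps.
\<close>

definition lmaps :: "nat \<Rightarrow> nat \<Rightarrow> (complex mat \<Rightarrow> complex mat) set" where
  "lmaps a b = {N \<in> carrier_mat a a \<rightarrow>\<^sub>E carrier_mat b b.
     (\<forall>X\<in>carrier_mat a a. \<forall>Y\<in>carrier_mat a a. N (X + Y) = N X + N Y) \<and>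
     (\<forall>z. \<forall>X\<in>carrier_mat a a. N (z \<cdot>\<^sub>m X) = z \<cdot>\<^sub>m N X)}"

definition id_map :: "nat \<Rightarrow> complex mat \<Rightarrow> complex mat" where
  "id_map n = (\<lambda>X\<in>carrier_mat n n. X)"

text \<open>
  The tensor product of \<open>F \<in> \<L>(E, E')\<close> and \<open>N \<in> \<L>(A, B)\<close>, obtained by expanding the argument in the
  matrix units \<open>unit_op e p q \<otimes> unit_op a k l\<close>; see \<open>tensor_map_kron\<close> below.
\<close>

definition tensor_map ::
  "nat \<Rightarrow> nat \<Rightarrow> nat \<Rightarrow> nat \<Rightarrow> (complex mat \<Rightarrow> complex mat) \<Rightarrow> (complex mat \<Rightarrow> complex mat)
     \<Rightarrow> complex mat \<Rightarrow> complex mat" where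
  "tensor_map e e' a b F N = (\<lambda>X\<in>carrier_mat (e * a) (e * a).
     mat (e' * b) (e' * b) (\<lambda>ij. \<Sum>p<e. \<Sum>q<e. \<Sum>k<a. \<Sum>l<a.
       X $$ (p * a + k, q * a + l) * kron (F (unit_op e p q)) (N (unit_op a k l)) $$ ij))"

definition id_tensor :: "nat \<Rightarrow> nat \<Rightarrow> nat \<Rightarrow> (complex mat \<Rightarrow> complex mat) \<Rightarrow> complex mat \<Rightarrow> complex mat" where
  "id_tensor r a b N = tensor_map r r a b (id_map r) N"

definition cp_map :: "nat \<Rightarrow> nat \<Rightarrow> (complex mat \<Rightarrow> complex mat) \<Rightarrow> bool" where
  "cp_map a b N \<longleftrightarrow> N \<in> lmaps a b \<and>
     (\<forall>r X. psd (r * a) X \<longrightarrow> psd (r * b) (id_tensor r a b N X))"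

definition tp_map :: "nat \<Rightarrow> nat \<Rightarrow> (complex mat \<Rightarrow> complex mat) \<Rightarrow> bool" where
  "tp_map a b N \<longleftrightarrow> N \<in> lmaps a b \<and> (\<forall>X\<in>carrier_mat a a. mtrace (N X) = mtrace X)"

definition channel :: "nat \<Rightarrow> nat \<Rightarrow> (complex mat \<Rightarrow> complex mat) \<Rightarrow> bool" where
  "channel a b N \<longleftrightarrow> cp_map a b N \<and> tp_map a b N"

text \<open>
  \<open>channel_state_div r a b N M P\<close> is \<open>D(id\<^sub>R \<otimes> N(P) \<parallel> id\<^sub>R \<otimes> M(P))\<close>;
  in \<open>channel_div\<close> the dimension \<open>r\<close> of the reference system is unbounded.
\<close>

definition channel_state_div ::
  "nat \<Rightarrow> nat \<Rightarrow> nat \<Rightarrow> (complex mat \<Rightarrow> complex mat) \<Rightarrow> (complex mat \<Rightarrow> complex mat)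
     \<Rightarrow> complex mat \<Rightarrow> ereal" where
  "channel_state_div r a b N M P =
     rel_entropy (r * b) (id_tensor r a b N P) (id_tensor r a b M P)"

definition channel_div ::
  "nat \<Rightarrow> nat \<Rightarrow> (complex mat \<Rightarrow> complex mat) \<Rightarrow> (complex mat \<Rightarrow> complex mat) \<Rightarrow> ereal" where
  "channel_div a b N M = Sup {channel_state_div r a b N M P | r P. pure_state (r * a) P}"


subsection \<open>Supermaps\<close>

definition supermaps ::
  "nat \<Rightarrow> nat \<Rightarrow> nat \<Rightarrow> nat \<Rightarrow> ((complex mat \<Rightarrow> complex mat) \<Rightarrow> (complex mat \<Rightarrow> complex mat)) set" where
  "supermaps a b c d = {\<Theta> \<in> lmaps a b \<rightarrow> lmaps c d.
     (\<forall>N\<in>lmaps a b. \<forall>M\<in>lmaps a b.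
        \<Theta> (\<lambda>X\<in>carrier_mat a a. N X + M X) = (\<lambda>Y\<in>carrier_mat c c. \<Theta> N Y + \<Theta> M Y)) \<and>
     (\<forall>z. \<forall>N\<in>lmaps a b.
        \<Theta> (\<lambda>X\<in>carrier_mat a a. z \<cdot>\<^sub>m N X) = (\<lambda>Y\<in>carrier_mat c c. z \<cdot>\<^sub>m \<Theta> N Y))}"

definition cp_preserving ::
  "nat \<Rightarrow> nat \<Rightarrow> nat \<Rightarrow> nat \<Rightarrow> ((complex mat \<Rightarrow> complex mat) \<Rightarrow> (complex mat \<Rightarrow> complex mat)) \<Rightarrow> bool" where
  "cp_preserving a b c d \<Theta> \<longleftrightarrow> (\<forall>N. cp_map a b N \<longrightarrow> cp_map c d (\<Theta> N))"

definition tp_preserving ::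
  "nat \<Rightarrow> nat \<Rightarrow> nat \<Rightarrow> nat \<Rightarrow> ((complex mat \<Rightarrow> complex mat) \<Rightarrow> (complex mat \<Rightarrow> complex mat)) \<Rightarrow> bool" where
  "tp_preserving a b c d \<Theta> \<longleftrightarrow> (\<forall>N. tp_map a b N \<longrightarrow> tp_map c d (\<Theta> N))"

text \<open>
  \<open>\<Xi>\<close> is \<open>id \<otimes> \<Theta>\<close> on \<open>\<L>(E, E') \<otimes> \<L>(A, B) = \<L>(E \<otimes> A, E' \<otimes> B)\<close>. The elementary tensors span this
  space, so the two conditions determine \<open>\<Xi>\<close> there.
\<close>

definition is_id_tensor_super ::
  "nat \<Rightarrow> nat \<Rightarrow> nat \<Rightarrow> nat \<Rightarrow> nat \<Rightarrow> nat
     \<Rightarrow> ((complex mat \<Rightarrow> complex mat) \<Rightarrow> (complex mat \<Rightarrow> complex mat))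
     \<Rightarrow> ((complex mat \<Rightarrow> complex mat) \<Rightarrow> (complex mat \<Rightarrow> complex mat)) \<Rightarrow> bool" where
  "is_id_tensor_super e e' a b c d \<Theta> \<Xi> \<longleftrightarrow>
     \<Xi> \<in> supermaps (e * a) (e' * b) (e * c) (e' * d) \<and>
     (\<forall>F\<in>lmaps e e'. \<forall>N\<in>lmaps a b.
        \<Xi> (tensor_map e e' a b F N) = tensor_map e e' c d F (\<Theta> N))"

definition completely_cp_preserving ::
  "nat \<Rightarrow> nat \<Rightarrow> nat \<Rightarrow> nat \<Rightarrow> ((complex mat \<Rightarrow> complex mat) \<Rightarrow> (complex mat \<Rightarrow> complex mat)) \<Rightarrow> bool" where
  "completely_cp_preserving a b c d \<Theta> \<longleftrightarrow> \<Theta> \<in> supermaps a b c d \<and>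
     (\<forall>e e'. \<exists>\<Xi>. is_id_tensor_super e e' a b c d \<Theta> \<Xi> \<and>
        cp_preserving (e * a) (e' * b) (e * c) (e' * d) \<Xi>)"

definition superchannel ::
  "nat \<Rightarrow> nat \<Rightarrow> nat \<Rightarrow> nat \<Rightarrow> ((complex mat \<Rightarrow> complex mat) \<Rightarrow> (complex mat \<Rightarrow> complex mat)) \<Rightarrow> bool" where
  "superchannel a b c d \<Theta> \<longleftrightarrow> completely_cp_preserving a b c d \<Theta> \<and> tp_preserving a b c d \<Theta>"


subsection \<open>Representing maps and the class SCT\<close>

definition choi :: "nat \<Rightarrow> nat \<Rightarrow> (complex mat \<Rightarrow> complex mat) \<Rightarrow> complex mat" where
  "choi a b N = mat (a * b) (a * b)
     (\<lambda>kl. \<Sum>i<a. \<Sum>j<a. kron (unit_op a i j) (N (unit_op a i j)) $$ kl)"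

definition representing_map ::
  "nat \<Rightarrow> nat \<Rightarrow> nat \<Rightarrow> nat \<Rightarrow> ((complex mat \<Rightarrow> complex mat) \<Rightarrow> (complex mat \<Rightarrow> complex mat))
     \<Rightarrow> (complex mat \<Rightarrow> complex mat) \<Rightarrow> bool" where
  "representing_map a b c d \<Theta> T \<longleftrightarrow> T \<in> lmaps (a * b) (c * d) \<and>
     (\<forall>N\<in>lmaps a b. T (choi a b N) = choi c d (\<Theta> N))"

definition state_representing_map ::
  "nat \<Rightarrow> nat \<Rightarrow> nat \<Rightarrow> nat \<Rightarrow> complex mat \<Rightarrow> complex mat
     \<Rightarrow> ((complex mat \<Rightarrow> complex mat) \<Rightarrow> (complex mat \<Rightarrow> complex mat))
     \<Rightarrow> (complex mat \<Rightarrow> complex mat) \<Rightarrow> bool" where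
  "state_representing_map a b c d P Q \<Theta> T \<longleftrightarrow> T \<in> lmaps (a * b) (c * d) \<and>
     (\<forall>K\<in>lmaps a b. T (id_tensor a a b K P) = id_tensor c c d (\<Theta> K) Q)"

definition trace_corrected ::
  "nat \<Rightarrow> (complex mat \<Rightarrow> complex mat) \<Rightarrow> complex mat \<Rightarrow> complex mat \<Rightarrow> complex mat" where
  "trace_corrected m T \<sigma>\<^sub>0 = (\<lambda>X\<in>carrier_mat m m. T X + (mtrace X - mtrace (T X)) \<cdot>\<^sub>m \<sigma>\<^sub>0)"

definition trace_correctable :: "nat \<Rightarrow> nat \<Rightarrow> (complex mat \<Rightarrow> complex mat) \<Rightarrow> bool" where
  "trace_correctable m n T \<longleftrightarrow>
     (\<exists>\<sigma>\<^sub>0\<in>carrier_mat n n. mtrace \<sigma>\<^sub>0 = 1 \<and> channel m n (trace_corrected m T \<sigma>\<^sub>0))"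

definition SCT ::
  "nat \<Rightarrow> nat \<Rightarrow> nat \<Rightarrow> nat \<Rightarrow> ((complex mat \<Rightarrow> complex mat) \<Rightarrow> (complex mat \<Rightarrow> complex mat)) set" where
  "SCT a b c d = {\<Theta>. superchannel a b c d \<Theta> \<and>
     (\<exists>T. representing_map a b c d \<Theta> T \<and> trace_correctable (a * b) (c * d) T)}"


subsection \<open>The tensor product of linear maps\<close>

lemma lmaps_carrier: "N \<in> lmaps a b \<Longrightarrow> X \<in> carrier_mat a a \<Longrightarrow> N X \<in> carrier_mat b b"
  unfolding lmaps_def by blast

lemma unit_op_carrier [simp]: "unit_op n i j \<in> carrier_mat n n"
  unfolding unit_op_def by simp

lemma tensor_map_lmaps: "tensor_map e e' a b F N \<in> lmaps (e * a) (e' * b)"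
proof -
  have idx: "p * a + k < e * a" if "p < e" "k < a" for p k
  proof -
    have "p * a + k < p * a + a" using that by simp
    also have "\<dots> = Suc p * a" by simp
    also have "\<dots> \<le> e * a" using that by (intro mult_le_mono1) simp
    finally show ?thesis .
  qed
  show ?thesis
    unfolding lmaps_def tensor_map_def
    by (auto intro!: eq_matI simp: idx distrib_right mult.assoc sum.distrib sum_distrib_left
        cong: sum.cong_simp)
qed

lemma lmaps_expand:
  assumes N: "N \<in> lmaps a b" and X: "X \<in> carrier_mat a a" and ij: "i < b" "j < b"
  shows "N X $$ (i, j) = (\<Sum>p<a. \<Sum>q<a. X $$ (p, q) * N (unit_op a p q) $$ (i, j))"
proof -
  let ?R = "\<lambda>S. mat a a (\<lambda>pq. if pq \<in> S then X $$ pq else 0)"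
  have add: "N (Y + Z) = N Y + N Z" if "Y \<in> carrier_mat a a" "Z \<in> carrier_mat a a" for Y Z
    using N that unfolding lmaps_def by blast
  have sm: "N (z \<cdot>\<^sub>m Y) = z \<cdot>\<^sub>m N Y" if "Y \<in> carrier_mat a a" for z Y
    using N that unfolding lmaps_def by blast
  have main: "N (?R S) $$ (i, j) = (\<Sum>(p, q)\<in>S. X $$ (p, q) * N (unit_op a p q) $$ (i, j))"
    if "finite S" "S \<subseteq> {..<a} \<times> {..<a}" for S
    using that
  proof (induction S rule: finite_induct)
    case empty
    have "?R {} = 0 \<cdot>\<^sub>m ?R {}" by (intro eq_matI) auto
    then have "N (?R {}) = 0 \<cdot>\<^sub>m N (?R {})" using sm[of "?R {}" 0] by auto
    then have "N (?R {}) $$ (i, j) = (0 \<cdot>\<^sub>m N (?R {})) $$ (i, j)" by metis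
    moreover have "N (?R {}) \<in> carrier_mat b b" by (rule lmaps_carrier[OF N]) simp
    ultimately show ?case using ij by auto
  next
    case (insert x S)
    obtain p q where x: "x = (p, q)" by force
    have "?R (insert x S) = X $$ (p, q) \<cdot>\<^sub>m unit_op a p q + ?R S"
      using insert.hyps unfolding x unit_op_def by (intro eq_matI) auto
    then have "N (?R (insert x S)) = X $$ (p, q) \<cdot>\<^sub>m N (unit_op a p q) + N (?R S)"
      by (simp add: add sm)
    moreover have "N (?R S) \<in> carrier_mat b b" "N (unit_op a p q) \<in> carrier_mat b b"
      by (auto intro: lmaps_carrier[OF N])
    ultimately show ?case using insert ij unfolding x by auto
  qed
  have "?R ({..<a} \<times> {..<a}) = X" using X by (intro eq_matI) auto
  with main[of "{..<a} \<times> {..<a}"] show ?thesis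
    by (simp add: sum.cartesian_product)
qed

lemma tensor_map_kron:
  assumes F: "F \<in> lmaps e e'" and N: "N \<in> lmaps a b"
    and X: "X \<in> carrier_mat e e" and Y: "Y \<in> carrier_mat a a"
  shows "tensor_map e e' a b F N (kron X Y) = kron (F X) (N Y)"
proof (rule eq_matI)
  have c: "F X \<in> carrier_mat e' e'" "N Y \<in> carrier_mat b b"
    "\<And>p q. F (unit_op e p q) \<in> carrier_mat e' e'" "\<And>p q. N (unit_op a p q) \<in> carrier_mat b b"
    using lmaps_carrier[OF F] lmaps_carrier[OF N] X Y by auto
  have k: "kron X Y \<in> carrier_mat (e * a) (e * a)" using X Y unfolding kron_def by auto
  show "dim_row (tensor_map e e' a b F N (kron X Y)) = dim_row (kron (F X) (N Y))"
    "dim_col (tensor_map e e' a b F N (kron X Y)) = dim_col (kron (F X) (N Y))"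
    using c k unfolding tensor_map_def kron_def by auto
  fix i j assume "i < dim_row (kron (F X) (N Y))" "j < dim_col (kron (F X) (N Y))"
  then have ij: "i < e' * b" "j < e' * b" using c unfolding kron_def by auto
  then have b: "b > 0" by (cases b) auto
  have d: "i div b < e'" "j div b < e'" "i mod b < b" "j mod b < b"
    using ij b by (auto simp: less_mult_imp_div_less)
  have idx: "p * a + k < e * a" if "p < e" "k < a" for p k
  proof -
    have "p * a + k < p * a + a" using that by simp
    also have "\<dots> = Suc p * a" by simp
    also have "\<dots> \<le> e * a" using that by (intro mult_le_mono1) simp
    finally show ?thesis .
  qed
  have "tensor_map e e' a b F N (kron X Y) $$ (i, j) =
    (\<Sum>p<e. \<Sum>q<e. \<Sum>k<a. \<Sum>l<a. (X $$ (p, q) * F (unit_op e p q) $$ (i div b, j div b)) *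
       (Y $$ (k, l) * N (unit_op a k l) $$ (i mod b, j mod b)))"
    unfolding tensor_map_def restrict_apply'[OF k]
    using ij
    apply (simp only: index_mat)
    apply (intro sum.cong refl)
    using X Y c idx carrier_matD[OF c(3)] carrier_matD[OF c(4)] by (simp add: kron_def)
  also have "\<dots> = (\<Sum>p<e. \<Sum>q<e. X $$ (p, q) * F (unit_op e p q) $$ (i div b, j div b)) *
     (\<Sum>k<a. \<Sum>l<a. Y $$ (k, l) * N (unit_op a k l) $$ (i mod b, j mod b))"
    by (simp only: sum_distrib_right) (simp only: sum_distrib_left)
  also have "\<dots> = kron (F X) (N Y) $$ (i, j)"
    using lmaps_expand[OF F X d(1,2)] lmaps_expand[OF N Y d(3,4)] ij c
      carrier_matD[OF c(1)] carrier_matD[OF c(2)]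
    by (simp add: kron_def)
  finally show "tensor_map e e' a b F N (kron X Y) $$ (i, j) = kron (F X) (N Y) $$ (i, j)" .
qed

end

theory Submission
  imports "HOL-Analysis.Equivalence_Lebesgue_Henstock_Integration" "HOL-Analysis.Lipschitz"
    "Jordan_Normal_Form.Spectral_Radius" Defs
begin

text \<open>
  Let \<open>\<rho>\<close>, \<open>\<sigma>\<close> be the images of \<open>\<Psi>\<close> under \<open>id \<otimes> \<N>\<close>, \<open>id \<otimes> \<M>\<close>, and let \<open>\<rho>'\<close>, \<open>\<sigma>'\<close> be the images of \<open>\<Phi>\<close> under
  \<open>id \<otimes> \<Theta>(\<N>)\<close>, \<open>id \<otimes> \<Theta>(\<M>)\<close>. The trace-corrected representing map is a channel taking \<open>(\<rho>, \<sigma>)\<close> to \<open>(\<rho>', \<sigma>')\<close> with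
  \<open>D(\<rho> \<parallel> \<sigma>) = D(\<rho>' \<parallel> \<sigma>') < \<infinity>\<close>. Since the recovery need not preserve traces, Petz' map is not needed: a
  measure-and-prepare map with two outcomes taking \<open>(\<rho>', \<sigma>')\<close> to \<open>(\<rho>, \<sigma>)\<close> exists as soon as the extremal constants
  in \<open>m \<sigma>' \<le> \<rho>' \<le> M \<sigma>'\<close> also satisfy \<open>m \<sigma> \<le> \<rho> \<le> M \<sigma>\<close>.

  That follows from an integral formula in the spirit of Frenkel: if \<open>\<rho> \<le> s\<^sub>0 \<sigma>\<close> and \<open>t = tr \<rho>\<close>, then
  \<open>D(\<rho> \<parallel> \<sigma>) = t (1 + ln s\<^sub>0) - \<integral>\<close> of \<open>(t - tr (\<rho> - s \<sigma>)\<^sub>+) / s\<close> over \<open>0 < s \<le> s\<^sub>0\<close>. As channels do not increase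
  \<open>tr (\<rho> - s \<sigma>)\<^sub>+\<close>, equality of the relative entropies forces equality of these traces for all \<open>s\<close>, and they determine
  whether \<open>\<rho> \<le> s \<sigma>\<close> and whether \<open>s \<sigma> \<le> \<rho>\<close>. The formula itself is obtained by replacing \<open>\<sigma>\<close> by \<open>\<sigma> + r\<close> and
  differentiating in \<open>r\<close>: by Sylvester's law of inertia the derivative of the integral is the sum of the generalized
  eigenvalues of \<open>(\<rho>, \<sigma> + r)\<close>, that is \<open>tr \<rho> (\<sigma> + r)\<inverse>\<close>.
\<close>

unbundle no vec_syntax

subsection \<open>Hermitian forms\<close>

text \<open>The constants \<open>m\<close>, \<open>M\<close> are attained: there are vectors
  \<open>w\<close>, \<open>v\<close>, not of unit norm, whose forms take the value 1 on
  \<open>\<sigma>'\<close> and the values \<open>m\<close>, \<open>M\<close> on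
  \<open>\<rho>'\<close>. Reading off these two numbers is completely positive, but the two outcomes
  need not form a measurement; this is where traces may be lost. Preparing
  \<open>(\<rho> - m \<sigma>) / (M - m)\<close> on the outcome of \<open>v\<close> and
  \<open>(M \<sigma> - \<rho>) / (M - m)\<close> on that of \<open>w\<close> returns
  \<open>\<rho>\<close> and \<open>\<sigma>\<close>, and both are positive because
  \<open>m \<sigma> \<le> \<rho> \<le> M \<sigma>\<close>. Full rank of the marginal of
  \<open>\<Psi>\<close> lets a map be read off from its output state, which turns this map of states
  into a supermap.

  The obstacle in the integral formula is that \<open>\<rho>\<close> and \<open>\<sigma>\<close> do
  not commute. Derivatives in \<open>r\<close> are replaced by two-sided difference bounds: an
  effect optimal for one shift is still admissible for another. The constant of integration is found
  as \<open>r\<close> tends to infinity, where \<open>\<sigma> + r\<close> is squeezed between two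
  multiples of the identity, and these commute with \<open>\<rho>\<close>.\<close>

text \<open>Vectors and operators on \<open>\<complex>^n\<close> are functions \<^typ>\<open>nat \<Rightarrow> complex\<close> and \<^typ>\<open>nat \<Rightarrow> nat \<Rightarrow> complex\<close>
  of which only the values at indices below \<open>n\<close> are used. In \<open>spec n A u d\<close>, the eigenvector for \<open>d m\<close> is
  \<open>u m\<close>, so that \<open>u\<close> is the transpose of the diagonalizing unitary.\<close>

definition cin :: "nat \<Rightarrow> (nat \<Rightarrow> complex) \<Rightarrow> (nat \<Rightarrow> complex) \<Rightarrow> complex" where
  "cin n x y = (\<Sum>i<n. cnj (x i) * y i)"

definition qf :: "nat \<Rightarrow> (nat \<Rightarrow> nat \<Rightarrow> complex) \<Rightarrow> (nat \<Rightarrow> complex) \<Rightarrow> complex" where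
  "qf n A x = (\<Sum>i<n. \<Sum>j<n. cnj (x i) * A i j * x j)"

definition herm :: "nat \<Rightarrow> (nat \<Rightarrow> nat \<Rightarrow> complex) \<Rightarrow> bool" where
  "herm n A \<longleftrightarrow> (\<forall>i<n. \<forall>j<n. A j i = cnj (A i j))"

definition ortho :: "nat \<Rightarrow> nat \<Rightarrow> (nat \<Rightarrow> nat \<Rightarrow> complex) \<Rightarrow> bool" where
  "ortho n k u \<longleftrightarrow> (\<forall>l<k. \<forall>m<k. cin n (u l) (u m) = (if l = m then 1 else 0))"

definition spec :: "nat \<Rightarrow> (nat \<Rightarrow> nat \<Rightarrow> complex) \<Rightarrow> (nat \<Rightarrow> nat \<Rightarrow> complex) \<Rightarrow> (nat \<Rightarrow> real) \<Rightarrow> bool" where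
  "spec n A u d \<longleftrightarrow> ortho n n u \<and>
     (\<forall>i<n. \<forall>j<n. A i j = (\<Sum>m<n. of_real (d m) * u m i * cnj (u m j)))"

lemma sum_mult_delta:
  fixes f :: "nat \<Rightarrow> complex"
  assumes "i < n"
  shows "(\<Sum>j<n. f j * (if i = j then 1 else 0)) = f i" "(\<Sum>j<n. f j * (if j = i then 1 else 0)) = f i"
  using assms by (simp_all add: if_distrib[of "(*) _"] cong: if_cong)

lemma sum_lessThan_add: "(\<Sum>m<k + K. f m) = (\<Sum>m<k. f m) + (\<Sum>j<K. f (k + j))" for f :: "nat \<Rightarrow> complex"
  by (induct K) (simp_all add: add.assoc)

lemma cin_cnj: "cnj (cin n x y) = cin n y x"
  unfolding cin_def by (simp add: mult.commute)

lemma cin_self: "cin n x x = of_real (\<Sum>i<n. (cmod (x i))\<^sup>2)"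
  unfolding cin_def of_real_sum complex_norm_square by (simp add: mult.commute)

lemma cin_self_pos: "(\<exists>i<n. x i \<noteq> 0) \<Longrightarrow> (\<Sum>i<n. (cmod (x i))\<^sup>2) > 0"
  for n :: nat
  using sum_pos2[of "{..<n}" _ "\<lambda>i. (cmod (x i))\<^sup>2"] by auto

lemma nonzero_vec_index:
  assumes "v \<in> carrier_vec n" "v \<noteq> 0\<^sub>v n"
  shows "\<exists>i<n. v $ i \<noteq> (0 :: complex)"
proof (rule ccontr)
  assume "\<not> ?thesis"
  then have "v = 0\<^sub>v n" using assms(1) by (intro eq_vecI) auto
  then show False using assms(2) by contradiction
qed

text \<open>Padding the conditions with zero rows gives a square matrix. It is singular because row
  \<open>n - 1\<close> is zero, so that its transpose kills the last unit vector.\<close>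

lemma nonzero_orthogonal:
  assumes "length F < n"
  shows "\<exists>x. (\<exists>i<n. x i \<noteq> 0) \<and> (\<forall>f\<in>set F. cin n f x = 0)"
proof -
  let ?M = "mat n n (\<lambda>(i, j). if i < length F then cnj ((F ! i) j) else 0)"
  have M: "?M \<in> carrier_mat n n" by simp
  have "transpose_mat ?M *\<^sub>v unit_vec n (n - 1) = 0\<^sub>v n"
    using assms by (intro eq_vecI) (auto simp: scalar_prod_def intro!: sum.neutral)
  moreover have "unit_vec n (n - 1) \<noteq> (0\<^sub>v n :: complex Matrix.vec)"
    using assms by (auto simp: vec_eq_iff)
  ultimately have "\<exists>v. v \<in> carrier_vec n \<and> v \<noteq> 0\<^sub>v n \<and> transpose_mat ?M *\<^sub>v v = 0\<^sub>v n"
    by (intro exI[of _ "unit_vec n (n - 1)"] conjI) simp_all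
  then have "Determinant.det (transpose_mat ?M) = 0"
    by (subst det_0_iff_vec_prod_zero[of _ n]) auto
  then have "Determinant.det ?M = 0" using det_transpose[OF M] by simp
  then obtain v where v: "v \<in> carrier_vec n" "v \<noteq> 0\<^sub>v n" "?M *\<^sub>v v = 0\<^sub>v n"
    using det_0_iff_vec_prod_zero[OF M] by auto
  have "\<exists>i<n. v $ i \<noteq> 0" using v(1,2) by (rule nonzero_vec_index)
  moreover have "cin n f (\<lambda>i. v $ i) = 0" if "f \<in> set F" for f
  proof -
    obtain i where i: "i < length F" "f = F ! i" using \<open>f \<in> set F\<close> by (auto simp: in_set_conv_nth)
    have "(?M *\<^sub>v v) $ i = 0" using v(3) i assms by simp
    then show ?thesis using i assms v(1)
      by (simp add: scalar_prod_def cin_def lessThan_atLeast0)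
  qed
  ultimately show ?thesis by blast
qed

text \<open>Orthonormality says that the matrix with columns \<open>u m\<close> has its adjoint as
  left inverse; for square matrices this is also a right inverse, which is completeness.\<close>

lemma ortho_complete:
  assumes "ortho n n u" "i < n" "j < n"
  shows "(\<Sum>m<n. u m i * cnj (u m j)) = (if i = j then 1 else 0)"
proof -
  let ?U = "mat n n (\<lambda>(i, m). u m i)" and ?V = "mat n n (\<lambda>(m, i). cnj (u m i))"
  have "?V * ?U = 1\<^sub>m n"
    using assms(1) unfolding ortho_def cin_def
    by (intro eq_matI) (auto simp: scalar_prod_def lessThan_atLeast0)
  then have "?U * ?V = 1\<^sub>m n" by (intro mat_mult_left_right_inverse[of ?V n ?U]) auto
  then have "(?U * ?V) $$ (i, j) = (1\<^sub>m n :: complex mat) $$ (i, j)" by simp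
  then show ?thesis using assms(2,3) by (simp add: scalar_prod_def lessThan_atLeast0)
qed

lemma ortho_expand:
  assumes "ortho n n u" "i < n"
  shows "x i = (\<Sum>m<n. cin n (u m) x * u m i)"
proof -
  have "(\<Sum>m<n. cin n (u m) x * u m i) = (\<Sum>m<n. \<Sum>j<n. x j * (u m i * cnj (u m j)))"
    unfolding cin_def by (simp add: sum_distrib_right sum_distrib_left mult.commute mult.left_commute)
  also have "\<dots> = (\<Sum>j<n. x j * (\<Sum>m<n. u m i * cnj (u m j)))"
    by (subst sum.swap) (simp add: sum_distrib_left)
  also have "\<dots> = (\<Sum>j<n. x j * (if i = j then 1 else 0))"
    using ortho_complete[OF assms(1,2)] by simp
  also have "\<dots> = x i" using assms(2) by (rule sum_mult_delta)
  finally show ?thesis by simp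
qed

lemma parseval:
  assumes "ortho n n u"
  shows "(\<Sum>m<n. (cmod (cin n (u m) x))\<^sup>2) = (\<Sum>i<n. (cmod (x i))\<^sup>2)"
proof -
  have "complex_of_real (\<Sum>i<n. (cmod (x i))\<^sup>2) = (\<Sum>i<n. cnj (x i) * x i)"
    unfolding cin_self[symmetric] cin_def ..
  also have "\<dots> = (\<Sum>i<n. cnj (x i) * (\<Sum>m<n. cin n (u m) x * u m i))"
    using ortho_expand[OF assms, of _ x] by simp
  also have "\<dots> = (\<Sum>m<n. cin n (u m) x * (\<Sum>i<n. cnj (x i) * u m i))"
    by (simp only: sum_distrib_left) (subst sum.swap, simp add: mult_ac)
  also have "\<dots> = (\<Sum>m<n. cin n (u m) x * cnj (cin n (u m) x))"
    by (simp add: cin_cnj) (simp add: cin_def)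
  also have "\<dots> = of_real (\<Sum>m<n. (cmod (cin n (u m) x))\<^sup>2)"
    by (simp only: complex_norm_square of_real_sum)
  finally show ?thesis by (simp only: of_real_eq_iff)
qed

lemma cin_scale: "cin n (\<lambda>i. of_real c * x i) (\<lambda>i. of_real c * x i) = of_real (c\<^sup>2) * cin n x x"
  unfolding cin_def sum_distrib_left by (simp add: power2_eq_square mult_ac)

lemma normalize_exists:
  assumes "\<exists>i<n. x i \<noteq> 0"
  obtains c :: real where "c > 0" "cin n (\<lambda>i. of_real c * x i) (\<lambda>i. of_real c * x i) = 1"
proof -
  define N where "N = (\<Sum>i<n. (cmod (x i))\<^sup>2)"
  have N: "N > 0" using cin_self_pos[OF assms] unfolding N_def .
  have "cin n (\<lambda>i. of_real (1 / sqrt N) * x i) (\<lambda>i. of_real (1 / sqrt N) * x i)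
      = of_real ((1 / sqrt N)\<^sup>2 * N)"
    by (simp only: cin_scale cin_self of_real_mult N_def)
  also have "(1 / sqrt N)\<^sup>2 * N = 1" using N by (simp add: power_divide)
  finally show ?thesis using N that[of "1 / sqrt N"] by simp
qed

lemma ortho_extend:
  assumes "ortho n k u" "k \<le> n"
  shows "\<exists>v. ortho n n v \<and> (\<forall>m<k. v m = u m)"
  using assms
proof (induction "n - k" arbitrary: k u)
  case 0
  then show ?case by (intro exI[of _ u]) simp
next
  case (Suc p)
  have kn: "k < n" using Suc by simp
  obtain x where x: "\<exists>i<n. x i \<noteq> 0" "\<forall>f\<in>set (map u [0..<k]). cin n f x = 0"
    using nonzero_orthogonal[of "map u [0..<k]" n] kn by auto
  obtain c :: real where c: "cin n (\<lambda>i. of_real c * x i) (\<lambda>i. of_real c * x i) = 1"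
    using normalize_exists[OF x(1)] by blast
  define w where "w = u(k := (\<lambda>i. of_real c * x i))"
  have z: "cin n (u m) (\<lambda>i. of_real c * x i) = 0" if "m < k" for m
  proof -
    have "cin n (u m) (\<lambda>i. of_real c * x i) = of_real c * cin n (u m) x"
      unfolding cin_def by (simp add: sum_distrib_left mult_ac)
    then show ?thesis using x(2) that by auto
  qed
  then have z': "cin n (\<lambda>i. of_real c * x i) (u m) = 0" if "m < k" for m
    using that cin_cnj[of n "u m" "\<lambda>i. of_real c * x i"] by simp
  have "ortho n (Suc k) w"
    using Suc.prems(1) c z z' unfolding ortho_def w_def by (auto simp: less_Suc_eq)
  moreover have "p = n - Suc k" using Suc.hyps(2) by simp
  ultimately obtain v where "ortho n n v" "\<forall>m<Suc k. v m = w m"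
    using Suc.hyps(1)[of "Suc k" w] kn by auto
  then show ?case unfolding w_def by auto
qed

section \<open>The spectral theorem for Hermitian matrices\<close>

lemma spec_eigen:
  assumes "spec n A u d" "m < n" "i < n"
  shows "(\<Sum>j<n. A i j * u m j) = of_real (d m) * u m i"
proof -
  have "(\<Sum>j<n. A i j * u m j) = (\<Sum>j<n. \<Sum>l<n. of_real (d l) * u l i * cnj (u l j) * u m j)"
    using assms by (simp add: spec_def sum_distrib_right)
  also have "\<dots> = (\<Sum>l<n. of_real (d l) * u l i * cin n (u l) (u m))"
    unfolding cin_def by (subst sum.swap) (simp add: sum_distrib_left mult_ac)
  also have "\<dots> = (\<Sum>l<n. of_real (d l) * u l i * (if l = m then 1 else 0))"
    using assms unfolding spec_def ortho_def by simp
  also have "\<dots> = of_real (d m) * u m i" using assms(2) by (rule sum_mult_delta)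
  finally show ?thesis .
qed

lemma spec_of_eigen:
  assumes u: "ortho n n u"
    and e: "\<And>m i. m < n \<Longrightarrow> i < n \<Longrightarrow> (\<Sum>j<n. A i j * u m j) = of_real (d m) * u m i"
  shows "spec n A u d"
  unfolding spec_def
proof (intro conjI allI impI u)
  fix i j assume ij: "i < n" "j < n"
  have "(\<Sum>m<n. of_real (d m) * u m i * cnj (u m j)) = (\<Sum>m<n. \<Sum>q<n. A i q * u m q * cnj (u m j))"
    using e ij(1) by (simp add: sum_distrib_right[symmetric])
  also have "\<dots> = (\<Sum>q<n. A i q * (\<Sum>m<n. u m q * cnj (u m j)))"
    by (subst sum.swap) (simp add: sum_distrib_left mult_ac)
  also have "\<dots> = (\<Sum>q<n. A i q * (if q = j then 1 else 0))"
    using ortho_complete[OF u _ ij(2)] by simp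
  also have "\<dots> = A i j" using ij(2) by (rule sum_mult_delta)
  finally show "A i j = (\<Sum>m<n. of_real (d m) * u m i * cnj (u m j))" by simp
qed

lemma herm_swap:
  assumes "herm n A"
  shows "cin n x (\<lambda>i. \<Sum>j<n. A i j * y j) = cin n (\<lambda>i. \<Sum>j<n. A i j * x j) y"
proof -
  have "cin n x (\<lambda>i. \<Sum>j<n. A i j * y j) = (\<Sum>i<n. \<Sum>j<n. cnj (x i) * A i j * y j)"
    unfolding cin_def by (simp add: sum_distrib_left mult_ac)
  also have "\<dots> = (\<Sum>j<n. \<Sum>i<n. cnj (x i) * A i j * y j)" by (rule sum.swap)
  also have "\<dots> = (\<Sum>j<n. \<Sum>i<n. cnj (A j i * x i) * y j)"
  proof (intro sum.cong refl)
    fix i j assume "j \<in> {..<n}" "i \<in> {..<n}"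
    then have "A i j = cnj (A j i)" using assms unfolding herm_def by blast
    then show "cnj (x i) * A i j * y j = cnj (A j i * x i) * y j" by simp
  qed
  also have "\<dots> = cin n (\<lambda>i. \<Sum>j<n. A i j * x j) y"
    unfolding cin_def by (simp add: sum_distrib_right)
  finally show ?thesis .
qed

text \<open>Induction on the number of eigenvectors. The orthogonal complement of those already
  found is invariant because \<open>A\<close> is Hermitian, so an eigenvector of the compression of
  \<open>A\<close> to it is an eigenvector of \<open>A\<close>.\<close>

lemma herm_eigenvectors:
  assumes A: "herm n A" and "k \<le> n"
  shows "\<exists>u d. ortho n k u \<and> (\<forall>m<k. \<forall>i<n. (\<Sum>j<n. A i j * u m j) = of_real (d m :: real) * u m i)"
  using \<open>k \<le> n\<close>
proof (induction k)
  case 0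
  then show ?case by (auto simp: ortho_def)
next
  case (Suc k)
  then obtain u d where u: "ortho n k u"
    "\<And>m i. m < k \<Longrightarrow> i < n \<Longrightarrow> (\<Sum>j<n. A i j * u m j) = of_real (d m :: real) * u m i" by auto
  obtain v where v: "ortho n n v" "\<And>m. m < k \<Longrightarrow> v m = u m"
    using ortho_extend[OF u(1)] Suc by auto
  define K where "K = n - k"
  have K: "K > 0" "n = k + K" using Suc K_def by auto
  let ?B = "mat K K (\<lambda>(i, j). cin n (v (k + i)) (\<lambda>p. \<Sum>q<n. A p q * v (k + j) q))"
  obtain y0 \<mu> where y0: "y0 \<in> carrier_vec K" "y0 \<noteq> 0\<^sub>v K" "?B *\<^sub>v y0 = \<mu> \<cdot>\<^sub>v y0"
    using spectrum_non_empty[of ?B K] K(1) unfolding spectrum_def eigenvalue_def eigenvector_def by auto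
  define y where "y = (\<lambda>j. y0 $ j)"
  have y1: "\<exists>j<K. y j \<noteq> 0" unfolding y_def using y0(1,2) by (rule nonzero_vec_index)
  have By: "(\<Sum>j<K. cin n (v (k + i)) (\<lambda>p. \<Sum>q<n. A p q * v (k + j) q) * y j) = \<mu> * y i" if "i < K" for i
  proof -
    have "(?B *\<^sub>v y0) $ i = (\<mu> \<cdot>\<^sub>v y0) $ i" using y0 by simp
    then show ?thesis using that y0(1) by (simp add: scalar_prod_def y_def lessThan_atLeast0)
  qed
  define x where "x = (\<lambda>p. \<Sum>j<K. y j * v (k + j) p)"
  define Ax where "Ax = (\<lambda>p. \<Sum>q<n. A p q * x q)"
  have cx: "cin n (v m) x = (\<Sum>j<K. y j * (if m = k + j then 1 else 0))" if "m < n" for m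
  proof -
    have "cin n (v m) x = (\<Sum>i<n. \<Sum>j<K. y j * (cnj (v m i) * v (k + j) i))"
      unfolding cin_def x_def by (simp add: sum_distrib_left mult_ac)
    also have "\<dots> = (\<Sum>j<K. y j * cin n (v m) (v (k + j)))"
      unfolding cin_def by (subst sum.swap) (simp add: sum_distrib_left)
    also have "\<dots> = (\<Sum>j<K. y j * (if m = k + j then 1 else 0))"
      using v(1) that K unfolding ortho_def by (intro sum.cong) auto
    finally show ?thesis .
  qed
  \<comment> \<open>Invariance of the complement: moved to the other side, \<open>A\<close> meets an
    eigenvector that is orthogonal to \<open>x\<close>.\<close>
  have lo: "cin n (v m) Ax = 0" if "m < k" for m
  proof -
    have "cin n (v m) Ax = cin n (\<lambda>i. \<Sum>j<n. A i j * v m j) x"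
      unfolding Ax_def by (rule herm_swap[OF A])
    also have "\<dots> = cin n (\<lambda>i. of_real (d m) * v m i) x"
      unfolding cin_def using u(2)[OF that] v(2)[OF that] by simp
    also have "\<dots> = of_real (d m) * cin n (v m) x"
      unfolding cin_def by (simp add: sum_distrib_left mult_ac)
    also have "cin n (v m) x = 0" using cx[of m] that K by simp
    finally show ?thesis by simp
  qed
  have hi: "cin n (v (k + i)) Ax = \<mu> * y i" if "i < K" for i
  proof -
    have "Ax p = (\<Sum>j<K. (\<Sum>q<n. A p q * v (k + j) q) * y j)" for p
      unfolding Ax_def x_def sum_distrib_left sum_distrib_right
      by (subst sum.swap) (simp add: mult_ac)
    then have "cin n (v (k + i)) Ax = (\<Sum>p<n. cnj (v (k + i) p) * (\<Sum>j<K. (\<Sum>q<n. A p q * v (k + j) q) * y j))"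
      unfolding cin_def by simp
    also have "\<dots> = (\<Sum>p<n. \<Sum>j<K. cnj (v (k + i) p) * (\<Sum>q<n. A p q * v (k + j) q) * y j)"
      by (intro sum.cong refl, subst sum_distrib_left) (simp add: mult.assoc)
    also have "\<dots> = (\<Sum>j<K. cin n (v (k + i)) (\<lambda>p. \<Sum>q<n. A p q * v (k + j) q) * y j)"
      unfolding cin_def by (subst sum.swap) (simp only: sum_distrib_right)
    finally show ?thesis using By[OF that] by simp
  qed
  have eig: "Ax p = \<mu> * x p" if "p < n" for p
  proof -
    have "Ax p = (\<Sum>m<k + K. cin n (v m) Ax * v m p)"
      using ortho_expand[OF v(1) that, of Ax] K(2) by simp
    also have "\<dots> = (\<Sum>m<k. cin n (v m) Ax * v m p) + (\<Sum>j<K. cin n (v (k + j)) Ax * v (k + j) p)"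
      by (rule sum_lessThan_add)
    also have "\<dots> = (\<Sum>j<K. \<mu> * y j * v (k + j) p)" using lo hi by simp
    also have "\<dots> = \<mu> * x p" unfolding x_def by (simp add: sum_distrib_left mult.assoc)
    finally show ?thesis .
  qed
  have xnz: "\<exists>i<n. x i \<noteq> 0"
  proof (rule ccontr)
    assume "\<not> ?thesis"
    then have z: "cin n (v m) x = 0" for m unfolding cin_def by simp
    obtain j where j: "j < K" "y j \<noteq> 0" using y1 by auto
    have "cin n (v (k + j)) x = y j" using cx[of "k + j"] j K sum_mult_delta(1)[OF j(1), of y] by simp
    then show False using z j by simp
  qed
  have real: "\<mu> = of_real (Re \<mu>)"
  proof -
    have e: "cin n x Ax = \<mu> * cin n x x" "cin n Ax x = cnj \<mu> * cin n x x"
      unfolding cin_def using eig by (simp_all add: sum_distrib_left mult_ac)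
    have "cin n x Ax = cin n Ax x" unfolding Ax_def by (rule herm_swap[OF A])
    moreover have "cin n x x \<noteq> 0" using cin_self_pos[OF xnz] unfolding cin_self by (simp only: of_real_eq_0_iff)
    ultimately have "\<mu> = cnj \<mu>" using e by simp
    then have "\<mu> \<in> \<real>" by (simp add: Reals_cnj_iff)
    then show ?thesis by simp
  qed
  obtain c :: real where c: "cin n (\<lambda>i. of_real c * x i) (\<lambda>i. of_real c * x i) = 1"
    using normalize_exists[OF xnz] by blast
  define z where "z = (\<lambda>i. of_real c * x i)"
  have uz: "cin n (u m) z = 0" if "m < k" for m
  proof -
    have "cin n (u m) z = of_real c * cin n (v m) x"
      unfolding cin_def z_def using v(2)[OF that] by (simp add: sum_distrib_left mult_ac)
    then show ?thesis using cx[of m] that K by simp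
  qed
  then have zu: "cin n z (u m) = 0" if "m < k" for m
    using that cin_cnj[of n "u m" z] by simp
  have "ortho n (Suc k) (u(k := z))"
    using u(1) c uz zu unfolding ortho_def z_def[symmetric]
    by (auto simp: less_Suc_eq fun_upd_def)
  moreover have "(\<Sum>j<n. A i j * z j) = of_real (Re \<mu>) * z i" if "i < n" for i
  proof -
    have "(\<Sum>j<n. A i j * z j) = of_real c * Ax i"
      unfolding Ax_def z_def by (simp add: sum_distrib_left mult_ac)
    also have "\<dots> = of_real c * (\<mu> * x i)" using eig[OF that] by simp
    also have "\<dots> = \<mu> * z i" unfolding z_def by simp
    finally show ?thesis using real by simp
  qed
  ultimately show ?case using u(2)
    by (intro exI[of _ "u(k := z)"] exI[of _ "d(k := Re \<mu>)"] conjI) (auto simp: less_Suc_eq fun_upd_def)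
qed

lemma herm_spec:
  assumes "herm n A"
  obtains u d where "spec n A u d"
proof -
  obtain u and d :: "nat \<Rightarrow> real" where "ortho n n u"
    and "\<And>m i. m < n \<Longrightarrow> i < n \<Longrightarrow> (\<Sum>j<n. A i j * u m j) = of_real (d m) * u m i"
    using herm_eigenvectors[OF assms order.refl] by auto
  then show thesis by (intro that spec_of_eigen)
qed

subsection \<open>The trace of the positive part\<close>

definition idm :: "nat \<Rightarrow> nat \<Rightarrow> complex" where
  "idm i j = (if i = j then 1 else 0)"

definition pos :: "nat \<Rightarrow> (nat \<Rightarrow> nat \<Rightarrow> complex) \<Rightarrow> bool" where
  "pos n A \<longleftrightarrow> (\<forall>x. 0 \<le> qf n A x)"

text \<open>The real part of the Hilbert-Schmidt pairing \<open>tr (A B)\<close>.\<close>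

definition ip :: "nat \<Rightarrow> (nat \<Rightarrow> nat \<Rightarrow> complex) \<Rightarrow> (nat \<Rightarrow> nat \<Rightarrow> complex) \<Rightarrow> real" where
  "ip n A B = Re (\<Sum>i<n. \<Sum>j<n. A i j * B j i)"

definition eff :: "nat \<Rightarrow> (nat \<Rightarrow> nat \<Rightarrow> complex) \<Rightarrow> bool" where
  "eff n P \<longleftrightarrow> pos n P \<and> pos n (\<lambda>i j. idm i j - P i j)"

text \<open>\<open>tr X\<^sub>+\<close>, in variational form.\<close>

definition tp :: "nat \<Rightarrow> (nat \<Rightarrow> nat \<Rightarrow> complex) \<Rightarrow> real" where
  "tp n X = (SUP P\<in>{P. eff n P}. ip n P X)"

lemma sum3_rotate:
  "(\<Sum>i\<in>A. \<Sum>j\<in>B. \<Sum>m\<in>C. f i j m) = (\<Sum>m\<in>C. \<Sum>i\<in>A. \<Sum>j\<in>B. f i j m)"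
proof -
  have "(\<Sum>i\<in>A. \<Sum>j\<in>B. \<Sum>m\<in>C. f i j m) = (\<Sum>i\<in>A. \<Sum>m\<in>C. \<Sum>j\<in>B. f i j m)"
    by (rule sum.cong[OF refl sum.swap])
  also have "\<dots> = (\<Sum>m\<in>C. \<Sum>i\<in>A. \<Sum>j\<in>B. f i j m)" by (rule sum.swap)
  finally show ?thesis .
qed

section \<open>Quadratic forms and their polarization\<close>

lemma qf_add: "qf n (\<lambda>i j. A i j + B i j) x = qf n A x + qf n B x"
  unfolding qf_def by (simp add: distrib_left distrib_right sum.distrib)

lemma qf_scale: "qf n (\<lambda>i j. c * A i j) x = c * qf n A x"
  unfolding qf_def sum_distrib_left by (simp add: mult_ac)

lemma qf_diff: "qf n (\<lambda>i j. A i j - B i j) x = qf n A x - qf n B x"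
  unfolding qf_def by (simp add: left_diff_distrib right_diff_distrib sum_subtractf)

lemma qf_uminus: "qf n (\<lambda>i j. - A i j) x = - qf n A x"
  unfolding qf_def by (simp add: sum_negf)

lemmas qf_simps = qf_add qf_scale qf_diff qf_uminus

lemma qf_cong: "(\<And>i j. i < n \<Longrightarrow> j < n \<Longrightarrow> A i j = B i j) \<Longrightarrow> qf n A x = qf n B x"
  unfolding qf_def by (intro sum.cong) auto

lemma qf_cong_vec: "(\<And>i. i < n \<Longrightarrow> x i = y i) \<Longrightarrow> qf n A x = qf n A y"
  unfolding qf_def by (intro sum.cong) auto

lemma qf_cin: "qf n A x = cin n x (\<lambda>i. \<Sum>j<n. A i j * x j)"
  unfolding qf_def cin_def by (simp add: sum_distrib_left mult_ac)

lemma qf_idm: "qf n idm x = cin n x x"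
proof -
  have "(\<Sum>j<n. idm i j * x j) = x i" if "i < n" for i
    using sum_mult_delta(1)[OF that, of x] by (simp add: idm_def mult.commute)
  then show ?thesis unfolding qf_cin cin_def by simp
qed

lemma qf_spec:
  assumes "spec n A u d"
  shows "qf n A x = of_real (\<Sum>m<n. d m * (cmod (cin n (u m) x))\<^sup>2)"
proof -
  have "qf n A x = (\<Sum>i<n. \<Sum>j<n. \<Sum>m<n. of_real (d m) * (cnj (x i) * u m i) * (cnj (u m j) * x j))"
    unfolding qf_def using assms by (simp add: spec_def sum_distrib_left sum_distrib_right mult_ac)
  also have "\<dots> = (\<Sum>m<n. \<Sum>i<n. \<Sum>j<n. of_real (d m) * (cnj (x i) * u m i) * (cnj (u m j) * x j))"
    by (rule sum3_rotate)
  also have "\<dots> = (\<Sum>m<n. of_real (d m) * cin n x (u m) * cin n (u m) x)"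
    unfolding cin_def by (simp add: sum_distrib_left sum_distrib_right mult_ac)
  also have "\<dots> = (\<Sum>m<n. of_real (d m * (cmod (cin n (u m) x))\<^sup>2))"
  proof (intro sum.cong refl)
    fix m
    show "of_real (d m) * cin n x (u m) * cin n (u m) x = of_real (d m * (cmod (cin n (u m) x))\<^sup>2)"
      unfolding of_real_mult complex_norm_square cin_cnj by (simp add: mult_ac)
  qed
  finally show ?thesis by simp
qed

lemma qf_two:
  assumes "i < n" "j < n" "i \<noteq> j"
  shows "qf n A (\<lambda>k. if k = i then 1 else if k = j then z else 0)
    = A i i + z * cnj z * A j j + z * A i j + cnj z * A j i"
proof -
  let ?x = "\<lambda>k. if k = i then 1 else if k = j then z else 0"
  have s: "(\<Sum>q<n. f q * ?x q) = f i + f j * z" for f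
  proof -
    have "(\<Sum>q<n. f q * ?x q) = (\<Sum>q\<in>{i, j}. f q * ?x q)"
      using assms by (intro sum.mono_neutral_right) auto
    then show ?thesis using assms by simp
  qed
  have s': "(\<Sum>q<n. cnj (?x q) * f q) = f i + cnj z * f j" for f
  proof -
    have "(\<Sum>q<n. cnj (?x q) * f q) = (\<Sum>q\<in>{i, j}. cnj (?x q) * f q)"
      using assms by (intro sum.mono_neutral_right) auto
    then show ?thesis using assms by simp
  qed
  show ?thesis unfolding qf_cin cin_def s s' by (simp add: algebra_simps)
qed

text \<open>Polarization: in \<open>qf_two\<close>, once the diagonal is known to be real,
  \<open>z = 1\<close> compares the imaginary parts of \<open>A i j\<close> and
  \<open>A j i\<close>, and \<open>z = \<i>\<close> their real parts.\<close>

lemma qf_real_herm: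
  assumes r: "\<And>x. Im (qf n A x) = 0"
  shows "herm n A"
  unfolding herm_def
proof (intro allI impI)
  fix i j assume ij: "i < n" "j < n"
  show "A j i = cnj (A i j)"
  proof (cases "i = j")
    case True
    have "(\<Sum>k<n. f k * (if k = i then 1 else 0)) = f i" for f :: "nat \<Rightarrow> complex"
      using sum_mult_delta(2)[OF ij(1)] .
    moreover have "(\<Sum>k<n. cnj (if k = i then 1 else 0) * f k) = f i" for f :: "nat \<Rightarrow> complex"
      using sum_mult_delta(2)[OF ij(1), of f] by (simp add: mult.commute if_distrib[of cnj] cong: if_cong)
    ultimately have "qf n A (\<lambda>k. if k = i then 1 else 0) = A i i"
      unfolding qf_cin cin_def by simp
    then have "Im (A i i) = 0" using r by metis
    then show ?thesis using True by (simp add: complex_eq_iff)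
  next
    case False
    have d: "Im (A k k) = 0" if "k < n" for k
    proof -
      have "(\<Sum>l<n. f l * (if l = k then 1 else 0)) = f k" for f :: "nat \<Rightarrow> complex"
        using sum_mult_delta(2)[OF that] .
      moreover have "(\<Sum>l<n. cnj (if l = k then 1 else 0) * f l) = f k" for f :: "nat \<Rightarrow> complex"
        using sum_mult_delta(2)[OF that, of f] by (simp add: mult.commute if_distrib[of cnj] cong: if_cong)
      ultimately have "qf n A (\<lambda>l. if l = k then 1 else 0) = A k k"
        unfolding qf_cin cin_def by simp
      then show ?thesis using r by metis
    qed
    have "Im (A i i + 1 * cnj 1 * A j j + 1 * A i j + cnj 1 * A j i) = 0"
      using r[of "\<lambda>k. if k = i then 1 else if k = j then 1 else 0"] qf_two[OF ij False, of A 1] by simp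
    moreover have "Im (A i i + \<i> * cnj \<i> * A j j + \<i> * A i j + cnj \<i> * A j i) = 0"
      using r[of "\<lambda>k. if k = i then 1 else if k = j then \<i> else 0"] qf_two[OF ij False, of A \<i>] by simp
    ultimately show ?thesis using d[OF ij(1)] d[OF ij(2)] by (simp add: complex_eq_iff)
  qed
qed

lemma pos_herm: "pos n A \<Longrightarrow> herm n A"
  by (rule qf_real_herm) (simp add: pos_def less_eq_complex_def)

lemma herm_qf_real: "herm n A \<Longrightarrow> Im (qf n A x) = 0"
proof -
  assume "herm n A"
  then obtain u d where "spec n A u d" using herm_spec by blast
  then show ?thesis by (simp add: qf_spec)
qed

lemma posI: "herm n A \<Longrightarrow> (\<And>x. 0 \<le> Re (qf n A x)) \<Longrightarrow> pos n A"
  using herm_qf_real by (simp add: pos_def less_eq_complex_def)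

lemma posD: "pos n A \<Longrightarrow> 0 \<le> Re (qf n A x)"
  by (simp add: pos_def less_eq_complex_def)

lemma herm_diff_scale:
  "herm n A \<Longrightarrow> herm n B \<Longrightarrow> herm n (\<lambda>i j. A i j - of_real s * B i j)"
  by (rule qf_real_herm) (simp add: qf_simps herm_qf_real)

lemma herm_add_scale:
  "herm n A \<Longrightarrow> herm n B \<Longrightarrow> herm n (\<lambda>i j. A i j + of_real s * B i j)"
  by (rule qf_real_herm) (simp add: qf_simps herm_qf_real)

lemma herm_diff: "herm n A \<Longrightarrow> herm n B \<Longrightarrow> herm n (\<lambda>i j. A i j - B i j)"
  using herm_diff_scale[of n A B 1] by simp

lemma herm_uminus: "herm n A \<Longrightarrow> herm n (\<lambda>i j. - A i j)"
  by (rule qf_real_herm) (simp add: qf_simps herm_qf_real)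

lemma pos_idm: "pos n idm"
  unfolding pos_def qf_idm cin_self by (auto simp: less_eq_complex_def intro!: sum_nonneg)

lemma spec_idm: "ortho n n u \<Longrightarrow> spec n idm u (\<lambda>_. 1)"
  using ortho_complete unfolding spec_def idm_def by simp

lemma spec_sum: "ortho n n u \<Longrightarrow> spec n (\<lambda>i j. \<Sum>m<n. of_real (d m) * u m i * cnj (u m j)) u d"
  unfolding spec_def by simp

lemma spec_comb:
  assumes "spec n A u d" "spec n B u e"
  shows "spec n (\<lambda>i j. of_real a * A i j + of_real b * B i j) u (\<lambda>m. a * d m + b * e m)"
  using assms unfolding spec_def by (simp add: sum_distrib_left sum.distrib algebra_simps)

lemma spec_diff:
  assumes "spec n A u d" "spec n B u e"
  shows "spec n (\<lambda>i j. A i j - B i j) u (\<lambda>m. d m - e m)"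
  using spec_comb[OF assms, of 1 "-1"] by simp

lemma spec_herm: "spec n A u d \<Longrightarrow> herm n A"
  by (rule qf_real_herm) (simp add: qf_spec)

lemma spec_pos: "spec n A u d \<Longrightarrow> (\<And>m. m < n \<Longrightarrow> 0 \<le> d m) \<Longrightarrow> pos n A"
  unfolding pos_def by (auto simp: qf_spec less_eq_complex_def intro!: sum_nonneg)

lemma qf_spec_vec:
  assumes "spec n A u d" "m < n"
  shows "qf n A (u m) = of_real (d m)"
proof -
  have "(\<Sum>l<n. d l * (cmod (cin n (u l) (u m)))\<^sup>2) = (\<Sum>l<n. if l = m then d m else 0)"
    using assms unfolding spec_def ortho_def by (intro sum.cong) auto
  then show ?thesis using assms(2) by (simp add: qf_spec[OF assms(1)])
qed

lemma spec_pos_nonneg: "spec n A u d \<Longrightarrow> pos n A \<Longrightarrow> m < n \<Longrightarrow> 0 \<le> d m"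
  using qf_spec_vec[of n A u d m] posD[of n A "u m"] by (simp add: pos_def less_eq_complex_def)

lemma spec_trace:
  assumes "spec n A u d"
  shows "Re (\<Sum>i<n. A i i) = (\<Sum>m<n. d m)"
proof -
  have "(\<Sum>i<n. A i i) = (\<Sum>i<n. \<Sum>m<n. of_real (d m) * (cnj (u m i) * u m i))"
    using assms by (simp add: spec_def mult_ac)
  also have "\<dots> = (\<Sum>m<n. of_real (d m) * cin n (u m) (u m))"
    unfolding cin_def by (subst sum.swap) (simp add: sum_distrib_left)
  also have "\<dots> = (\<Sum>m<n. of_real (d m))"
    using assms by (simp add: spec_def ortho_def)
  finally show ?thesis by simp
qed

lemma ip_spec:
  assumes "spec n B u d"
  shows "ip n A B = (\<Sum>m<n. d m * Re (qf n A (u m)))"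
proof -
  have "(\<Sum>i<n. \<Sum>j<n. A i j * B j i)
      = (\<Sum>i<n. \<Sum>j<n. \<Sum>m<n. of_real (d m) * (cnj (u m i) * A i j * u m j))"
    using assms by (simp add: spec_def sum_distrib_left mult_ac)
  also have "\<dots> = (\<Sum>m<n. \<Sum>i<n. \<Sum>j<n. of_real (d m) * (cnj (u m i) * A i j * u m j))"
    by (rule sum3_rotate)
  also have "\<dots> = (\<Sum>m<n. of_real (d m) * qf n A (u m))"
    unfolding qf_def by (simp add: sum_distrib_left)
  finally show ?thesis unfolding ip_def by simp
qed

lemma ip_diff: "ip n P (\<lambda>i j. A i j - B i j) = ip n P A - ip n P B"
  unfolding ip_def by (simp add: right_diff_distrib sum_subtractf)

lemma ip_scale: "ip n P (\<lambda>i j. of_real s * A i j) = s * ip n P A"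
proof -
  have "(\<Sum>i<n. \<Sum>j<n. P i j * (of_real s * A j i)) = of_real s * (\<Sum>i<n. \<Sum>j<n. P i j * A j i)"
    unfolding sum_distrib_left by (simp add: mult_ac)
  then show ?thesis unfolding ip_def by simp
qed

lemma ip_commute: "ip n A B = ip n B A"
  unfolding ip_def by (subst sum.swap) (simp add: mult.commute)

lemma ip_diff_left: "ip n (\<lambda>i j. P i j - Q i j) A = ip n P A - ip n Q A"
  using ip_diff[of n A P Q] by (simp only: ip_commute[of n _ A])

lemma ip_idm: "ip n idm B = Re (\<Sum>i<n. B i i)"
proof -
  have "(\<Sum>j<n. idm i j * B j i) = B i i" if "i < n" for i
    using sum_mult_delta(1)[OF that, of "\<lambda>j. B j i"] by (simp add: idm_def mult.commute)
  then show ?thesis unfolding ip_def by simp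
qed

lemma ip_pos:
  assumes "pos n A" "pos n B"
  shows "0 \<le> ip n A B"
proof -
  obtain u d where s: "spec n B u d" using herm_spec[OF pos_herm[OF assms(2)]] .
  show ?thesis unfolding ip_spec[OF s]
    using spec_pos_nonneg[OF s assms(2)] posD[OF assms(1)] by (auto intro!: sum_nonneg)
qed

lemma eff_idm: "eff n idm"
  unfolding eff_def using pos_idm by (simp add: pos_def qf_def)

lemma ip_eff_le: "eff n P \<Longrightarrow> pos n Y \<Longrightarrow> ip n P Y \<le> Re (\<Sum>i<n. Y i i)"
  using ip_pos[of n "\<lambda>i j. idm i j - P i j" Y] unfolding ip_diff_left ip_idm eff_def by simp

lemma ip_eff_nonneg: "eff n P \<Longrightarrow> pos n Y \<Longrightarrow> 0 \<le> ip n P Y"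
  using ip_pos unfolding eff_def by blast

lemma eff_qf_le:
  assumes "eff n P" "ortho n n u" "m < n"
  shows "Re (qf n P (u m)) \<le> 1"
proof -
  have "cin n (u m) (u m) = 1" using assms by (simp add: ortho_def)
  moreover have "0 \<le> Re (qf n idm (u m) - qf n P (u m))"
    using assms(1) posD unfolding eff_def qf_diff[symmetric] by blast
  ultimately show ?thesis by (simp add: qf_idm)
qed

lemma ip_le_spec:
  assumes "spec n X u d" "eff n P"
  shows "ip n P X \<le> (\<Sum>m<n. max 0 (d m))"
  unfolding ip_spec[OF assms(1)]
proof (rule sum_mono)
  fix m assume "m \<in> {..<n}"
  then have "Re (qf n P (u m)) \<le> 1" "0 \<le> Re (qf n P (u m))"
    using eff_qf_le[OF assms(2)] assms posD unfolding spec_def eff_def by auto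
  then show "d m * Re (qf n P (u m)) \<le> max 0 (d m)"
    by (cases "0 \<le> d m") (auto simp: mult_left_le mult_nonpos_nonneg max_def)
qed

text \<open>The effect is the projection onto the eigenvectors with positive eigenvalue. Its rank is
  recorded because it bounds how fast \<open>tp\<close> falls when a multiple of the identity is
  subtracted.\<close>

lemma spec_effect:
  assumes s: "spec n X u d"
  shows "\<exists>P. eff n P \<and> ip n P X = (\<Sum>m<n. max 0 (d m)) \<and> ip n P idm = real (card {m. m < n \<and> d m > 0})"
proof -
  have o: "ortho n n u" using s by (simp add: spec_def)
  define e where "e = (\<lambda>m. if d m > 0 then 1 else (0::real))"
  define P where "P = (\<lambda>i j. \<Sum>m<n. of_real (e m) * u m i * cnj (u m j))"
  have P: "spec n P u e" unfolding P_def by (rule spec_sum[OF o])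
  have "pos n P" by (rule spec_pos[OF P]) (simp add: e_def)
  moreover have "pos n (\<lambda>i j. idm i j - P i j)"
    by (rule spec_pos[OF spec_diff[OF spec_idm[OF o] P]]) (simp add: e_def)
  moreover have "ip n P X = (\<Sum>m<n. max 0 (d m))"
    unfolding ip_spec[OF s] using qf_spec_vec[OF P] by (intro sum.cong) (auto simp: e_def max_def)
  moreover have "ip n P idm = real (card {m. m < n \<and> d m > 0})"
  proof -
    have "ip n P idm = (\<Sum>m<n. e m)"
      unfolding ip_spec[OF spec_idm[OF o]] using qf_spec_vec[OF P] by (intro sum.cong) auto
    also have "\<dots> = (\<Sum>m\<in>{m. m < n \<and> d m > 0}. 1)"
      unfolding e_def by (intro sum.mono_neutral_cong_right) auto
    finally show ?thesis by simp
  qed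
  ultimately show ?thesis unfolding eff_def by blast
qed

text \<open>The supremum is attained at the projection from \<open>spec_effect\<close>. The
  variational form pays off in comparisons: an effect optimal for one operator is tested on
  another.\<close>

lemma tp_spec:
  assumes s: "spec n X u d"
  shows "tp n X = (\<Sum>m<n. max 0 (d m))"
proof -
  obtain P where P: "eff n P" "ip n P X = (\<Sum>m<n. max 0 (d m))" using spec_effect[OF s] by auto
  show ?thesis unfolding tp_def
    by (rule cSup_eq_maximum) (use P ip_le_spec[OF s] in \<open>auto simp: image_iff\<close>)
qed

lemma tp_ge:
  assumes "herm n X" "eff n P"
  shows "ip n P X \<le> tp n X"
proof -
  obtain u d where s: "spec n X u d" using herm_spec[OF assms(1)] .
  show ?thesis using ip_le_spec[OF s assms(2)] tp_spec[OF s] by simp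
qed

lemma tp_attained:
  assumes "herm n X"
  obtains P where "eff n P" "ip n P X = tp n X"
proof -
  obtain u d where s: "spec n X u d" using herm_spec[OF assms(1)] .
  then show thesis using spec_effect[OF s] tp_spec[OF s] that by auto
qed

lemma tp_ge_trace: "herm n X \<Longrightarrow> Re (\<Sum>i<n. X i i) \<le> tp n X"
  using tp_ge[OF _ eff_idm] by (simp only: ip_idm)

lemma tp_mono:
  assumes "herm n X" "herm n Y" "pos n (\<lambda>i j. Y i j - X i j)"
  shows "tp n X \<le> tp n Y"
proof -
  obtain P where P: "eff n P" "ip n P X = tp n X" using tp_attained[OF assms(1)] .
  have "0 \<le> ip n P (\<lambda>i j. Y i j - X i j)" using ip_eff_nonneg[OF P(1) assms(3)] .
  then show ?thesis using tp_ge[OF assms(2) P(1)] P(2) by (simp add: ip_diff)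
qed

lemma tp_eq_0_iff:
  assumes "herm n X"
  shows "tp n X = 0 \<longleftrightarrow> pos n (\<lambda>i j. - X i j)"
proof -
  obtain u d where s: "spec n X u d" using herm_spec[OF assms(1)] .
  have s': "spec n (\<lambda>i j. - X i j) u (\<lambda>m. - d m)"
    using spec_comb[OF s s, of "-1" 0] by simp
  have "tp n X = 0 \<longleftrightarrow> (\<forall>m<n. max 0 (d m) = 0)"
    unfolding tp_spec[OF s] by (subst sum_nonneg_eq_0_iff) auto
  also have "\<dots> \<longleftrightarrow> (\<forall>m<n. 0 \<le> - d m)"
  proof -
    have "max 0 r = 0 \<longleftrightarrow> 0 \<le> - r" for r :: real by (auto simp: max_def)
    then show ?thesis by simp
  qed
  also have "\<dots> \<longleftrightarrow> pos n (\<lambda>i j. - X i j)"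
    using spec_pos[OF s'] spec_pos_nonneg[OF s'] by blast
  finally show ?thesis .
qed

text \<open>The positive part of \<open>- X\<close> is the negative part of \<open>X\<close>. This
  allows lower bounds on an operator to be read off from \<open>tp\<close>.\<close>

lemma tp_uminus:
  assumes "herm n X"
  shows "tp n (\<lambda>i j. - X i j) = tp n X - Re (\<Sum>i<n. X i i)"
proof -
  obtain u d where s: "spec n X u d" using herm_spec[OF assms(1)] .
  have s': "spec n (\<lambda>i j. - X i j) u (\<lambda>m. - d m)"
    using spec_comb[OF s s, of "-1" 0] by simp
  show ?thesis unfolding tp_spec[OF s] tp_spec[OF s'] spec_trace[OF s] sum_subtractf[symmetric]
    by (intro sum.cong) (auto simp: max_def)
qed

text \<open>The Jordan decomposition: \<open>Q\<close> is the positive part of \<open>X\<close> and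
  \<open>Q - X\<close> the negative part.\<close>

lemma positive_part:
  assumes "herm n X"
  obtains Q where "pos n Q" "pos n (\<lambda>i j. Q i j - X i j)" "Re (\<Sum>i<n. Q i i) = tp n X"
proof -
  obtain u d where s: "spec n X u d" using herm_spec[OF assms(1)] .
  then have o: "ortho n n u" by (simp add: spec_def)
  note q = spec_sum[OF o, of "\<lambda>m. max 0 (d m)"]
  show thesis
  proof (rule that[OF spec_pos[OF q] spec_pos[OF spec_diff[OF q s]]])
    show "Re (\<Sum>i<n. \<Sum>m<n. of_real (max 0 (d m)) * u m i * cnj (u m i)) = tp n X"
      by (simp only: spec_trace[OF q] tp_spec[OF s])
  qed auto
qed

section \<open>The law of inertia by dimension count\<close>

definition separating :: "nat \<Rightarrow> (nat \<Rightarrow> nat \<Rightarrow> complex) \<Rightarrow> bool" where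
  "separating n z \<longleftrightarrow> (\<forall>x. (\<forall>m<n. cin n (z m) x = 0) \<longrightarrow> (\<forall>i<n. x i = 0))"

text \<open>If the left side had more positive coefficients, then orthogonality to the
  \<open>b m\<close> with \<open>e m \<le> 0\<close> and to the \<open>z m\<close> with
  \<open>g m > 0\<close> would be fewer than \<open>n\<close> conditions. A nonzero solution makes
  the left side positive and the right side nonpositive.\<close>

lemma inertia_le:
  assumes eq: "\<And>x. (\<Sum>m<n. e m * (cmod (cin n (b m) x))\<^sup>2) = (\<Sum>m<n. g m * (cmod (cin n (z m) x))\<^sup>2)"
    and inj: "separating n b"
  shows "card {m. m < n \<and> (0::real) < e m} \<le> card {m. m < n \<and> (0::real) < g m}"
proof (rule ccontr)
  assume c: "\<not> ?thesis"
  define F where "F = map b (filter (\<lambda>m. \<not> 0 < e m) [0..<n]) @ map z (filter (\<lambda>m. 0 < g m) [0..<n])"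
  have l: "length (filter R [0..<n]) = card {m. m < n \<and> R m}" for R
    by (subst distinct_card[symmetric]) (auto intro!: arg_cong[where f = card])
  have "card {m. m < n \<and> 0 < e m} + card {m. m < n \<and> \<not> 0 < e m} = n"
    by (subst card_Un_disjoint[symmetric]) (auto intro!: trans[OF arg_cong[where f = card] card_lessThan])
  then have "length F < n" using c unfolding F_def by (simp add: l)
  then obtain x where x: "\<exists>i<n. x i \<noteq> 0" "\<forall>f\<in>set F. cin n f x = 0"
    using nonzero_orthogonal by blast
  have bz: "cin n (b m) x = 0" if "m < n" "\<not> 0 < e m" for m using x(2) that by (auto simp: F_def)
  have zz: "cin n (z m) x = 0" if "m < n" "0 < g m" for m using x(2) that by (auto simp: F_def)
  obtain m where m: "m < n" "cin n (b m) x \<noteq> 0" using inj x(1) unfolding separating_def by blast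
  then have "0 < e m" using bz by blast
  then have "0 < (\<Sum>m<n. e m * (cmod (cin n (b m) x))\<^sup>2)"
  proof (intro sum_pos2[of "{..<n}" m])
    fix l assume "l \<in> {..<n}"
    then show "0 \<le> e l * (cmod (cin n (b l) x))\<^sup>2" using bz[of l] by (cases "0 < e l") auto
  qed (use m in auto)
  moreover have "(\<Sum>m<n. g m * (cmod (cin n (z m) x))\<^sup>2) \<le> 0"
  proof (rule sum_nonpos)
    fix m assume "m \<in> {..<n}"
    then show "g m * (cmod (cin n (z m) x))\<^sup>2 \<le> 0"
      using zz[of m] by (cases "0 < g m") (auto simp: mult_nonpos_nonneg)
  qed
  ultimately show False using eq[of x] by simp
qed

text \<open>Sylvester's law of inertia: the rank of the projection onto the positive part of \<open>Z\<close> can be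
  read off any diagonalization of \<open>Z\<close> by congruence.\<close>

lemma effect_inertia:
  assumes Z: "herm n Z"
    and q: "\<And>x. Re (qf n Z x) = (\<Sum>m<n. g m * (cmod (cin n (z m) x))\<^sup>2)"
    and inj: "separating n z"
  obtains P where "eff n P" "ip n P Z = tp n Z" "ip n P idm = real (card {m. m < n \<and> 0 < g m})"
proof -
  obtain u d where s: "spec n Z u d" using herm_spec[OF Z] .
  then have o: "ortho n n u" by (simp add: spec_def)
  have eq: "(\<Sum>m<n. d m * (cmod (cin n (u m) x))\<^sup>2) = (\<Sum>m<n. g m * (cmod (cin n (z m) x))\<^sup>2)" for x
    using qf_spec[OF s, of x] q[of x] by simp
  have inj': "separating n u"
    unfolding separating_def using ortho_expand[OF o] by (metis (no_types, lifting) lessThan_iff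
      mult_zero_left sum.neutral)
  have "card {m. m < n \<and> 0 < d m} \<le> card {m. m < n \<and> 0 < g m}"
    by (rule inertia_le[OF eq inj'])
  moreover have "card {m. m < n \<and> 0 < g m} \<le> card {m. m < n \<and> 0 < d m}"
    by (rule inertia_le[OF eq[symmetric] inj])
  ultimately have "card {m. m < n \<and> 0 < d m} = card {m. m < n \<and> 0 < g m}" by simp
  then show thesis using spec_effect[OF s] tp_spec[OF s] that by auto
qed

subsection \<open>An integral formula for the relative entropy\<close>

text \<open>An effect optimal at \<open>s\<close> is a candidate at \<open>s'\<close>, and its
  pairing with \<open>B\<close> lies between 0 and the trace of \<open>B\<close>. Exchanging the
  roles gives the absolute value.\<close>

lemma tp_lipschitz:
  assumes A: "herm n A" and B: "pos n B"
  shows "\<bar>tp n (\<lambda>i j. A i j - of_real s * B i j) - tp n (\<lambda>i j. A i j - of_real s' * B i j)\<bar>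
    \<le> \<bar>s - s'\<bar> * Re (\<Sum>i<n. B i i)"
proof -
  have le: "tp n (\<lambda>i j. A i j - of_real s * B i j) - tp n (\<lambda>i j. A i j - of_real s' * B i j)
    \<le> \<bar>s - s'\<bar> * Re (\<Sum>i<n. B i i)" for s s'
  proof -
    obtain P where P: "eff n P"
      "ip n P (\<lambda>i j. A i j - of_real s * B i j) = tp n (\<lambda>i j. A i j - of_real s * B i j)"
      using tp_attained[OF herm_diff_scale[OF A pos_herm[OF B]]] .
    have "ip n P (\<lambda>i j. A i j - of_real s' * B i j) \<le> tp n (\<lambda>i j. A i j - of_real s' * B i j)"
      by (rule tp_ge[OF herm_diff_scale[OF A pos_herm[OF B]] P(1)])
    moreover have "(s' - s) * ip n P B \<le> \<bar>s - s'\<bar> * Re (\<Sum>i<n. B i i)"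
      using ip_eff_le[OF P(1) B] ip_eff_nonneg[OF P(1) B] by (intro mult_mono) auto
    ultimately show ?thesis using P(2) by (simp add: ip_diff ip_scale algebra_simps)
  qed
  show ?thesis using le[of s s'] le[of s' s] by (simp add: abs_le_iff abs_minus_commute)
qed

lemma qf_congruence:
  "qf n (\<lambda>j k. \<Sum>a<n. \<Sum>b<n. cnj (V j a) * A a b * V k b) \<xi> = qf n A (\<lambda>a. \<Sum>k<n. \<xi> k * V k a)"
proof -
  let ?f = "\<lambda>j k a b. cnj (\<xi> j * V j a) * A a b * (\<xi> k * V k b)"
  have "qf n (\<lambda>j k. \<Sum>a<n. \<Sum>b<n. cnj (V j a) * A a b * V k b) \<xi> = (\<Sum>j<n. \<Sum>k<n. \<Sum>a<n. \<Sum>b<n. ?f j k a b)"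
    unfolding qf_def by (simp add: sum_distrib_left sum_distrib_right mult_ac)
  also have "\<dots> = (\<Sum>a<n. \<Sum>j<n. \<Sum>k<n. \<Sum>b<n. ?f j k a b)" by (rule sum3_rotate)
  also have "\<dots> = (\<Sum>a<n. \<Sum>b<n. \<Sum>j<n. \<Sum>k<n. ?f j k a b)"
    by (rule sum.cong[OF refl sum3_rotate])
  also have "\<dots> = qf n A (\<lambda>a. \<Sum>k<n. \<xi> k * V k a)"
    unfolding qf_def by (simp add: sum_distrib_left sum_distrib_right mult_ac)
  finally show ?thesis .
qed

text \<open>Stands in for a vanishing derivative. Over \<open>N\<close> equal steps the bounds
  telescope to \<open>(b - a) * (g a - g b) / N\<close>, which tends to 0.\<close>

lemma telescoping_const:
  fixes f g :: "real \<Rightarrow> real"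
  assumes le: "\<And>a b. 0 < a \<Longrightarrow> a < b \<Longrightarrow> \<bar>f b - f a\<bar> \<le> (b - a) * (g a - g b)"
    and ab: "0 < a" "a < b"
  shows "f b = f a"
proof -
  have bound: "\<bar>f b - f a\<bar> \<le> (b - a) * (g a - g b) / real N" if N: "N > 0" for N :: nat
  proof -
    define h where "h = (b - a) / real N"
    have h: "h > 0" using ab N by (simp add: h_def)
    define x where "x = (\<lambda>i. a + real i * h)"
    have x: "0 < x i" "x (Suc i) - x i = h" for i
      using ab h by (auto simp: x_def algebra_simps intro!: add_pos_nonneg)
    have "f (x N) - f (x 0) = (\<Sum>i<N. f (x (Suc i)) - f (x i))"
      by (rule sum_lessThan_telescope[symmetric])
    also have "\<bar>\<dots>\<bar> \<le> (\<Sum>i<N. \<bar>f (x (Suc i)) - f (x i)\<bar>)" by (rule sum_abs)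
    also have "\<dots> \<le> (\<Sum>i<N. h * (g (x i) - g (x (Suc i))))"
    proof (rule sum_mono)
      fix i
      have "x i < x (Suc i)" using x(2)[of i] h by simp
      from le[OF x(1) this] show "\<bar>f (x (Suc i)) - f (x i)\<bar> \<le> h * (g (x i) - g (x (Suc i)))"
        unfolding x(2) .
    qed
    also have "\<dots> = h * (g (x 0) - g (x N))"
      unfolding sum_distrib_left[symmetric] sum_lessThan_telescope'[of "\<lambda>i. g (x i)"] ..
    finally have "\<bar>f (x N) - f (x 0)\<bar> \<le> h * (g (x 0) - g (x N))" .
    moreover have "x N = b" "x 0 = a" using N by (auto simp: x_def h_def)
    ultimately show ?thesis by (simp add: h_def)
  qed
  have "(\<lambda>N. (b - a) * (g a - g b) / real N) \<longlonglongrightarrow> 0" by (rule lim_const_over_n)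
  then have "\<bar>f b - f a\<bar> \<le> 0"
    by (rule tendsto_lowerbound) (auto intro!: bound eventually_sequentiallyI[of 1])
  then show ?thesis by simp
qed

section \<open>Elementary integrals and logarithm bounds\<close>

lemma has_integral_left_open:
  fixes f :: "real \<Rightarrow> real"
  shows "(f has_integral i) {0<..b} \<longleftrightarrow> (f has_integral i) {0..b}"
  by (rule has_integral_spike_set_eq) (auto intro: negligible_subset[of "{0}"])

lemma has_integral_step:
  fixes \<mu> b :: real
  assumes "0 \<le> \<mu>" "\<mu> \<le> b"
  shows "((\<lambda>s. if s < \<mu> then 1 else 0 :: real) has_integral \<mu>) {0<..b}"
proof -
  have "((\<lambda>s. 1 :: real) has_integral (\<mu> - 0)) {0..\<mu>}"
    using has_integral_const_real[of "1 :: real" 0 \<mu>] assms by (simp add: content_real)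
  then have "((\<lambda>s. if s \<in> {0..\<mu>} then 1 else 0 :: real) has_integral \<mu>) {0..b}"
    using assms by (subst has_integral_restrict) auto
  then have "((\<lambda>s. if s < \<mu> then 1 else 0 :: real) has_integral \<mu>) {0..b}"
    by (rule has_integral_spike[of "{\<mu>}", rotated 2]) auto
  then show ?thesis unfolding has_integral_left_open .
qed

text \<open>The integral formula for 1x1 matrices \<open>l\<close> and \<open>x\<close>: the
  integrand is \<open>x\<close> up to the crossover \<open>s = l / x\<close> and
  \<open>l / s\<close> beyond it. The bound \<open>l \<le> b * x\<close> keeps the crossover in
  range.\<close>

lemma has_integral_clip_quotient:
  fixes b l x :: real
  assumes l: "0 \<le> l" "l \<le> b * x" and x: "0 < x" and b: "0 < b"
  shows "((\<lambda>s. (l - max 0 (l - s * x)) / s) has_integral (l + l * ln b + l * ln x - l * ln l)) {0<..b}"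
proof (cases "l = 0")
  case True
  have "((\<lambda>s. (l - max 0 (l - s * x)) / s) has_integral 0) {0<..b}"
  proof (rule has_integral_is_0)
    fix s assume "s \<in> {0<..b}"
    then have "0 \<le> s * x" using x by simp
    then show "(l - max 0 (l - s * x)) / s = 0" using True by simp
  qed
  then show ?thesis using True by simp
next
  case False
  then have l0: "0 < l" using l by simp
  define c where "c = l / x"
  have c: "0 < c" "c \<le> b" "c * x = l" using l0 x l by (auto simp: c_def field_simps)
  have "((\<lambda>s. x) has_integral (c * x)) {0..c}"
    using has_integral_const_real[of x 0 c] c by simp
  then have 1: "((\<lambda>s. (l - max 0 (l - s * x)) / s) has_integral (c * x)) {0..c}"
  proof (rule has_integral_spike[of "{0}", rotated 2])
    fix s assume "s \<in> {0..c} - {0}"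
    then have "0 < s" "s * x \<le> l" using c x by (auto simp: mult_right_mono c(3)[symmetric])
    then show "(l - max 0 (l - s * x)) / s = x" by simp
  qed simp
  have "((\<lambda>s. l / s) has_integral (l * ln b - l * ln c)) {c..b}"
    by (rule fundamental_theorem_of_calculus[OF c(2)])
      (use c in \<open>auto intro!: derivative_eq_intros simp: has_real_derivative_iff_has_vector_derivative[symmetric]\<close>)
  then have 2: "((\<lambda>s. (l - max 0 (l - s * x)) / s) has_integral (l * ln b - l * ln c)) {c..b}"
  proof (rule has_integral_eq[rotated])
    fix s assume s: "s \<in> {c..b}"
    have "c * x \<le> s * x" using s x by (intro mult_right_mono) auto
    then have "l \<le> s * x" using c(3) by simp
    then show "l / s = (l - max 0 (l - s * x)) / s" by simp
  qed
  have "((\<lambda>s. (l - max 0 (l - s * x)) / s) has_integral (c * x + (l * ln b - l * ln c))) {0..b}"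
    by (rule has_integral_combine[OF _ c(2) 1 2]) (use c in auto)
  moreover have "ln c = ln l - ln x" using l0 x by (simp add: c_def ln_div)
  ultimately show ?thesis unfolding has_integral_left_open c(3) by (simp add: algebra_simps)
qed

lemma ln_difference_bounds:
  assumes "0 < a" "a < b"
  shows "(b - a) / b \<le> ln b - ln a" "ln b - ln a \<le> (b - a) / (a::real)"
proof -
  have "ln (b / a) \<le> b / a - 1" using assms by (intro ln_le_minus_one) auto
  then show "ln b - ln a \<le> (b - a) / a" using assms by (simp add: ln_div diff_divide_distrib)
  have "ln (a / b) \<le> a / b - 1" using assms by (intro ln_le_minus_one) auto
  then show "(b - a) / b \<le> ln b - ln a" using assms by (simp add: ln_div diff_divide_distrib)
qed

section \<open>The integral as a function of the shift\<close>

locale dominated_pair =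
  fixes n :: nat and \<rho> \<sigma> u :: "nat \<Rightarrow> nat \<Rightarrow> complex" and d :: "nat \<Rightarrow> real" and s\<^sub>0 :: real
  assumes \<rho>: "pos n \<rho>" and \<sigma>: "pos n \<sigma>" and spec: "spec n \<sigma> u d"
    and s0: "0 < s\<^sub>0" and dom: "pos n (\<lambda>i j. of_real s\<^sub>0 * \<sigma> i j - \<rho> i j)"
begin

text \<open>\<open>J r\<close> is the integral for the pair \<open>(\<rho>, \<sigma> + r)\<close>: the shift by \<open>r > 0\<close> makes the second operator invertible,
  and differentiating in \<open>r\<close> produces its resolvent.\<close>

definition t where "t = Re (\<Sum>i<n. \<rho> i i)"
definition p where "p j = Re (qf n \<rho> (u j))"
definition Y where "Y r = (\<lambda>i j. \<sigma> i j + of_real r * idm i j)"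
definition E where "E r s = tp n (\<lambda>i j. \<rho> i j - of_real s * Y r i j)"
definition k where "k r s = (t - E r s) / s"
definition J where "J r = integral {0<..s\<^sub>0} (k r)"

lemma ortho_u: "ortho n n u"
  using spec by (simp add: spec_def)

lemma d_nonneg: "j < n \<Longrightarrow> 0 \<le> d j"
  using spec_pos_nonneg[OF spec \<sigma>] .

lemma p_nonneg: "0 \<le> p j"
  unfolding p_def using posD[OF \<rho>] .

lemma sum_p: "(\<Sum>j<n. p j) = t"
  using ip_spec[OF spec_idm[OF ortho_u], of \<rho>] ip_commute[of n \<rho> idm]
  by (simp add: p_def t_def ip_idm)

lemma t_nonneg: "0 \<le> t"
  unfolding sum_p[symmetric] using p_nonneg by (simp add: sum_nonneg)

lemma p_le: "j < n \<Longrightarrow> p j \<le> s\<^sub>0 * d j"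
  using posD[OF dom, of "u j"] qf_spec_vec[OF spec, of j] by (simp add: qf_simps p_def)

lemma spec_Y: "spec n (Y r) u (\<lambda>j. d j + r)"
  using spec_comb[OF spec spec_idm[OF ortho_u], of 1 r] by (simp add: Y_def)

lemma pos_Y: "0 \<le> r \<Longrightarrow> pos n (Y r)"
  using spec_pos[OF spec_Y] d_nonneg by simp

lemma herm_Z: "herm n (\<lambda>i j. \<rho> i j - of_real s * Y r i j)"
  by (rule herm_diff_scale[OF pos_herm[OF \<rho>] spec_herm[OF spec_Y]])

lemma E_le_t:
  assumes "0 \<le> r" "0 \<le> s"
  shows "E r s \<le> t"
proof -
  obtain P where P: "eff n P" "ip n P (\<lambda>i j. \<rho> i j - of_real s * Y r i j) = E r s"
    using tp_attained[OF herm_Z] unfolding E_def .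
  have "0 \<le> s * ip n P (Y r)" using ip_eff_nonneg[OF P(1) pos_Y] assms by simp
  then show ?thesis using P ip_eff_le[OF P(1) \<rho>] by (simp add: ip_diff ip_scale t_def)
qed

lemma E_ge_trace: "t - s * Re (\<Sum>i<n. Y r i i) \<le> E r s"
  using tp_ge_trace[OF herm_Z, of s r]
  by (simp add: E_def t_def sum_subtractf sum_distrib_left[symmetric])

lemma E_lipschitz: "0 \<le> r \<Longrightarrow> \<bar>E r s - E r s'\<bar> \<le> \<bar>s - s'\<bar> * Re (\<Sum>i<n. Y r i i)"
  unfolding E_def by (rule tp_lipschitz[OF pos_herm[OF \<rho>] pos_Y])

lemma Y_shift: "\<rho> i j - of_real s * Y (r + \<delta>) i j = \<rho> i j - of_real s * Y r i j - of_real (s * \<delta>) * idm i j"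
  by (simp add: Y_def algebra_simps)

text \<open>Shifting by \<open>r\<close> subtracts \<open>s * r\<close> times the identity, so this
  is \<open>tp_lipschitz\<close> with the identity as \<open>B\<close>. The factor \<open>s\<close>
  will cancel the denominator of \<open>k\<close>.\<close>

lemma E_shift:
  assumes "0 \<le> s"
  shows "\<bar>E 0 s - E r s\<bar> \<le> s * \<bar>r\<bar> * n"
proof -
  have "E r s = tp n (\<lambda>i j. \<rho> i j - of_real s * Y 0 i j - of_real (s * r) * idm i j)"
    unfolding E_def Y_shift[symmetric] by simp
  moreover have "E 0 s = tp n (\<lambda>i j. \<rho> i j - of_real s * Y 0 i j - of_real 0 * idm i j)"
    unfolding E_def by simp
  moreover have "Re (\<Sum>i<n. idm i i) = n" by (simp add: idm_def)
  ultimately show ?thesis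
    using tp_lipschitz[OF herm_Z pos_idm, of s 0 0 "s * r"] assms by (simp only:) (simp add: abs_mult)
qed

lemma continuous_E: "0 \<le> r \<Longrightarrow> continuous_on A (E r)"
proof (rule continuous_on_subset[OF _ subset_UNIV], rule lipschitz_on_continuous_on)
  assume r: "0 \<le> r"
  show "(Re (\<Sum>i<n. Y r i i))-lipschitz_on UNIV (E r)"
  proof (rule lipschitz_onI)
    show "0 \<le> Re (\<Sum>i<n. Y r i i)"
      using ip_pos[OF pos_idm pos_Y[OF r]] by (simp only: ip_idm)
  qed (use E_lipschitz[OF r] in \<open>simp add: dist_real_def mult.commute\<close>)
qed

lemma continuous_k: "0 \<le> r \<Longrightarrow> continuous_on {0<..s\<^sub>0} (k r)"
  unfolding k_def by (intro continuous_intros continuous_E) auto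

text \<open>\<open>E r s\<close> differs from \<open>t\<close> by at most a multiple of
  \<open>s\<close>; hence the subtraction from \<open>t\<close> makes the integral converge at
  0.\<close>

lemma k_bounds:
  assumes "0 \<le> r" "0 < s"
  shows "0 \<le> k r s" "k r s \<le> Re (\<Sum>i<n. Y r i i)"
  using assms E_le_t[of r s] E_ge_trace[of s r] by (auto simp: k_def field_simps)

lemma k_integrable:
  assumes r: "0 \<le> r"
  shows "k r integrable_on {0<..s\<^sub>0}"
proof (rule measurable_bounded_by_integrable_imp_integrable_real)
  show "k r \<in> borel_measurable (lebesgue_on {0<..s\<^sub>0})"
    by (rule continuous_imp_measurable_on_sets_lebesgue[OF continuous_k[OF r]]) auto
  show "(\<lambda>s. Re (\<Sum>i<n. Y r i i)) integrable_on {0<..s\<^sub>0}"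
    using integrable_const_ivl[of "Re (\<Sum>i<n. Y r i i)" 0 s\<^sub>0]
    unfolding integrable_on_def has_integral_left_open .
qed (use k_bounds[OF r] in auto)

text \<open>The matrix \<open>C\<close> below is \<open>\<rho>\<close> multiplied on both sides by
  the inverse square root of \<open>Y r\<close>, written in the eigenbasis of
  \<open>\<sigma>\<close>. In the eigenbasis of \<open>C\<close> both forms are diagonal, and its
  eigenvalues \<open>\<mu>\<close> are the generalized eigenvalues of the pair. They add up to the
  trace of \<open>C\<close>, and \<open>\<rho> \<le> s\<^sub>0 \<sigma> \<le> s\<^sub>0 Y r\<close>
  bounds them by \<open>s\<^sub>0\<close>.\<close>

lemma simultaneous_diagonalization:
  assumes r: "0 < r"
  shows "\<exists>\<mu> z. (\<forall>m<n. \<mu> m \<in> {0..s\<^sub>0}) \<and>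
    (\<Sum>m<n. \<mu> m) = (\<Sum>j<n. p j / (d j + r)) \<and>
    (\<forall>x. Re (qf n (Y r) x) = (\<Sum>m<n. (cmod (cin n (z m) x))\<^sup>2)) \<and>
    (\<forall>x. Re (qf n \<rho> x) = (\<Sum>m<n. \<mu> m * (cmod (cin n (z m) x))\<^sup>2)) \<and>
    separating n z"
proof -
  define y where "y = (\<lambda>j. sqrt (d j + r))"
  have y: "0 < y j" "(y j)\<^sup>2 = d j + r" if "j < n" for j
    using d_nonneg[OF that] r by (auto simp: y_def)
  define V where "V = (\<lambda>j a. of_real (1 / y j) * u j a)"
  define C where "C = (\<lambda>j k. \<Sum>a<n. \<Sum>b<n. cnj (V j a) * \<rho> a b * V k b)"
  \<comment> \<open>\<open>\<xi>\<close> passes to coordinates in which the form of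
    \<open>Y r\<close> is the squared norm, and \<open>X\<close> leads back.\<close>
  define X where "X = (\<lambda>\<xi> a. \<Sum>k<n. \<xi> k * V k a)"
  define \<xi> where "\<xi> = (\<lambda>x j. of_real (y j) * cin n (u j) x)"
  have qC: "qf n C x = qf n \<rho> (X x)" for x
    unfolding C_def X_def by (rule qf_congruence)
  have C: "pos n C" using \<rho> by (simp add: pos_def qC)
  obtain v \<mu> where v: "spec n C v \<mu>" using herm_spec[OF pos_herm[OF C]] .
  then have ov: "ortho n n v" by (simp add: spec_def)
  have uX: "cin n (u j) (X x) = x j / of_real (y j)" if "j < n" for j x
  proof -
    have "cin n (u j) (X x) = (\<Sum>i<n. \<Sum>k<n. x k * of_real (1 / y k) * (cnj (u j i) * u k i))"
      unfolding cin_def X_def V_def by (simp add: sum_distrib_left mult_ac)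
    also have "\<dots> = (\<Sum>k<n. x k * of_real (1 / y k) * cin n (u j) (u k))"
      unfolding cin_def by (subst sum.swap) (simp add: sum_distrib_left)
    also have "\<dots> = (\<Sum>k<n. x k * of_real (1 / y k) * (if j = k then 1 else 0))"
      using ortho_u that by (simp add: ortho_def)
    also have "\<dots> = x j / of_real (y j)" unfolding sum_mult_delta(1)[OF that] by simp
    finally show ?thesis .
  qed
  have X\<xi>: "X (\<xi> x) a = x a" if "a < n" for x a
  proof -
    have "X (\<xi> x) a = (\<Sum>k<n. cin n (u k) x * u k a)"
      unfolding X_def \<xi>_def V_def using y(1) by (intro sum.cong refl) (auto simp: less_imp_neq[THEN not_sym])
    then show ?thesis using ortho_expand[OF ortho_u that, of x] by simp
  qed
  have qY: "Re (qf n (Y r) x) = (\<Sum>j<n. (cmod (\<xi> x j))\<^sup>2)" for x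
    unfolding qf_spec[OF spec_Y] \<xi>_def using y by (auto simp: norm_mult power_mult_distrib intro!: sum.cong)
  define z where "z = (\<lambda>m i. \<Sum>j<n. v m j * of_real (y j) * u j i)"
  have z: "cin n (z m) x = cin n (v m) (\<xi> x)" for m x
  proof -
    have "cin n (z m) x = (\<Sum>i<n. \<Sum>j<n. cnj (v m j) * of_real (y j) * (cnj (u j i) * x i))"
      unfolding cin_def z_def by (simp add: sum_distrib_right sum_distrib_left mult_ac)
    also have "\<dots> = cin n (v m) (\<xi> x)"
      unfolding cin_def \<xi>_def by (subst sum.swap) (simp add: sum_distrib_left mult_ac)
    finally show ?thesis .
  qed
  show ?thesis
  proof (rule exI[of _ \<mu>], rule exI[of _ z], intro conjI allI impI)
    fix m assume m: "m < n"
    have le: "\<mu> m \<le> s\<^sub>0"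
    proof -
      have "\<mu> m = Re (qf n \<rho> (X (v m)))" using qf_spec_vec[OF v m] qC[of "v m"] by simp
      also have "\<dots> \<le> s\<^sub>0 * Re (qf n \<sigma> (X (v m)))"
        using posD[OF dom, of "X (v m)"] by (simp add: qf_simps)
      also have "\<dots> \<le> s\<^sub>0 * Re (qf n (Y r) (X (v m)))"
        using s0 r posD[OF pos_idm, of n "X (v m)"] by (simp add: Y_def qf_simps)
      also have "Re (qf n (Y r) (X (v m))) = (\<Sum>j<n. (cmod (v m j))\<^sup>2)"
        unfolding qY \<xi>_def using y(1) uX
        by (intro sum.cong refl) (auto simp: less_imp_neq[THEN not_sym])
      also have "\<dots> = 1"
        using ov m cin_self[of n "v m"] unfolding ortho_def by (simp only: of_real_eq_1_iff[where 'a = complex, symmetric]) simp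
      finally show ?thesis by simp
    qed
    then show "\<mu> m \<in> {0..s\<^sub>0}" using spec_pos_nonneg[OF v C m] by simp
  next
    have "(\<Sum>m<n. \<mu> m) = (\<Sum>j<n. Re (C j j))" using spec_trace[OF v] by simp
    also have "\<dots> = (\<Sum>j<n. p j / (d j + r))"
    proof (intro sum.cong refl)
      fix j assume "j \<in> {..<n}"
      then have j: "j < n" by simp
      have "C j j = of_real ((1 / y j)\<^sup>2) * qf n \<rho> (u j)"
        unfolding C_def V_def qf_def sum_distrib_left by (simp add: power2_eq_square mult_ac)
      moreover have "Re (of_real c * w) = c * Re w" for c w by simp
      ultimately have "Re (C j j) = (1 / y j)\<^sup>2 * p j" unfolding p_def by (simp only:)
      then show "Re (C j j) = p j / (d j + r)" using y(2)[OF j] by (simp add: power_divide)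
    qed
    finally show "(\<Sum>m<n. \<mu> m) = (\<Sum>j<n. p j / (d j + r))" .
  next
    fix x
    show "Re (qf n (Y r) x) = (\<Sum>m<n. (cmod (cin n (z m) x))\<^sup>2)"
      unfolding z parseval[OF ov] qY ..
    have "qf n \<rho> x = qf n \<rho> (X (\<xi> x))" by (rule qf_cong_vec) (simp add: X\<xi>)
    then show "Re (qf n \<rho> x) = (\<Sum>m<n. \<mu> m * (cmod (cin n (z m) x))\<^sup>2)"
      unfolding z by (simp add: qC[symmetric] qf_spec[OF v])
  next
    show "separating n z"
      unfolding separating_def
    proof (intro allI impI)
      fix x i assume zx: "\<forall>m<n. cin n (z m) x = 0" and i: "i < n"
      have \<xi>0: "\<xi> x j = 0" if "j < n" for j
        using ortho_expand[OF ov that, of "\<xi> x"] zx by (simp add: z)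
      have "cin n (u j) x = 0" if "j < n" for j
        using \<xi>0[OF that] y(1)[OF that] by (simp add: \<xi>_def)
      then show "x i = 0" using ortho_expand[OF ortho_u i, of x] by simp
    qed
  qed
qed

text \<open>Compressing with the projection onto the positive part of \<open>\<rho> - s (\<sigma> + r)\<close> bounds the change of
  \<^term>\<open>E\<close> under \<open>r \<mapsto> r + \<delta>\<close> by its rank, and integrating this rank over \<open>s\<close> gives
  the trace of \<open>\<rho> (\<sigma> + r)\<inverse>\<close>.\<close>

lemma J_difference:
  assumes r: "0 < a" "a < b"
  shows "(b - a) * (\<Sum>j<n. p j / (d j + b)) \<le> J b - J a"
    and "J b - J a \<le> (b - a) * (\<Sum>j<n. p j / (d j + a))"
proof -
  have ab: "Y b = Y (a + (b - a))" by simp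
  have key: "\<exists>N. (N has_integral (\<Sum>j<n. p j / (d j + r))) {0<..s\<^sub>0} \<and>
      (\<forall>s. \<exists>P. eff n P \<and> ip n P (\<lambda>i j. \<rho> i j - of_real s * Y r i j) = E r s \<and> ip n P idm = N s)"
    if r: "0 < r" for r
  proof -
    obtain \<mu> z where mz: "\<forall>m<n. \<mu> m \<in> {0..s\<^sub>0}"
      "(\<Sum>m<n. \<mu> m) = (\<Sum>j<n. p j / (d j + r))"
      "\<forall>x. Re (qf n (Y r) x) = (\<Sum>m<n. (cmod (cin n (z m) x))\<^sup>2)"
      "\<forall>x. Re (qf n \<rho> x) = (\<Sum>m<n. \<mu> m * (cmod (cin n (z m) x))\<^sup>2)"
      "separating n z"
      using simultaneous_diagonalization[OF r] by (elim exE conjE)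
    \<comment> \<open>The number of generalized eigenvalues above \<open>s\<close>. Each indicator
      integrates to its \<open>\<mu> m\<close>, as this lies between 0 and
      \<open>s\<^sub>0\<close>.\<close>
    let ?N = "\<lambda>s. \<Sum>m<n. if s < \<mu> m then 1 else 0 :: real"
    have "(?N has_integral (\<Sum>m<n. \<mu> m)) {0<..s\<^sub>0}"
      by (intro has_integral_sum has_integral_step) (use mz(1) in auto)
    moreover have "\<exists>P. eff n P \<and> ip n P (\<lambda>i j. \<rho> i j - of_real s * Y r i j) = E r s \<and> ip n P idm = ?N s" for s
    proof -
      have q: "Re (qf n (\<lambda>i j. \<rho> i j - of_real s * Y r i j) x)
          = (\<Sum>m<n. (\<mu> m - s) * (cmod (cin n (z m) x))\<^sup>2)" for x
        by (simp add: qf_simps mz(3,4)[rule_format] sum_distrib_left sum_subtractf[symmetric] left_diff_distrib)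
      obtain P where "eff n P" "ip n P (\<lambda>i j. \<rho> i j - of_real s * Y r i j) = E r s"
        "ip n P idm = real (card {m. m < n \<and> 0 < \<mu> m - s})"
        unfolding E_def by (rule effect_inertia[OF herm_Z q mz(5)])
      moreover have "?N s = (\<Sum>m\<in>{m. m < n \<and> 0 < \<mu> m - s}. 1)"
        by (intro sum.mono_neutral_cong_right) auto
      ultimately show ?thesis by auto
    qed
    ultimately show ?thesis using mz(2) by (intro exI[of _ ?N]) auto
  qed
  have diff: "((\<lambda>s. k b s - k a s) has_integral (J b - J a)) {0<..s\<^sub>0}"
    unfolding J_def by (intro has_integral_diff integrable_integral k_integrable) (use r in auto)
  have kd: "k b s - k a s = (E a s - E b s) / s" for s
    by (simp add: k_def diff_divide_distrib)
  show "(b - a) * (\<Sum>j<n. p j / (d j + b)) \<le> J b - J a"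
  proof -
    obtain N where N: "(N has_integral (\<Sum>j<n. p j / (d j + b))) {0<..s\<^sub>0}"
      "\<And>s. \<exists>P. eff n P \<and> ip n P (\<lambda>i j. \<rho> i j - of_real s * Y b i j) = E b s \<and> ip n P idm = N s"
      using key[of b] r by auto
    \<comment> \<open>The effect optimal at shift \<open>b\<close> is only a competitor at shift
      \<open>a\<close>; this bounds \<open>E a s\<close> from below. The upper bound further on
      exchanges the two shifts.\<close>
    have "(b - a) * N s \<le> k b s - k a s" if "s \<in> {0<..s\<^sub>0}" for s
    proof -
      obtain P where P: "eff n P" "ip n P (\<lambda>i j. \<rho> i j - of_real s * Y b i j) = E b s" "ip n P idm = N s"
        using N(2) by blast
      have "E b s = ip n P (\<lambda>i j. \<rho> i j - of_real s * Y a i j) - s * (b - a) * N s"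
        unfolding P(2,3)[symmetric] ab Y_shift ip_diff ip_scale ..
      also have "ip n P (\<lambda>i j. \<rho> i j - of_real s * Y a i j) \<le> E a s"
        unfolding E_def by (rule tp_ge[OF herm_Z P(1)])
      finally show ?thesis using that by (simp add: kd field_simps)
    qed
    then show ?thesis using has_integral_le[OF has_integral_mult_right[OF N(1)] diff] by blast
  qed
  show "J b - J a \<le> (b - a) * (\<Sum>j<n. p j / (d j + a))"
  proof -
    obtain N where N: "(N has_integral (\<Sum>j<n. p j / (d j + a))) {0<..s\<^sub>0}"
      "\<And>s. \<exists>P. eff n P \<and> ip n P (\<lambda>i j. \<rho> i j - of_real s * Y a i j) = E a s \<and> ip n P idm = N s"
      using key[of a] r by auto
    have "k b s - k a s \<le> (b - a) * N s" if "s \<in> {0<..s\<^sub>0}" for s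
    proof -
      obtain P where P: "eff n P" "ip n P (\<lambda>i j. \<rho> i j - of_real s * Y a i j) = E a s" "ip n P idm = N s"
        using N(2) by blast
      have "ip n P (\<lambda>i j. \<rho> i j - of_real s * Y b i j) \<le> E b s"
        unfolding E_def by (rule tp_ge[OF herm_Z P(1)])
      also have "ip n P (\<lambda>i j. \<rho> i j - of_real s * Y b i j) = E a s - s * (b - a) * N s"
        unfolding P(2,3)[symmetric] ab Y_shift ip_diff ip_scale ..
      finally show ?thesis using that by (simp add: kd field_simps)
    qed
    then show ?thesis using has_integral_le[OF diff has_integral_mult_right[OF N(1)]] by blast
  qed
qed

text \<open>The increments of \<open>J\<close> and of the sum of logarithms from \<open>a\<close> to
  \<open>b\<close> lie between the same two numbers: \<open>b - a\<close> times the resolvent sum at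
  \<open>b\<close> and at \<open>a\<close>. Hence their difference meets the hypothesis of
  \<open>telescoping_const\<close>.\<close>

lemma J_minus_log_const:
  assumes "0 < a" "a < b"
  shows "J b - (\<Sum>j<n. p j * ln (d j + b)) = J a - (\<Sum>j<n. p j * ln (d j + a))"
proof (rule telescoping_const[where f = "\<lambda>r. J r - (\<Sum>j<n. p j * ln (d j + r))"
      and g = "\<lambda>r. \<Sum>j<n. p j / (d j + r)", OF _ assms])
  fix a b :: real assume ab: "0 < a" "a < b"
  have "p j * (ln (d j + b) - ln (d j + a)) \<le> (b - a) * (p j / (d j + a))"
    and "(b - a) * (p j / (d j + b)) \<le> p j * (ln (d j + b) - ln (d j + a))" if "j < n" for j
    using mult_left_mono[OF ln_difference_bounds(1)[of "d j + a" "d j + b"] p_nonneg[of j]]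
      mult_left_mono[OF ln_difference_bounds(2)[of "d j + a" "d j + b"] p_nonneg[of j]]
      d_nonneg[OF that] ab by (auto simp: mult.commute)
  then have "(\<Sum>j<n. p j * (ln (d j + b) - ln (d j + a))) \<le> (b - a) * (\<Sum>j<n. p j / (d j + a))"
    and "(b - a) * (\<Sum>j<n. p j / (d j + b)) \<le> (\<Sum>j<n. p j * (ln (d j + b) - ln (d j + a)))"
    unfolding sum_distrib_left by (auto intro!: sum_mono)
  then show "\<bar>J b - (\<Sum>j<n. p j * ln (d j + b)) - (J a - (\<Sum>j<n. p j * ln (d j + a)))\<bar>
      \<le> (b - a) * ((\<Sum>j<n. p j / (d j + a)) - (\<Sum>j<n. p j / (d j + b)))"
    using J_difference[OF ab] unfolding right_diff_distrib sum_subtractf by linarith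
qed

end

section \<open>Evaluation of the integral: large shifts, then shift zero\<close>

context dominated_pair
begin

text \<open>The spectrum of \<open>Y r\<close> lies between \<open>r\<close> and
  \<open>r + m\<close>. For a multiple \<open>x\<close> of the identity in place of
  \<open>Y r\<close>, the integral splits into scalar ones over the eigenvalues \<open>l i\<close>
  of \<open>\<rho>\<close>; the hypothesis \<open>t \<le> s\<^sub>0 * r\<close> keeps their
  crossovers \<open>l i / x\<close> below \<open>s\<^sub>0\<close>.\<close>

lemma J_bounds:
  assumes w: "spec n \<rho> w l" and r: "0 < r" and m: "0 \<le> m" "\<And>j. j < n \<Longrightarrow> d j \<le> m" and large: "t \<le> s\<^sub>0 * r"
  defines "B \<equiv> t + t * ln s\<^sub>0 - (\<Sum>i<n. l i * ln (l i))"
  shows "B + t * ln r \<le> J r" "J r \<le> B + t * ln (r + m)"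
proof -
  have l0: "0 \<le> l i" if "i < n" for i using spec_pos_nonneg[OF w \<rho> that] .
  have tl: "t = (\<Sum>i<n. l i)" unfolding t_def spec_trace[OF w] ..
  have lt: "l i \<le> t" if "i < n" for i
    unfolding tl using l0 that by (intro member_le_sum) auto
  \<comment> \<open>The integrand \<open>k\<close> for the pair consisting of \<open>\<rho>\<close>
    and \<open>x\<close> times the identity.\<close>
  define q where "q = (\<lambda>x s. \<Sum>i<n. (l i - max 0 (l i - s * x)) / s)"
  have q: "(q x has_integral (B + t * ln x)) {0<..s\<^sub>0}" if "r \<le> x" for x
  proof -
    have x: "0 < x" using that r by simp
    have "t \<le> s\<^sub>0 * x" using large mult_left_mono[OF that less_imp_le[OF s0]] by simp
    then have "(q x has_integral (\<Sum>i<n. l i + l i * ln s\<^sub>0 + l i * ln x - l i * ln (l i))) {0<..s\<^sub>0}"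
      unfolding q_def using l0 lt x s0
      by (intro has_integral_sum has_integral_clip_quotient) (auto intro: order_trans)
    also have "(\<Sum>i<n. l i + l i * ln s\<^sub>0 + l i * ln x - l i * ln (l i)) = B + t * ln x"
      unfolding B_def tl by (simp add: sum.distrib sum_subtractf sum_distrib_right)
    finally show ?thesis .
  qed
  have tpx: "tp n (\<lambda>i j. \<rho> i j - of_real (s * x) * idm i j) = t - s * q x s"
    if "0 < s" for s x
  proof -
    have s: "spec n (\<lambda>i j. \<rho> i j - of_real (s * x) * idm i j) w (\<lambda>i. l i - s * x)"
      using spec_comb[OF w spec_idm, of 1 "- (s * x)"] w by (simp add: spec_def)
    have "s * q x s = (\<Sum>i<n. l i - max 0 (l i - s * x))"
      using that unfolding q_def sum_distrib_left by simp
    then show ?thesis unfolding tp_spec[OF s] tl by (simp add: sum_subtractf)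
  qed
  have kJ: "(k r has_integral J r) {0<..s\<^sub>0}"
    unfolding J_def using k_integrable[of r] r by (intro integrable_integral) simp
  have h: "herm n (\<lambda>i j. \<rho> i j - of_real x * idm i j)" for x
    by (rule herm_diff_scale[OF pos_herm[OF \<rho>] pos_herm[OF pos_idm]])
  have le: "q r s \<le> k r s" "k r s \<le> q (r + m) s" if s: "s \<in> {0<..s\<^sub>0}" for s
  proof -
    have s0: "0 < s" using s by simp
    have sp: "spec n (\<lambda>i j. (\<rho> i j - of_real (s * x) * idm i j) - (\<rho> i j - of_real s * Y r i j)) u
        (\<lambda>j. s * (d j + r) - s * x)" for x
      using spec_comb[OF spec_Y[of r] spec_idm[OF ortho_u], of s "- (s * x)"] by simp
    have sp': "spec n (\<lambda>i j. (\<rho> i j - of_real s * Y r i j) - (\<rho> i j - of_real (s * x) * idm i j)) u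
        (\<lambda>j. s * x - s * (d j + r))" for x
      using spec_comb[OF spec_Y[of r] spec_idm[OF ortho_u], of "- s" "s * x"] by simp
    have "E r s \<le> t - s * q r s"
      unfolding E_def tpx[OF s0, symmetric]
      by (rule tp_mono[OF herm_Z h spec_pos[OF sp]]) (use d_nonneg s0 in \<open>simp add: distrib_left\<close>)
    moreover have "t - s * q (r + m) s \<le> E r s"
      unfolding E_def tpx[OF s0, symmetric]
      by (rule tp_mono[OF h herm_Z spec_pos[OF sp']]) (use m s0 in \<open>simp add: distrib_left\<close>)
    ultimately show "q r s \<le> k r s" "k r s \<le> q (r + m) s"
      using s0 by (simp_all add: k_def field_simps)
  qed
  show "B + t * ln r \<le> J r" by (rule has_integral_le[OF q kJ le(1)]) auto
  show "J r \<le> B + t * ln (r + m)" by (rule has_integral_le[OF kJ q le(2)]) (use m in auto)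
qed

text \<open>By \<open>J_minus_log_const\<close> the quantity \<open>F\<close> can be evaluated at
  any larger shift \<open>r\<close>. There \<open>J_bounds\<close> confines it to within
  \<open>t * (ln (r + m) - ln r)\<close> of \<open>B\<close>, which is at most
  \<open>t * m / r\<close>.\<close>

lemma J_eq:
  assumes w: "spec n \<rho> w l" and a: "0 < a"
  shows "J a = t + t * ln s\<^sub>0 - (\<Sum>i<n. l i * ln (l i)) + (\<Sum>j<n. p j * ln (d j + a))"
proof -
  define B where "B = t + t * ln s\<^sub>0 - (\<Sum>i<n. l i * ln (l i))"
  define F where "F = J a - (\<Sum>j<n. p j * ln (d j + a))"
  define m where "m = (\<Sum>j<n. d j)"
  have m: "0 \<le> m" "\<And>j. j < n \<Longrightarrow> d j \<le> m"
    unfolding m_def using d_nonneg by (auto intro: sum_nonneg member_le_sum)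
  have bound: "\<bar>F - B\<bar> \<le> t * m / r" if r: "a + 1 \<le> r" "t / s\<^sub>0 \<le> r" for r
  proof -
    have r0: "0 < r" "a < r" using r a by auto
    have "t \<le> s\<^sub>0 * r" using r s0 by (simp add: field_simps)
    note J = J_bounds[OF w r0(1) m this, folded B_def]
    have F: "F = J r - (\<Sum>j<n. p j * ln (d j + r))"
      unfolding F_def using J_minus_log_const[OF a r0(2)] by simp
    have "p j * ln r \<le> p j * ln (d j + r)" "p j * ln (d j + r) \<le> p j * ln (r + m)" if "j < n" for j
      using p_nonneg[of j] d_nonneg[OF that] m(2)[OF that] r0 by (auto intro!: mult_left_mono)
    then have "(\<Sum>j<n. p j * ln r) \<le> (\<Sum>j<n. p j * ln (d j + r))"
      "(\<Sum>j<n. p j * ln (d j + r)) \<le> (\<Sum>j<n. p j * ln (r + m))" by (auto intro!: sum_mono)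
    then have L: "t * ln r \<le> (\<Sum>j<n. p j * ln (d j + r))" "(\<Sum>j<n. p j * ln (d j + r)) \<le> t * ln (r + m)"
      unfolding sum_distrib_right[symmetric] sum_p .
    have "\<bar>F - B\<bar> \<le> t * (ln (r + m) - ln r)"
      unfolding F right_diff_distrib using J L by linarith
    also have "\<dots> \<le> t * (m / r)"
    proof (rule mult_left_mono[OF _ t_nonneg])
      show "ln (r + m) - ln r \<le> m / r"
        using ln_difference_bounds(2)[OF r0(1), of "r + m"] m(1) by (cases "m = 0") auto
    qed
    finally show ?thesis by simp
  qed
  have "((\<lambda>r. t * m / r) \<longlongrightarrow> 0) at_top"
    by (rule tendsto_divide_0[OF tendsto_const filterlim_at_top_imp_at_infinity[OF filterlim_ident]])
  then have "\<bar>F - B\<bar> \<le> 0"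
    by (rule tendsto_lowerbound)
      (auto simp: eventually_at_top_linorder intro!: exI[of _ "max (a + 1) (t / s\<^sub>0)"] bound)
  then show ?thesis unfolding F_def B_def by simp
qed

lemma J_shift:
  assumes "0 \<le> r"
  shows "\<bar>J r - J 0\<bar> \<le> n * s\<^sub>0 * r"
proof -
  have c: "((\<lambda>s. c) has_integral (c * s\<^sub>0)) {0<..s\<^sub>0}" for c :: real
    using has_integral_const_real[of c 0 s\<^sub>0] s0 unfolding has_integral_left_open by (simp add: mult.commute)
  have d: "((\<lambda>s. k r s - k 0 s) has_integral (J r - J 0)) {0<..s\<^sub>0}"
    unfolding J_def by (intro has_integral_diff integrable_integral k_integrable) (use assms in auto)
  have kk: "\<bar>k r s - k 0 s\<bar> \<le> n * r" if s: "s \<in> {0<..s\<^sub>0}" for s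
  proof -
    have "k r s - k 0 s = (E 0 s - E r s) / s" by (simp add: k_def diff_divide_distrib)
    moreover have "\<bar>E 0 s - E r s\<bar> \<le> n * r * s" using E_shift[of s r] s assms by (simp add: mult_ac)
    ultimately show ?thesis using s by (simp only: abs_divide) (simp add: pos_divide_le_eq)
  qed
  have "k r s - k 0 s \<le> n * r" "- (n * r) \<le> k r s - k 0 s" if "s \<in> {0<..s\<^sub>0}" for s
    using kk[OF that] by linarith+
  then have "J r - J 0 \<le> n * r * s\<^sub>0" "- (n * r) * s\<^sub>0 \<le> J r - J 0"
    using has_integral_le[OF d c[of "n * r"]] has_integral_le[OF c[of "- (n * r)"] d] by auto
  then show ?thesis by (simp add: abs_le_iff algebra_simps)
qed

lemma entropy_integral:
  assumes w: "spec n \<rho> w l"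
  shows "J 0 = t + t * ln s\<^sub>0 - ((\<Sum>i<n. l i * ln (l i)) - (\<Sum>j<n. p j * ln (d j)))"
proof -
  have "((\<lambda>r. J r - J 0) \<longlongrightarrow> 0) (at_right 0)"
  proof (rule Lim_null_comparison)
    show "\<forall>\<^sub>F r in at_right 0. norm (J r - J 0) \<le> n * s\<^sub>0 * r"
      using J_shift by (auto simp: eventually_at_filter)
    show "((\<lambda>r. n * s\<^sub>0 * r) \<longlongrightarrow> 0) (at_right 0)"
      by (auto intro!: tendsto_eq_intros)
  qed
  then have 1: "(J \<longlongrightarrow> J 0) (at_right 0)" by (simp add: LIM_zero_cancel)
  have "((\<lambda>r. p j * ln (d j + r)) \<longlongrightarrow> p j * ln (d j)) (at_right 0)" if j: "j < n" for j
  proof (cases "d j = 0")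
    case True
    \<comment> \<open>Domination forces \<open>p j = 0\<close> on the kernel of
      \<open>\<sigma>\<close>, so the term vanishes for every \<open>r\<close> and the convention
      \<open>ln 0 = 0\<close> is harmless in the limit.\<close>
    then have "p j = 0" using p_le[OF j] p_nonneg[of j] by simp
    then show ?thesis by simp
  next
    case False
    then show ?thesis by (auto intro!: tendsto_eq_intros)
  qed
  then have "((\<lambda>r. t + t * ln s\<^sub>0 - (\<Sum>i<n. l i * ln (l i)) + (\<Sum>j<n. p j * ln (d j + r))) \<longlongrightarrow>
      t + t * ln s\<^sub>0 - (\<Sum>i<n. l i * ln (l i)) + (\<Sum>j<n. p j * ln (d j))) (at_right 0)"
    by (intro tendsto_add tendsto_const tendsto_sum) auto
  then have 2: "(J \<longlongrightarrow> t + t * ln s\<^sub>0 - (\<Sum>i<n. l i * ln (l i)) + (\<Sum>j<n. p j * ln (d j))) (at_right 0)"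
    by (rule Lim_transform_eventually) (auto simp: eventually_at_filter J_eq[OF w])
  show ?thesis using tendsto_unique[OF _ 1 2] by simp
qed

end

text \<open>With the same \<open>s\<^sub>0\<close> on both sides, equal entropies and traces give
  equal integrals. The difference \<open>g\<close> of the integrands is nonnegative by
  \<open>mono\<close>, continuous away from 0, and integrates to 0.\<close>

lemma tp_eq_of_entropy_eq:
  assumes P: "dominated_pair n \<rho> \<sigma> u d s\<^sub>0" and P': "dominated_pair n' \<rho>' \<sigma>' u' d' s\<^sub>0"
    and w: "spec n \<rho> w l" and w': "spec n' \<rho>' w' l'"
    and tr: "Re (\<Sum>i<n. \<rho> i i) = Re (\<Sum>i<n'. \<rho>' i i)"
    and ent: "(\<Sum>i<n. l i * ln (l i)) - (\<Sum>j<n. Re (qf n \<rho> (u j)) * ln (d j))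
      = (\<Sum>i<n'. l' i * ln (l' i)) - (\<Sum>j<n'. Re (qf n' \<rho>' (u' j)) * ln (d' j))"
    and mono: "\<And>s. 0 < s \<Longrightarrow> tp n' (\<lambda>i j. \<rho>' i j - of_real s * \<sigma>' i j) \<le> tp n (\<lambda>i j. \<rho> i j - of_real s * \<sigma> i j)"
    and s: "0 < s" "s \<le> s\<^sub>0"
  shows "tp n' (\<lambda>i j. \<rho>' i j - of_real s * \<sigma>' i j) = tp n (\<lambda>i j. \<rho> i j - of_real s * \<sigma> i j)"
proof -
  interpret A: dominated_pair n \<rho> \<sigma> u d s\<^sub>0 by fact
  interpret B: dominated_pair n' \<rho>' \<sigma>' u' d' s\<^sub>0 by fact
  have E: "A.E 0 s = tp n (\<lambda>i j. \<rho> i j - of_real s * \<sigma> i j)"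
    "B.E 0 s = tp n' (\<lambda>i j. \<rho>' i j - of_real s * \<sigma>' i j)" for s
    unfolding A.E_def B.E_def A.Y_def B.Y_def by simp_all
  have t: "A.t = B.t" using tr unfolding A.t_def B.t_def .
  have J: "A.J 0 = B.J 0"
    using ent unfolding A.entropy_integral[OF w] B.entropy_integral[OF w'] t A.p_def B.p_def by simp
  define g where "g = (\<lambda>s. B.k 0 s - A.k 0 s)"
  have g0: "0 \<le> g r" if "0 < r" for r
    using mono[OF that] that t unfolding g_def A.k_def B.k_def E by (simp add: divide_right_mono)
  have gI: "(g has_integral 0) {0<..s\<^sub>0}"
    using has_integral_diff[OF integrable_integral[OF B.k_integrable[of 0]] integrable_integral[OF A.k_integrable[of 0]]]
      J unfolding g_def A.J_def B.J_def by simp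
  \<comment> \<open>Starting at \<open>s / 2\<close> stays clear of the division by 0 and keeps
    \<open>s\<close> in the interval.\<close>
  have c: "continuous_on {s / 2..s\<^sub>0} g"
    unfolding g_def
    by (intro continuous_intros continuous_on_subset[OF A.continuous_k] continuous_on_subset[OF B.continuous_k])
      (use s in auto)
  have i: "g integrable_on {s / 2..s\<^sub>0}" by (rule integrable_continuous_real[OF c])
  have "integral {s / 2..s\<^sub>0} g \<le> 0"
    by (rule has_integral_subset_le[OF _ integrable_integral[OF i] gI]) (use g0 s in auto)
  moreover have "0 \<le> integral {s / 2..s\<^sub>0} g"
    using g0 s by (intro integral_nonneg i) auto
  ultimately have "integral {s / 2..s\<^sub>0} g = 0" by simp
  then have "\<forall>x\<in>{s / 2..s\<^sub>0}. g x = 0"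
    by (subst (asm) integral_eq_0_iff[OF c]) (use g0 s in auto)
  then have "g s = 0" using s by auto
  then show ?thesis using s t unfolding g_def A.k_def B.k_def E by simp
qed

subsection \<open>Extremal multipliers\<close>

text \<open>In an eigenbasis the vanishing form is a sum of nonnegative terms, so \<open>v\<close>
  is orthogonal to every eigenvector with nonzero eigenvalue.\<close>

lemma pos_qf_zero:
  assumes B: "pos n B" and z: "qf n B v = 0" and i: "i < n"
  shows "(\<Sum>j<n. B i j * v j) = 0"
proof -
  obtain u b where s: "spec n B u b" using herm_spec[OF pos_herm[OF B]] .
  have nn: "0 \<le> b m" if "m < n" for m using spec_pos_nonneg[OF s B that] .
  have "(\<Sum>m<n. b m * (cmod (cin n (u m) v))\<^sup>2) = 0"
    using z unfolding qf_spec[OF s] of_real_eq_0_iff .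
  then have b0: "b m * (cmod (cin n (u m) v))\<^sup>2 = 0" if "m < n" for m
    using that nn by (subst (asm) sum_nonneg_eq_0_iff) auto
  have "(\<Sum>j<n. B i j * v j) = (\<Sum>j<n. \<Sum>m<n. of_real (b m) * u m i * (cnj (u m j) * v j))"
    using s i by (simp add: spec_def sum_distrib_right sum_distrib_left mult_ac)
  also have "\<dots> = (\<Sum>m<n. of_real (b m) * u m i * cin n (u m) v)"
    unfolding cin_def by (subst sum.swap) (simp add: sum_distrib_left)
  also have "\<dots> = 0" using b0 by (intro sum.neutral) auto
  finally show ?thesis .
qed

text \<open>In the eigenbasis of \<open>B\<close> every entry of \<open>A\<close> with an index in
  the kernel of \<open>B\<close> vanishes, and the coordinates outside the kernel are controlled by
  the form of \<open>B\<close>.\<close>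

lemma dominated_of_kernel:
  assumes A: "herm n A" and B: "pos n B"
    and ker: "\<And>x. (\<forall>i<n. (\<Sum>j<n. B i j * x j) = 0) \<Longrightarrow> (\<forall>i<n. (\<Sum>j<n. A i j * x j) = 0)"
  obtains s where "0 < s" "pos n (\<lambda>i j. of_real s * B i j - A i j)"
proof -
  obtain u b where s: "spec n B u b" using herm_spec[OF pos_herm[OF B]] .
  then have o: "ortho n n u" by (simp add: spec_def)
  have nn: "0 \<le> b m" if "m < n" for m using spec_pos_nonneg[OF s B that] .
  define a where "a = (\<lambda>j k. \<Sum>p<n. \<Sum>q<n. cnj (u j p) * A p q * u k q)"
  have a_cin: "a j k = cin n (u j) (\<lambda>p. \<Sum>q<n. A p q * u k q)" for j k
    unfolding a_def cin_def by (simp add: sum_distrib_left mult_ac)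
  have Au: "\<forall>i<n. (\<Sum>q<n. A i q * u k q) = 0" if "k < n" "b k = 0" for k
    by (rule ker) (use spec_eigen[OF s that(1)] that(2) in simp)
  have a0: "a j k = 0" if "k < n" "b k = 0" for j k
    unfolding a_cin cin_def using Au[OF that] by simp
  have a0': "a j k = 0" if "j < n" "b j = 0" for j k
  proof -
    have "a j k = cin n (\<lambda>p. \<Sum>q<n. A p q * u j q) (u k)"
      unfolding a_cin by (rule herm_swap[OF A])
    then show ?thesis unfolding cin_def using Au[OF that] by simp
  qed
  \<comment> \<open>Crude constants: the sum of all entries of \<open>A\<close> in modulus and the
    sum of the inverse eigenvalues of \<open>B\<close>. Kernel directions add nothing to
    \<open>M\<close>, since \<open>1 / 0 = 0\<close>.\<close>
  define K where "K = (\<Sum>j<n. \<Sum>k<n. cmod (a j k))"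
  define M where "M = (\<Sum>j<n. 1 / b j)"
  have K: "0 \<le> K" unfolding K_def by (intro sum_nonneg) auto
  have M: "1 / b j \<le> M" "0 \<le> M" if "j < n" for j
    unfolding M_def using nn that by (auto intro!: member_le_sum sum_nonneg)
  have M0: "0 \<le> M" unfolding M_def using nn by (auto intro!: sum_nonneg)
  have bound: "Re (qf n A x) \<le> K * M * Re (qf n B x)" for x
  proof -
    define y where "y = (\<lambda>k. cin n (u k) x)"
    define S where "S = Re (qf n B x)"
    have S: "S = (\<Sum>m<n. b m * (cmod (y m))\<^sup>2)" unfolding S_def qf_spec[OF s] y_def by simp
    have S0: "0 \<le> S" unfolding S using nn by (auto intro!: sum_nonneg)
    have ySM: "(cmod (y j))\<^sup>2 \<le> S * M" if j: "j < n" "b j \<noteq> 0" for j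
    proof -
      have bj: "0 < b j" using nn[OF j(1)] j(2) by simp
      have "b j * (cmod (y j))\<^sup>2 \<le> S"
        unfolding S using nn j(1) by (intro member_le_sum) auto
      then have "(cmod (y j))\<^sup>2 \<le> S * (1 / b j)" using bj by (simp add: field_simps)
      also have "\<dots> \<le> S * M" using M(1)[OF j(1)] S0 by (rule mult_left_mono)
      finally show ?thesis .
    qed
    have "qf n A x = qf n A (\<lambda>p. \<Sum>k<n. y k * u k p)"
      by (rule qf_cong_vec) (simp add: y_def ortho_expand[OF o, symmetric])
    also have "\<dots> = qf n a y" unfolding a_def by (rule qf_congruence[symmetric])
    finally have "Re (qf n A x) \<le> cmod (qf n a y)" using complex_Re_le_cmod by simp
    also have "\<dots> \<le> (\<Sum>j<n. \<Sum>k<n. cmod (cnj (y j) * a j k * y k))"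
      unfolding qf_def by (rule order_trans[OF norm_sum]) (intro sum_mono norm_sum)
    also have "\<dots> \<le> (\<Sum>j<n. \<Sum>k<n. cmod (a j k) * (S * M))"
    proof (intro sum_mono)
      fix j k assume "j \<in> {..<n}" "k \<in> {..<n}"
      then have jk: "j < n" "k < n" by auto
      show "cmod (cnj (y j) * a j k * y k) \<le> cmod (a j k) * (S * M)"
      proof (cases "b j = 0 \<or> b k = 0")
        case True
        then have "a j k = 0" using a0 a0' jk by blast
        then show ?thesis by simp
      next
        case False
        have "2 * (cmod (y j) * cmod (y k)) \<le> (cmod (y j))\<^sup>2 + (cmod (y k))\<^sup>2"
          using sum_squares_bound[of "cmod (y j)" "cmod (y k)"] by simp
        also have "\<dots> \<le> S * M + S * M" using False jk ySM by (intro add_mono) auto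
        finally have "cmod (y j) * cmod (y k) \<le> S * M" by linarith
        then have "cmod (a j k) * (cmod (y j) * cmod (y k)) \<le> cmod (a j k) * (S * M)"
          by (rule mult_left_mono) simp
        then show ?thesis by (simp add: norm_mult mult_ac)
      qed
    qed
    also have "\<dots> = K * M * S" unfolding K_def sum_distrib_right by (simp add: mult_ac)
    finally show ?thesis unfolding S_def .
  qed
  show thesis
  proof (rule that)
    \<comment> \<open>The added 1 makes the multiplier positive even if \<open>K * M = 0\<close>;
      domination survives because \<open>B\<close> is positive.\<close>
    show "0 < K * M + 1" using K M0 by (simp add: add_nonneg_pos)
    show "pos n (\<lambda>i j. of_real (K * M + 1) * B i j - A i j)"
    proof (rule posI)
      show "herm n (\<lambda>i j. of_real (K * M + 1) * B i j - A i j)"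
        using herm_add_scale[OF herm_uminus[OF A] pos_herm[OF B], of "K * M + 1"] by simp
      fix x
      show "0 \<le> Re (qf n (\<lambda>i j. of_real (K * M + 1) * B i j - A i j) x)"
        using bound[of x] posD[OF B, of x] unfolding qf_simps by (simp add: algebra_simps)
    qed
  qed
qed

text \<open>This is the largest generalized eigenvalue of \<open>A\<close> relative to
  \<open>B\<close>. As \<open>B\<close> may be singular, the witness has to avoid its kernel: it is
  taken from the kernel of \<open>\<gamma> B - A\<close> and normalized by its
  \<open>B\<close>-form, not by its norm.\<close>

lemma extremal_multiplier:
  assumes A: "herm n A" and B: "pos n B" and tr: "0 < Re (\<Sum>i<n. B i i)"
    and s: "pos n (\<lambda>i j. of_real s * B i j - A i j)"
  obtains \<gamma> v where "\<gamma> \<le> s" "pos n (\<lambda>i j. of_real \<gamma> * B i j - A i j)"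
    "Re (qf n B v) = 1" "Re (qf n A v) = \<gamma>"
proof -
  define G where "G = {\<gamma>. pos n (\<lambda>i j. of_real \<gamma> * B i j - A i j)}"
  define \<gamma> where "\<gamma> = Inf G"
  have hZ: "herm n (\<lambda>i j. of_real g * B i j - A i j)" for g
    using herm_add_scale[OF herm_uminus[OF A] pos_herm[OF B], of g] by simp
  have sG: "s \<in> G" using s by (simp add: G_def)
  have lower: "Re (\<Sum>i<n. A i i) / Re (\<Sum>i<n. B i i) \<le> g" if "g \<in> G" for g
  proof -
    have "0 \<le> ip n idm (\<lambda>i j. of_real g * B i j - A i j)"
      using that ip_pos[OF pos_idm] unfolding G_def by blast
    then have "Re (\<Sum>i<n. A i i) \<le> g * Re (\<Sum>i<n. B i i)"
      unfolding ip_diff ip_scale by (simp only: ip_idm diff_ge_0_iff_ge)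
    then show ?thesis using tr by (simp only: pos_divide_le_eq)
  qed
  have bdd: "bdd_below G" using lower by (rule bdd_belowI)
  have le: "\<gamma> \<le> s" unfolding \<gamma>_def by (rule cInf_lower[OF sG bdd])
  have Z: "pos n (\<lambda>i j. of_real \<gamma> * B i j - A i j)"
  proof (rule posI[OF hZ])
    fix x
    have G: "Re (qf n A x) \<le> g * Re (qf n B x)" if "g \<in> G" for g
      using that posD[of n _ x] unfolding G_def by (force simp: qf_simps)
    have "Re (qf n A x) \<le> \<gamma> * Re (qf n B x)"
    proof (cases "Re (qf n B x) = 0")
      case True
      then show ?thesis using G[OF sG] by simp
    next
      case False
      then have b: "0 < Re (qf n B x)" using posD[OF B, of x] by simp
      have "Re (qf n A x) / Re (qf n B x) \<le> \<gamma>"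
        unfolding \<gamma>_def using sG G b by (intro cInf_greatest) (auto simp: pos_divide_le_eq)
      then show ?thesis using b by (simp add: pos_divide_le_eq)
    qed
    then show "0 \<le> Re (qf n (\<lambda>i j. of_real \<gamma> * B i j - A i j) x)" by (simp add: qf_simps)
  qed
  \<comment> \<open>Otherwise \<open>\<gamma> B - A\<close> dominates a multiple of \<open>B\<close>, and \<open>\<gamma>\<close> could be lowered.\<close>
  have "\<exists>x. (\<forall>i<n. (\<Sum>j<n. (of_real \<gamma> * B i j - A i j) * x j) = 0) \<and> \<not> (\<forall>i<n. (\<Sum>j<n. B i j * x j) = 0)"
  proof (rule ccontr)
    assume "\<not> ?thesis"
    then have ker: "\<forall>i<n. (\<Sum>j<n. B i j * x j) = 0"
      if "\<forall>i<n. (\<Sum>j<n. (of_real \<gamma> * B i j - A i j) * x j) = 0" for x using that by blast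
    obtain r where r: "0 < r" "pos n (\<lambda>i j. of_real r * (of_real \<gamma> * B i j - A i j) - B i j)"
      using dominated_of_kernel[OF pos_herm[OF B] Z ker] by blast
    have "\<gamma> - 1 / r \<in> G"
      unfolding G_def mem_Collect_eq
    proof (rule posI[OF hZ])
      fix x
      have "0 \<le> r * (\<gamma> * Re (qf n B x) - Re (qf n A x)) - Re (qf n B x)"
        using posD[OF r(2), of x] by (simp add: qf_simps)
      then have "Re (qf n B x) / r \<le> \<gamma> * Re (qf n B x) - Re (qf n A x)"
        using r(1) by (simp add: field_simps)
      then show "0 \<le> Re (qf n (\<lambda>i j. of_real (\<gamma> - 1 / r) * B i j - A i j) x)"
        unfolding qf_simps by (simp add: algebra_simps)
    qed
    then have "\<gamma> \<le> \<gamma> - 1 / r" unfolding \<gamma>_def by (rule cInf_lower[OF _ bdd])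
    then show False using r(1) by simp
  qed
  then obtain x where x: "\<forall>i<n. (\<Sum>j<n. (of_real \<gamma> * B i j - A i j) * x j) = 0"
    "\<not> (\<forall>i<n. (\<Sum>j<n. B i j * x j) = 0)" by blast
  have qB: "0 < Re (qf n B x)"
  proof -
    have "qf n B x \<noteq> 0" using pos_qf_zero[OF B] x(2) by blast
    moreover have "Im (qf n B x) = 0" using herm_qf_real[OF pos_herm[OF B]] .
    ultimately show ?thesis using posD[OF B, of x] by (simp add: complex_eq_iff)
  qed
  have "qf n (\<lambda>i j. of_real \<gamma> * B i j - A i j) x = 0"
    unfolding qf_cin cin_def using x(1) by simp
  then have qA: "Re (qf n A x) = \<gamma> * Re (qf n B x)" by (simp add: qf_simps complex_eq_iff)
  define c where "c = 1 / sqrt (Re (qf n B x))"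
  have c: "c\<^sup>2 * Re (qf n B x) = 1" using qB by (simp add: c_def power_divide)
  have q: "Re (qf n C (\<lambda>i. of_real c * x i)) = c\<^sup>2 * Re (qf n C x)" for C
  proof -
    have "qf n C (\<lambda>i. of_real c * x i) = of_real (c\<^sup>2) * qf n C x"
      unfolding qf_def sum_distrib_left by (simp add: power2_eq_square mult_ac)
    moreover have "Re (of_real e * w) = e * Re w" for e w by simp
    ultimately show ?thesis by (simp only:)
  qed
  have "Re (qf n B (\<lambda>i. of_real c * x i)) = 1" "Re (qf n A (\<lambda>i. of_real c * x i)) = \<gamma>"
    using c by (simp_all add: q qA)
  then show thesis using that[OF le Z] by blast
qed

text \<open>With unit traces both order relations are values of \<open>tp\<close>:
  \<open>\<rho> \<le> s \<sigma>\<close> means that \<open>tp\<close> of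
  \<open>\<rho> - s \<sigma>\<close> is 0, and \<open>s \<sigma> \<le> \<rho>\<close> that it is
  \<open>1 - s\<close>. The constants come from \<open>extremal_multiplier\<close> for
  \<open>\<rho>'\<close> and for \<open>- \<rho>'\<close>.\<close>

lemma order_interval_transfer:
  assumes "pos n \<rho>" "pos n \<sigma>" "pos n' \<rho>'" "pos n' \<sigma>'"
    and tr: "Re (\<Sum>i<n. \<rho> i i) = 1" "Re (\<Sum>i<n. \<sigma> i i) = 1" "Re (\<Sum>i<n'. \<rho>' i i) = 1" "Re (\<Sum>i<n'. \<sigma>' i i) = 1"
    and dom: "pos n' (\<lambda>i j. of_real s\<^sub>0 * \<sigma>' i j - \<rho>' i j)"
    and eq: "\<And>s. 0 < s \<Longrightarrow> s \<le> s\<^sub>0 \<Longrightarrow>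
      tp n' (\<lambda>i j. \<rho>' i j - of_real s * \<sigma>' i j) = tp n (\<lambda>i j. \<rho> i j - of_real s * \<sigma> i j)"
  obtains m M v w where "m \<le> M" "pos n (\<lambda>i j. of_real M * \<sigma> i j - \<rho> i j)" "pos n (\<lambda>i j. \<rho> i j - of_real m * \<sigma> i j)"
    "Re (qf n' \<sigma>' v) = 1" "Re (qf n' \<rho>' v) = M" "Re (qf n' \<sigma>' w) = 1" "Re (qf n' \<rho>' w) = m"
proof -
  note h = assms(1-4)[THEN pos_herm]
  obtain M v where M: "M \<le> s\<^sub>0" "pos n' (\<lambda>i j. of_real M * \<sigma>' i j - \<rho>' i j)"
    "Re (qf n' \<sigma>' v) = 1" "Re (qf n' \<rho>' v) = M"
    using extremal_multiplier[OF h(3) assms(4) _ dom] tr(4) by auto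
  have z: "pos n' (\<lambda>i j. of_real 0 * \<sigma>' i j - - \<rho>' i j)" using assms(3) by simp
  have tr0: "0 < Re (\<Sum>i<n'. \<sigma>' i i)" using tr(4) by simp
  obtain g w where g: "g \<le> 0" "pos n' (\<lambda>i j. of_real g * \<sigma>' i j - - \<rho>' i j)"
    "Re (qf n' \<sigma>' w) = 1" "Re (qf n' (\<lambda>i j. - \<rho>' i j) w) = g"
    using extremal_multiplier[OF herm_uminus[OF h(3)] assms(4) tr0 z] by blast
  define m where "m = - g"
  have m: "0 \<le> m" "pos n' (\<lambda>i j. - (of_real m * \<sigma>' i j - \<rho>' i j))" "Re (qf n' \<rho>' w) = m"
    using g by (simp_all add: m_def qf_simps add.commute)
  \<comment> \<open>Comparing traces gives \<open>m \<le> 1 \<le> M\<close>, which places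
    \<open>M\<close> and every nonzero \<open>m\<close> in the range of \<open>eq\<close>.\<close>
  have "0 \<le> ip n' idm (\<lambda>i j. of_real M * \<sigma>' i j - \<rho>' i j)" by (rule ip_pos[OF pos_idm M(2)])
  then have M1: "1 \<le> M" unfolding ip_diff ip_scale using tr by (simp only: ip_idm)
  have "0 \<le> ip n' idm (\<lambda>i j. \<rho>' i j - of_real m * \<sigma>' i j)" by (rule ip_pos[OF pos_idm]) (use m(2) in simp)
  then have m1: "m \<le> 1" unfolding ip_diff ip_scale using tr by (simp only: ip_idm)
  have hd: "herm n (\<lambda>i j. \<rho> i j - of_real s * \<sigma> i j)" "herm n' (\<lambda>i j. \<rho>' i j - of_real s * \<sigma>' i j)" for s
    using herm_diff_scale h by blast+
  have up: "pos n (\<lambda>i j. of_real M * \<sigma> i j - \<rho> i j)"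
  proof -
    have "tp n' (\<lambda>i j. \<rho>' i j - of_real M * \<sigma>' i j) = 0"
      unfolding tp_eq_0_iff[OF hd(2)] using M(2) by simp
    then have "tp n (\<lambda>i j. \<rho> i j - of_real M * \<sigma> i j) = 0" using eq[of M] M(1) M1 by simp
    then show ?thesis unfolding tp_eq_0_iff[OF hd(1)] by simp
  qed
  have lo: "pos n (\<lambda>i j. \<rho> i j - of_real m * \<sigma> i j)"
  proof (cases "m = 0")
    case True
    then show ?thesis using assms(1) by simp
  next
    case False
    have u: "tp k (\<lambda>i j. - (A i j - of_real m * B i j)) = tp k (\<lambda>i j. A i j - of_real m * B i j) - (1 - m)"
      if "herm k (\<lambda>i j. A i j - of_real m * B i j)" "Re (\<Sum>i<k. A i i) = 1" "Re (\<Sum>i<k. B i i) = 1" for A B k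
    proof -
      have "Re (\<Sum>i<k. A i i - of_real m * B i i) = ip k idm (\<lambda>i j. A i j - of_real m * B i j)"
        by (rule ip_idm[symmetric])
      also have "\<dots> = 1 - m * 1" unfolding ip_diff ip_scale ip_idm that(2,3) ..
      finally show ?thesis unfolding tp_uminus[OF that(1)] by simp
    qed
    have "tp n' (\<lambda>i j. - (\<rho>' i j - of_real m * \<sigma>' i j)) = 0"
      unfolding tp_eq_0_iff[OF herm_uminus[OF hd(2)]] using m(2) by simp
    moreover have "tp n' (\<lambda>i j. \<rho>' i j - of_real m * \<sigma>' i j) = tp n (\<lambda>i j. \<rho> i j - of_real m * \<sigma> i j)"
      using False m(1) m1 M1 M(1) by (intro eq) auto
    ultimately have "tp n (\<lambda>i j. - (\<rho> i j - of_real m * \<sigma> i j)) = 0"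
      using u[OF hd(1) tr(1,2)] u[OF hd(2) tr(3,4)] by simp
    then show ?thesis unfolding tp_eq_0_iff[OF herm_uminus[OF hd(1)]] by simp
  qed
  show thesis by (rule that[OF _ up lo M(3,4) g(3) m(3)]) (use m1 M1 in simp)
qed

subsection \<open>Matrices and relative entropy\<close>

abbreviation ent :: "complex mat \<Rightarrow> nat \<Rightarrow> nat \<Rightarrow> complex" where
  "ent A \<equiv> \<lambda>i j. A $$ (i, j)"

lemma mult_mat_vec_index:
  assumes "A \<in> carrier_mat n n" "v \<in> carrier_vec n" "i < n"
  shows "(A *\<^sub>v v) $ i = (\<Sum>j<n. A $$ (i, j) * v $ j)"
  using assms by (auto simp: scalar_prod_def lessThan_atLeast0 intro!: sum.cong)

lemma cscalar_prod_cin: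
  assumes "v \<in> carrier_vec n" "w \<in> carrier_vec n"
  shows "v \<bullet>c w = cin n (\<lambda>i. w $ i) (\<lambda>i. v $ i)"
  using assms by (simp add: scalar_prod_def cin_def lessThan_atLeast0 mult.commute)

lemma psd_iff_pos: "psd n A \<longleftrightarrow> A \<in> carrier_mat n n \<and> pos n (ent A)"
proof -
  have q: "(A *\<^sub>v v) \<bullet>c v = qf n (ent A) (\<lambda>i. v $ i)" if "A \<in> carrier_mat n n" "v \<in> carrier_vec n" for v
  proof -
    have "(A *\<^sub>v v) \<bullet>c v = cin n (\<lambda>i. v $ i) (\<lambda>i. (A *\<^sub>v v) $ i)"
      using that by (intro cscalar_prod_cin) auto
    also have "\<dots> = qf n (ent A) (\<lambda>i. v $ i)"
      unfolding qf_cin cin_def by (intro sum.cong refl) (simp only: mult_mat_vec_index[OF that] lessThan_iff)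
    finally show ?thesis .
  qed
  have "qf n (ent A) x = qf n (ent A) (\<lambda>i. vec n x $ i)" for x
    by (rule qf_cong_vec) simp
  then show ?thesis unfolding psd_def pos_def using q by (metis vec_carrier)
qed

lemma mat_adjoint_index:
  assumes "U \<in> carrier_mat n n" "i < n" "j < n"
  shows "mat_adjoint U $$ (i, j) = cnj (U $$ (j, i))"
  using assms by (simp add: mat_adjoint_def mat_of_rows_def)

lemma mat_adjoint_carrier: "U \<in> carrier_mat n n \<Longrightarrow> mat_adjoint U \<in> carrier_mat n n"
  by (auto simp: mat_adjoint_def mat_of_rows_def)

lemma diagonal_form_index:
  assumes U: "U \<in> carrier_mat n n" and ij: "i < n" "j < n"
  shows "(U * mat_diag n g * mat_adjoint U) $$ (i, j) = (\<Sum>m<n. g m * U $$ (i, m) * cnj (U $$ (j, m)))"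
proof -
  have "U * mat_diag n g = mat n n (\<lambda>(i, j). U $$ (i, j) * g j)"
    by (rule mat_diag_mult_right[OF U])
  then show ?thesis
    using ij U mat_adjoint_carrier[OF U]
    by (auto simp: scalar_prod_def mat_adjoint_index[OF U] lessThan_atLeast0 mult_ac intro!: sum.cong)
qed

lemma spec_of_diagonal_form:
  assumes U: "U \<in> carrier_mat n n" and o: "mat_adjoint U * U = 1\<^sub>m n"
    and A: "A = U * mat_diag n (\<lambda>i. complex_of_real (d i)) * mat_adjoint U"
  shows "spec n (ent A) (\<lambda>m i. U $$ (i, m)) d"
  unfolding spec_def ortho_def
proof (intro conjI allI impI)
  fix l m assume lm: "l < n" "m < n"
  have "(mat_adjoint U * U) $$ (l, m) = (1\<^sub>m n :: complex mat) $$ (l, m)" using o by simp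
  moreover have "(mat_adjoint U * U) $$ (l, m) = cin n (\<lambda>i. U $$ (i, l)) (\<lambda>i. U $$ (i, m))"
    using lm U mat_adjoint_carrier[OF U]
    by (auto simp: scalar_prod_def mat_adjoint_index[OF U] cin_def lessThan_atLeast0 intro!: sum.cong)
  ultimately show "cin n (\<lambda>i. U $$ (i, l)) (\<lambda>i. U $$ (i, m)) = (if l = m then 1 else 0)"
    using lm by simp
next
  fix i j assume "i < n" "j < n"
  then show "A $$ (i, j) = (\<Sum>m<n. of_real (d m) * U $$ (i, m) * cnj (U $$ (j, m)))"
    unfolding A by (rule diagonal_form_index[OF U])
qed

text \<open>The overlap of \<open>v l\<close> and \<open>u m\<close> vanishes unless
  \<open>e l = d m\<close>, so \<open>f (d m)\<close> may be exchanged for \<open>f (e l)\<close> in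
  front of it.\<close>

lemma spec_fun_unique:
  assumes u: "spec n A u d" and v: "spec n A v e" and ij: "i < n" "j < n"
  shows "(\<Sum>m<n. of_real (f (d m)) * u m i * cnj (u m j)) = (\<Sum>l<n. of_real (f (e l)) * v l i * cnj (v l j))"
proof -
  have ou: "ortho n n u" and ov: "ortho n n v" using u v by (simp_all add: spec_def)
  have g: "of_real (f (d m)) * cin n (v l) (u m) = of_real (f (e l)) * cin n (v l) (u m)"
    if "m < n" "l < n" for m l
  proof -
    have "of_real (d m) * cin n (v l) (u m) = cin n (v l) (\<lambda>i. \<Sum>j<n. A i j * u m j)"
      unfolding cin_def using spec_eigen[OF u that(1)] by (simp add: sum_distrib_left mult_ac)
    also have "\<dots> = cin n (\<lambda>i. \<Sum>j<n. A i j * v l j) (u m)"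
      by (rule herm_swap[OF spec_herm[OF u]])
    also have "\<dots> = of_real (e l) * cin n (v l) (u m)"
      unfolding cin_def using spec_eigen[OF v that(2)] by (simp add: sum_distrib_left mult_ac)
    finally show ?thesis by auto
  qed
  have "(\<Sum>m<n. of_real (f (d m)) * u m i * cnj (u m j))
      = (\<Sum>m<n. of_real (f (d m)) * (\<Sum>l<n. cin n (v l) (u m) * v l i) * cnj (u m j))"
    using ortho_expand[OF ov ij(1)] by simp
  also have "\<dots> = (\<Sum>m<n. \<Sum>l<n. of_real (f (d m)) * cin n (v l) (u m) * v l i * cnj (u m j))"
    by (simp add: sum_distrib_left sum_distrib_right mult_ac)
  also have "\<dots> = (\<Sum>m<n. \<Sum>l<n. of_real (f (e l)) * v l i * (cin n (v l) (u m) * cnj (u m j)))"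
    using g by (intro sum.cong refl) (simp add: mult_ac)
  also have "\<dots> = (\<Sum>l<n. of_real (f (e l)) * v l i * (\<Sum>m<n. cin n (v l) (u m) * cnj (u m j)))"
    by (subst sum.swap) (simp add: sum_distrib_left)
  also have "\<dots> = (\<Sum>l<n. of_real (f (e l)) * v l i * cnj (v l j))"
  proof (intro sum.cong refl)
    fix l
    have "(\<Sum>m<n. cin n (v l) (u m) * cnj (u m j)) = cnj (\<Sum>m<n. cin n (u m) (v l) * u m j)"
      by (simp add: cin_cnj)
    also have "\<dots> = cnj (v l j)" using ortho_expand[OF ou ij(2), of "v l"] by simp
    finally show "of_real (f (e l)) * v l i * (\<Sum>m<n. cin n (v l) (u m) * cnj (u m j))
        = of_real (f (e l)) * v l i * cnj (v l j)" by simp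
  qed
  finally show ?thesis .
qed

text \<open>By \<open>spec_fun_unique\<close> the definite description in \<open>herm_fun\<close> is
  satisfied by exactly one matrix, which any spectral decomposition computes.\<close>

lemma herm_fun_spec:
  assumes A: "A \<in> carrier_mat n n" and s: "spec n (ent A) u d"
  shows "herm_fun n f A \<in> carrier_mat n n"
    and "spec n (ent (herm_fun n f A)) u (\<lambda>m. f (d m))"
proof -
  let ?R = "\<lambda>B U e. U \<in> carrier_mat n n \<and> mat_adjoint U * U = 1\<^sub>m n \<and>
     A = U * mat_diag n (\<lambda>i. complex_of_real (e i)) * mat_adjoint U \<and>
     B = U * mat_diag n (\<lambda>i. complex_of_real (f (e i))) * mat_adjoint U"
  define U where "U = mat n n (\<lambda>(i, m). u m i)"
  define B where "B = U * mat_diag n (\<lambda>i. complex_of_real (f (d i))) * mat_adjoint U"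
  have U: "U \<in> carrier_mat n n" by (simp add: U_def)
  note Ua = mat_adjoint_carrier[OF U]
  have car: "U * mat_diag n g * mat_adjoint U \<in> carrier_mat n n" for g
    using U Ua by (metis mat_diag_dim mult_carrier_mat)
  have o: "mat_adjoint U * U = 1\<^sub>m n"
  proof (rule eq_matI)
    fix l m assume "l < dim_row (1\<^sub>m n :: complex mat)" "m < dim_col (1\<^sub>m n :: complex mat)"
    then have lm: "l < n" "m < n" by auto
    have "(mat_adjoint U * U) $$ (l, m) = cin n (\<lambda>i. U $$ (i, l)) (\<lambda>i. U $$ (i, m))"
      using lm U Ua
      by (auto simp: scalar_prod_def mat_adjoint_index[OF U] cin_def lessThan_atLeast0 intro!: sum.cong)
    also have "\<dots> = cin n (u l) (u m)" using lm by (simp add: cin_def U_def)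
    finally have "(mat_adjoint U * U) $$ (l, m) = cin n (u l) (u m)" .
    then show "(mat_adjoint U * U) $$ (l, m) = (1\<^sub>m n :: complex mat) $$ (l, m)"
      using s lm by (simp add: spec_def ortho_def)
  qed (use U Ua in auto)
  have "A = U * mat_diag n (\<lambda>i. complex_of_real (d i)) * mat_adjoint U"
  proof (rule eq_matI)
    fix i j
    assume "i < dim_row (U * mat_diag n (\<lambda>i. complex_of_real (d i)) * mat_adjoint U)"
      "j < dim_col (U * mat_diag n (\<lambda>i. complex_of_real (d i)) * mat_adjoint U)"
    then have ij: "i < n" "j < n" using U Ua by auto
    show "A $$ (i, j) = (U * mat_diag n (\<lambda>i. complex_of_real (d i)) * mat_adjoint U) $$ (i, j)"
      unfolding diagonal_form_index[OF U ij] using s ij by (simp add: spec_def U_def)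
  qed (use A U Ua in auto)
  then have R: "?R B U d" using U o by (simp add: B_def)
  have B_ij: "B $$ (i, j) = (\<Sum>m<n. of_real (f (d m)) * u m i * cnj (u m j))" if "i < n" "j < n" for i j
    unfolding B_def diagonal_form_index[OF U that] using that by (simp add: U_def)
  have uniq: "B' = B" if "?R B' U' e" for B' U' e
  proof (rule eq_matI)
    have B': "B' = U' * mat_diag n (\<lambda>i. complex_of_real (f (e i))) * mat_adjoint U'"
      and U': "U' \<in> carrier_mat n n" using that by auto
    have s': "spec n (ent A) (\<lambda>m i. U' $$ (i, m)) e" by (rule spec_of_diagonal_form) (use that in auto)
    show "dim_row B' = dim_row B" "dim_col B' = dim_col B"
      unfolding B' B_def using U U' Ua mat_adjoint_carrier[OF U'] by auto
    fix i j assume "i < dim_row B" "j < dim_col B"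
    then have ij: "i < n" "j < n" using U Ua by (auto simp: B_def)
    show "B' $$ (i, j) = B $$ (i, j)"
      unfolding B' diagonal_form_index[OF U' ij] B_ij[OF ij] by (rule spec_fun_unique[OF s' s ij])
  qed
  have eq: "herm_fun n f A = B"
    unfolding herm_fun_def
  proof (rule the_equality)
    show "\<exists>U d. ?R B U d" using R by blast
    show "B' = B" if "\<exists>U e. ?R B' U e" for B' using that uniq by blast
  qed
  show "herm_fun n f A \<in> carrier_mat n n" unfolding eq B_def by (rule car)
  show "spec n (ent (herm_fun n f A)) u (\<lambda>m. f (d m))"
    unfolding eq using s B_ij by (simp add: spec_def)
qed

lemma mtrace_mult_ip:
  assumes "A \<in> carrier_mat n n" "B \<in> carrier_mat n n"
  shows "Re (mtrace (A * B)) = ip n (ent A) (ent B)"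
  using assms unfolding mtrace_def ip_def
  by (auto simp: scalar_prod_def lessThan_atLeast0 intro!: sum.cong)

text \<open>Each logarithm is paired with \<open>\<rho>\<close> in the eigenbasis of its own
  operator, which gives the sums of \<open>entropy_integral\<close>.\<close>

lemma rel_entropy_finite:
  assumes \<rho>: "\<rho> \<in> carrier_mat n n" and \<sigma>: "\<sigma> \<in> carrier_mat n n"
    and w: "spec n (ent \<rho>) w l" and u: "spec n (ent \<sigma>) u d" and fin: "rel_entropy n \<rho> \<sigma> < \<infinity>"
  shows "supp n \<rho> \<subseteq> supp n \<sigma>"
    and "rel_entropy n \<rho> \<sigma>
      = ereal ((\<Sum>i<n. l i * ln (l i)) - (\<Sum>j<n. Re (qf n (ent \<rho>) (u j)) * ln (d j)))"
proof -
  show sub: "supp n \<rho> \<subseteq> supp n \<sigma>"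
    using fin unfolding rel_entropy_def by (auto split: if_splits)
  note L\<rho> = herm_fun_spec[OF \<rho> w, of ln] and L\<sigma> = herm_fun_spec[OF \<sigma> u, of ln]
  let ?H = "herm_fun n ln \<rho> - herm_fun n ln \<sigma>"
  have "Re (mtrace (\<rho> * ?H)) = ip n (ent \<rho>) (ent ?H)"
    using L\<rho>(1) L\<sigma>(1) by (intro mtrace_mult_ip[OF \<rho>]) auto
  also have "\<dots> = ip n (ent \<rho>) (\<lambda>i j. herm_fun n ln \<rho> $$ (i, j) - herm_fun n ln \<sigma> $$ (i, j))"
    using L\<rho>(1) L\<sigma>(1) unfolding ip_def by (auto intro!: sum.cong)
  also have "\<dots> = (\<Sum>i<n. l i * ln (l i)) - (\<Sum>j<n. Re (qf n (ent \<rho>) (u j)) * ln (d j))"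
    unfolding ip_diff ip_spec[OF L\<rho>(2)] ip_spec[OF L\<sigma>(2)]
    using qf_spec_vec[OF w] by (auto simp: mult.commute intro!: sum.cong)
  finally show "rel_entropy n \<rho> \<sigma>
      = ereal ((\<Sum>i<n. l i * ln (l i)) - (\<Sum>j<n. Re (qf n (ent \<rho>) (u j)) * ln (d j)))"
    using sub unfolding rel_entropy_def by simp
qed

lemma mat_kernel_iff:
  assumes A: "A \<in> carrier_mat n n"
  shows "v \<in> mat_kernel A \<longleftrightarrow> v \<in> carrier_vec n \<and> (\<forall>i<n. (\<Sum>j<n. A $$ (i, j) * v $ j) = 0)"
proof -
  have "A *\<^sub>v v = 0\<^sub>v n \<longleftrightarrow> (\<forall>i<n. (\<Sum>j<n. A $$ (i, j) * v $ j) = 0)" if "v \<in> carrier_vec n"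
    using A mult_mat_vec_index[OF A that] by (auto simp: vec_eq_iff)
  then show ?thesis using A unfolding mat_kernel_def by auto
qed

text \<open>The vector \<open>\<rho> (\<rho> x)\<close> lies in the support of
  \<open>\<rho>\<close>, hence in that of \<open>\<sigma>\<close>, and is orthogonal to the kernel
  vector \<open>x\<close>. This inner product is the squared norm of
  \<open>\<rho> x\<close>.\<close>

lemma supp_subset_kernel:
  assumes \<rho>: "\<rho> \<in> carrier_mat n n" and \<sigma>: "\<sigma> \<in> carrier_mat n n" and h: "herm n (ent \<rho>)"
    and sub: "supp n \<rho> \<subseteq> supp n \<sigma>" and x: "\<forall>i<n. (\<Sum>j<n. \<sigma> $$ (i, j) * x j) = 0"
  shows "\<forall>i<n. (\<Sum>j<n. \<rho> $$ (i, j) * x j) = 0"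
proof -
  define y where "y = (\<lambda>i. \<Sum>j<n. \<rho> $$ (i, j) * x j)"
  define z where "z = (\<lambda>i. \<Sum>j<n. \<rho> $$ (i, j) * y j)"
  have v: "vec n f \<bullet>c w = cin n (\<lambda>i. w $ i) f" if "w \<in> carrier_vec n" for f w
    using that cscalar_prod_cin[of "vec n f" n w] by (simp add: cin_def)
  have "vec n z \<in> supp n \<rho>"
    unfolding supp_def
  proof (intro CollectI conjI ballI)
    fix w assume "w \<in> mat_kernel \<rho>"
    then have w: "w \<in> carrier_vec n" "\<forall>i<n. (\<Sum>j<n. \<rho> $$ (i, j) * w $ j) = 0"
      by (simp_all add: mat_kernel_iff[OF \<rho>])
    have "vec n z \<bullet>c w = cin n (\<lambda>i. \<Sum>j<n. \<rho> $$ (i, j) * w $ j) y"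
      unfolding v[OF w(1)] z_def by (rule herm_swap[OF h])
    also have "\<dots> = 0" using w(2) by (simp add: cin_def)
    finally show "vec n z \<bullet>c w = 0" .
  qed simp
  then have "vec n z \<in> supp n \<sigma>" using sub by blast
  moreover have "vec n x \<in> mat_kernel \<sigma>" using x by (simp add: mat_kernel_iff[OF \<sigma>])
  ultimately have "vec n z \<bullet>c vec n x = 0" unfolding supp_def by blast
  then have "cin n x z = 0" unfolding v[OF vec_carrier] by (simp add: cin_def)
  then have "cin n y y = 0" unfolding z_def herm_swap[OF h] y_def[symmetric] .
  then have "(\<Sum>i<n. (cmod (y i))\<^sup>2) = 0" unfolding cin_self of_real_eq_0_iff .
  then have "\<forall>i<n. y i = 0" by (subst (asm) sum_nonneg_eq_0_iff) auto
  then show ?thesis unfolding y_def .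
qed

subsection \<open>Maps given by their matrix units\<close>

lemma block_index: "p < r \<Longrightarrow> k < b \<Longrightarrow> p * b + k < r * (b :: nat)"
proof -
  assume "p < r" "k < b"
  then have "p * b + k < Suc p * b" by simp
  also have "\<dots> \<le> r * b" using \<open>p < r\<close> by (intro mult_le_mono1) simp
  finally show ?thesis .
qed

lemma block_cases:
  assumes "i < r * (b :: nat)"
  obtains p k where "p < r" "k < b" "i = p * b + k"
proof -
  have "b > 0" using assms by (cases b) auto
  then show thesis using that[of "i div b" "i mod b"] assms by (simp add: less_mult_imp_div_less)
qed

lemma sum_blocks: "(\<Sum>i<r * b. f i) = (\<Sum>p<r. \<Sum>k<b. f (p * b + k))"
  for f :: "nat \<Rightarrow> complex"
proof -
  have "(\<Sum>i<r * b. f i) = (\<Sum>p<r. sum f {p * b..<p * b + b})" by (rule sum.nat_group[symmetric])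
  also have "\<dots> = (\<Sum>p<r. \<Sum>k<b. f (p * b + k))"
  proof (rule sum.cong[OF refl])
    fix p
    show "sum f {p * b..<p * b + b} = (\<Sum>k<b. f (p * b + k))"
      using sum.shift_bounds_nat_ivl[of f 0 "p * b" b] by (simp add: lessThan_atLeast0 add.commute)
  qed
  finally show ?thesis .
qed

lemma qf_blocks:
  "qf (r * b) A w = (\<Sum>p<r. \<Sum>q<r. \<Sum>k<b. \<Sum>l<b.
     cnj (w (p * b + k)) * A (p * b + k) (q * b + l) * w (q * b + l))"
  unfolding qf_def sum_blocks by (rule sum.cong[OF refl sum.swap])

lemma sum_swap4:
  "(\<Sum>a\<in>A. \<Sum>b\<in>B. \<Sum>c\<in>C. \<Sum>d\<in>D. f a b c d) = (\<Sum>c\<in>C. \<Sum>d\<in>D. \<Sum>a\<in>A. \<Sum>b\<in>B. f a b c d)"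
proof -
  have "(\<Sum>a\<in>A. \<Sum>b\<in>B. \<Sum>c\<in>C. \<Sum>d\<in>D. f a b c d) = (\<Sum>c\<in>C. \<Sum>a\<in>A. \<Sum>b\<in>B. \<Sum>d\<in>D. f a b c d)"
    by (rule sum3_rotate)
  also have "\<dots> = (\<Sum>c\<in>C. \<Sum>d\<in>D. \<Sum>a\<in>A. \<Sum>b\<in>B. f a b c d)"
    by (rule sum.cong[OF refl sum3_rotate])
  finally show ?thesis .
qed

lemma kron_index:
  assumes "A \<in> carrier_mat m m" "B \<in> carrier_mat b b" "p < m" "q < m" "k < b" "l < b"
  shows "kron A B $$ (p * b + k, q * b + l) = A $$ (p, q) * B $$ (k, l)"
  using assms block_index[of p m k b] block_index[of q m l b] by (auto simp: kron_def)

lemma unit_op_index: "k < n \<Longrightarrow> l < n \<Longrightarrow> unit_op n i j $$ (k, l) = (if k = i \<and> l = j then 1 else 0)"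
  by (simp add: unit_op_def)

lemma unit_op_kron:
  assumes "p < e" "q < e" "i < a" "j < a"
  shows "unit_op (e * a) (p * a + i) (q * a + j) = kron (unit_op e p q) (unit_op a i j)"
proof (rule eq_matI)
  have c: "kron (unit_op e p q) (unit_op a i j) \<in> carrier_mat (e * a) (e * a)"
    by (simp add: kron_def unit_op_def)
  then show "dim_row (unit_op (e * a) (p * a + i) (q * a + j)) = dim_row (kron (unit_op e p q) (unit_op a i j))"
    "dim_col (unit_op (e * a) (p * a + i) (q * a + j)) = dim_col (kron (unit_op e p q) (unit_op a i j))"
    by (auto simp: unit_op_def)
  fix x y assume "x < dim_row (kron (unit_op e p q) (unit_op a i j))" "y < dim_col (kron (unit_op e p q) (unit_op a i j))"
  then have "x < e * a" "y < e * a" using c by auto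
  then obtain p' i' q' j' where xy: "p' < e" "i' < a" "x = p' * a + i'" "q' < e" "j' < a" "y = q' * a + j'"
    by (metis block_cases)
  have inj: "r * a + k = s * a + l \<longleftrightarrow> r = s \<and> k = l" if "k < a" "l < a" for r s k l
  proof
    assume eq: "r * a + k = s * a + l"
    then have "(r * a + k) div a = (s * a + l) div a" "(r * a + k) mod a = (s * a + l) mod a" by simp_all
    then show "r = s \<and> k = l" using that by simp
  qed simp
  show "unit_op (e * a) (p * a + i) (q * a + j) $$ (x, y) = kron (unit_op e p q) (unit_op a i j) $$ (x, y)"
    unfolding xy kron_index[OF unit_op_carrier unit_op_carrier xy(1,4,2,5)]
    using xy assms inj by (simp add: unit_op_index block_index)
qed

lemma tensor_map_unit:
  assumes F: "F \<in> lmaps e e'" and N: "N \<in> lmaps a b"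
    and "p < e" "q < e" "i < a" "j < a" "s < e'" "t < e'" "k < b" "l < b"
  shows "tensor_map e e' a b F N (unit_op (e * a) (p * a + i) (q * a + j)) $$ (s * b + k, t * b + l)
    = F (unit_op e p q) $$ (s, t) * N (unit_op a i j) $$ (k, l)"
  unfolding unit_op_kron[OF assms(3-6)] tensor_map_kron[OF F N unit_op_carrier unit_op_carrier]
  by (rule kron_index[OF lmaps_carrier[OF F unit_op_carrier] lmaps_carrier[OF N unit_op_carrier] assms(7-10)])

lemma lmaps_eqI:
  assumes N: "N \<in> lmaps a b" and M: "M \<in> lmaps a b"
    and eq: "\<And>i j k l. i < a \<Longrightarrow> j < a \<Longrightarrow> k < b \<Longrightarrow> l < b \<Longrightarrow>
      N (unit_op a i j) $$ (k, l) = M (unit_op a i j) $$ (k, l)"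
  shows "N = M"
proof (rule PiE_ext)
  show "N \<in> carrier_mat a a \<rightarrow>\<^sub>E carrier_mat b b" "M \<in> carrier_mat a a \<rightarrow>\<^sub>E carrier_mat b b"
    using N M by (auto simp: lmaps_def)
  fix X :: "complex mat" assume X: "X \<in> carrier_mat a a"
  show "N X = M X"
    by (rule eq_matI)
      (use lmaps_carrier[OF N X] lmaps_carrier[OF M X] lmaps_expand[OF N X] lmaps_expand[OF M X] eq in auto)
qed

lemma id_map_lmaps: "id_map r \<in> lmaps r r"
  unfolding id_map_def lmaps_def by auto

lemma id_tensor_lmaps: "id_tensor r a b N \<in> lmaps (r * a) (r * b)"
  unfolding id_tensor_def by (rule tensor_map_lmaps)

lemma id_tensor_index:
  assumes N: "N \<in> lmaps a b" and X: "X \<in> carrier_mat (r * a) (r * a)"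
    and pq: "p < r" "q < r" and kl: "k < b" "l < b"
  shows "id_tensor r a b N X $$ (p * b + k, q * b + l)
    = (\<Sum>i<a. \<Sum>j<a. X $$ (p * a + i, q * a + j) * N (unit_op a i j) $$ (k, l))"
proof -
  let ?T = "\<lambda>p' i q' j. X $$ (p' * a + i, q' * a + j) *
      (id_map r (unit_op r p' q') $$ (p, q) * N (unit_op a i j) $$ (k, l))"
  let ?S = "\<lambda>i. \<Sum>j<a. X $$ (p * a + i, q * a + j) * N (unit_op a i j) $$ (k, l)"
  have "id_tensor r a b N X $$ (p * b + k, q * b + l) = (\<Sum>x<r * a. \<Sum>y<r * a. X $$ (x, y) *
      id_tensor r a b N (unit_op (r * a) x y) $$ (p * b + k, q * b + l))"
    by (rule lmaps_expand[OF id_tensor_lmaps X block_index[OF pq(1) kl(1)] block_index[OF pq(2) kl(2)]])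
  also have "\<dots> = (\<Sum>p'<r. \<Sum>i<a. \<Sum>q'<r. \<Sum>j<a. ?T p' i q' j)"
    unfolding sum_blocks id_tensor_def
    by (intro sum.cong refl) (use tensor_map_unit[OF id_map_lmaps N] pq kl in auto)
  also have "\<dots> = (\<Sum>p'<r. \<Sum>i<a. if p' = p then ?S i else 0)"
  proof (rule sum.cong[OF refl], rule sum.cong[OF refl])
    fix p' i assume p': "p' \<in> {..<r}"
    have "(\<Sum>j<a. ?T p' i q' j) = (if q' = q then if p' = p then ?S i else 0 else 0)" if "q' < r" for q'
      using pq p' that by (auto simp: id_map_def unit_op_index)
    then show "(\<Sum>q'<r. \<Sum>j<a. ?T p' i q' j) = (if p' = p then ?S i else 0)"
      using pq by simp
  qed
  also have "\<dots> = (\<Sum>i<a. \<Sum>p'<r. if p' = p then ?S i else 0)" by (rule sum.swap)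
  also have "\<dots> = (\<Sum>i<a. ?S i)" using pq by simp
  finally show ?thesis .
qed

lemma mtrace_id_tensor:
  assumes N: "tp_map a b N" and X: "X \<in> carrier_mat (r * a) (r * a)"
  shows "mtrace (id_tensor r a b N X) = mtrace X"
proof -
  have Nl: "N \<in> lmaps a b" using N by (simp add: tp_map_def)
  have u: "(\<Sum>k<b. N (unit_op a i j) $$ (k, k)) = (if i = j then 1 else 0)" if "i < a" "j < a" for i j
  proof -
    have "(\<Sum>k<b. N (unit_op a i j) $$ (k, k)) = mtrace (N (unit_op a i j))"
      by (simp add: mtrace_def carrier_matD(1)[OF lmaps_carrier[OF Nl unit_op_carrier]])
    also have "\<dots> = mtrace (unit_op a i j)" using N unit_op_carrier unfolding tp_map_def by blast
    also have "\<dots> = (\<Sum>k<a. if k = i \<and> k = j then 1 else 0)"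
      by (simp add: mtrace_def unit_op_def)
    also have "\<dots> = (\<Sum>k<a. if k = i then (if i = j then 1 else 0) else 0)"
      by (intro sum.cong) auto
    also have "\<dots> = (if i = j then 1 else 0)" using that by simp
    finally show ?thesis .
  qed
  have "mtrace (id_tensor r a b N X) = (\<Sum>x<r * b. id_tensor r a b N X $$ (x, x))"
    using lmaps_carrier[OF id_tensor_lmaps X, of b N] by (simp add: mtrace_def)
  also have "\<dots> = (\<Sum>p<r. \<Sum>k<b. \<Sum>i<a. \<Sum>j<a. X $$ (p * a + i, p * a + j) * N (unit_op a i j) $$ (k, k))"
    unfolding sum_blocks by (intro sum.cong refl) (simp add: id_tensor_index[OF Nl X])
  also have "\<dots> = (\<Sum>p<r. \<Sum>i<a. \<Sum>j<a. X $$ (p * a + i, p * a + j) * (\<Sum>k<b. N (unit_op a i j) $$ (k, k)))"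
    by (simp only: sum_distrib_left) (rule sum.cong[OF refl sum3_rotate[symmetric]])
  also have "\<dots> = (\<Sum>p<r. \<Sum>i<a. \<Sum>j<a. X $$ (p * a + i, p * a + j) * (if i = j then 1 else 0))"
    using u by simp
  also have "\<dots> = (\<Sum>p<r. \<Sum>i<a. X $$ (p * a + i, p * a + i))"
    by (intro sum.cong refl) (rule sum_mult_delta, simp)
  also have "\<dots> = mtrace X" using X by (simp add: mtrace_def sum_blocks)
  finally show ?thesis .
qed

text \<open>Complete positivity with a reference of dimension 1.\<close>

lemma cp_map_positive:
  assumes N: "cp_map a b N" and X: "psd a X"
  shows "psd b (N X)"
proof -
  have Nl: "N \<in> lmaps a b" using N by (simp add: cp_map_def)
  have Xc: "X \<in> carrier_mat a a" using X by (simp add: psd_def)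
  have "id_tensor 1 a b N X = N X"
  proof (rule eq_matI)
    have c: "id_tensor 1 a b N X \<in> carrier_mat b b"
      using lmaps_carrier[OF id_tensor_lmaps[of 1 a b N], of X] Xc by simp
    then show "dim_row (id_tensor 1 a b N X) = dim_row (N X)" "dim_col (id_tensor 1 a b N X) = dim_col (N X)"
      using lmaps_carrier[OF Nl Xc] by auto
    fix i j assume "i < dim_row (N X)" "j < dim_col (N X)"
    then have "i < b" "j < b" using lmaps_carrier[OF Nl Xc] by auto
    then show "id_tensor 1 a b N X $$ (i, j) = N X $$ (i, j)"
      using id_tensor_index[OF Nl, of X 1 0 0 i j] Xc lmaps_expand[OF Nl Xc, of i j] by simp
  qed
  moreover have "psd (1 * b) (id_tensor 1 a b N X)" using N X unfolding cp_map_def by (metis mult_1)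
  ultimately show ?thesis by simp
qed

subsection \<open>Measure-and-prepare supermaps\<close>

text \<open>The form of the output at \<open>w\<close> is the sum over \<open>m\<close> of forms of
  the input at the image of \<open>w\<close> under the adjoint of \<open>1 \<otimes> V m\<close>,
  for every reference dimension.\<close>

lemma kraus_cp:
  fixes V :: "'i \<Rightarrow> nat \<Rightarrow> nat \<Rightarrow> complex"
  assumes N: "N \<in> lmaps a b"
    and V: "\<And>i j k l. i < a \<Longrightarrow> j < a \<Longrightarrow> k < b \<Longrightarrow> l < b \<Longrightarrow>
      N (unit_op a i j) $$ (k, l) = (\<Sum>m\<in>I. V m k i * cnj (V m l j))"
  shows "cp_map a b N"
  unfolding cp_map_def
proof (intro conjI allI impI N)
  fix r X assume X: "psd (r * a) X"
  then have Xc: "X \<in> carrier_mat (r * a) (r * a)" and Xp: "pos (r * a) (ent X)"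
    by (simp_all add: psd_iff_pos)
  have q: "qf (r * b) (ent (id_tensor r a b N X)) w
      = (\<Sum>m\<in>I. qf (r * a) (ent X) (\<lambda>s. \<Sum>l<b. cnj (V m l (s mod a)) * w ((s div a) * b + l)))" for w
  proof -
    let ?t = "\<lambda>m p q k l i j. cnj (w (p * b + k)) * V m k i * X $$ (p * a + i, q * a + j) *
        (cnj (V m l j) * w (q * b + l))"
    have "qf (r * b) (ent (id_tensor r a b N X)) w
        = (\<Sum>p<r. \<Sum>q<r. \<Sum>k<b. \<Sum>l<b. \<Sum>i<a. \<Sum>j<a. \<Sum>m\<in>I. ?t m p q k l i j)"
      unfolding qf_blocks
    proof (rule sum.cong[OF refl], rule sum.cong[OF refl], rule sum.cong[OF refl], rule sum.cong[OF refl])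
      fix p q k l assume *: "p \<in> {..<r}" "q \<in> {..<r}" "k \<in> {..<b}" "l \<in> {..<b}"
      have "id_tensor r a b N X $$ (p * b + k, q * b + l)
          = (\<Sum>i<a. \<Sum>j<a. X $$ (p * a + i, q * a + j) * (\<Sum>m\<in>I. V m k i * cnj (V m l j)))"
        using * by (simp add: id_tensor_index[OF N Xc] V)
      then show "cnj (w (p * b + k)) * id_tensor r a b N X $$ (p * b + k, q * b + l) * w (q * b + l)
          = (\<Sum>i<a. \<Sum>j<a. \<Sum>m\<in>I. ?t m p q k l i j)"
        by (simp add: sum_distrib_left sum_distrib_right mult_ac)
    qed
    also have "\<dots> = (\<Sum>p<r. \<Sum>q<r. \<Sum>i<a. \<Sum>j<a. \<Sum>k<b. \<Sum>l<b. \<Sum>m\<in>I. ?t m p q k l i j)"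
      by (rule sum.cong[OF refl], rule sum.cong[OF refl], rule sum_swap4)
    also have "\<dots> = (\<Sum>p<r. \<Sum>q<r. \<Sum>m\<in>I. \<Sum>i<a. \<Sum>j<a. \<Sum>k<b. \<Sum>l<b. ?t m p q k l i j)"
      by (rule sum.cong[OF refl], rule sum.cong[OF refl]) (subst sum3_rotate, rule sum3_rotate)
    also have "\<dots> = (\<Sum>m\<in>I. \<Sum>p<r. \<Sum>q<r. \<Sum>i<a. \<Sum>j<a. \<Sum>k<b. \<Sum>l<b. ?t m p q k l i j)"
      by (rule sum3_rotate)
    also have "\<dots> = (\<Sum>m\<in>I. qf (r * a) (ent X) (\<lambda>s. \<Sum>l<b. cnj (V m l (s mod a)) * w ((s div a) * b + l)))"
      unfolding qf_blocks
      by (intro sum.cong[OF refl]) (simp add: sum_distrib_left sum_distrib_right mult_ac)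
    finally show ?thesis .
  qed
  have "pos (r * b) (ent (id_tensor r a b N X))"
    unfolding pos_def q using Xp by (auto simp: pos_def intro!: sum_nonneg)
  then show "psd (r * b) (id_tensor r a b N X)"
    using lmaps_carrier[OF id_tensor_lmaps Xc] by (simp add: psd_iff_pos)
qed

text \<open>With \<open>R\<close> inverse to the coefficient matrix of \<open>\<psi>\<close>, this recovers a map from its action on
  \<open>\<psi> \<psi>\<^sup>*\<close>.\<close>

definition recov ::
  "nat \<Rightarrow> nat \<Rightarrow> (nat \<Rightarrow> nat \<Rightarrow> complex) \<Rightarrow> (nat \<Rightarrow> nat \<Rightarrow> complex) \<Rightarrow> nat \<Rightarrow> nat \<Rightarrow> nat \<Rightarrow> nat \<Rightarrow> complex" where
  "recov a b R \<tau> i j k l = (\<Sum>p<a. \<Sum>q<a. R i p * cnj (R j q) * \<tau> (p * b + k) (q * b + l))"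

definition rank_one :: "nat \<Rightarrow> (nat \<Rightarrow> complex) \<Rightarrow> complex mat" where
  "rank_one n \<psi> = mat n n (\<lambda>(i, j). \<psi> i * cnj (\<psi> j))"

lemma rank_one_carrier [simp]: "rank_one n \<psi> \<in> carrier_mat n n"
  by (simp add: rank_one_def)

lemma rank_one_index: "i < n \<Longrightarrow> j < n \<Longrightarrow> rank_one n \<psi> $$ (i, j) = \<psi> i * cnj (\<psi> j)"
  by (simp add: rank_one_def)

lemma psd_rank_one: "psd n (rank_one n \<psi>)"
proof -
  have "qf n (ent (rank_one n \<psi>)) x = cin n x \<psi> * cin n \<psi> x" for x
    unfolding qf_def cin_def rank_one_def
    by (simp add: sum_distrib_left sum_distrib_right mult_ac) (subst sum.swap, simp)
  also have "cin n x \<psi> * cin n \<psi> x = of_real ((cmod (cin n \<psi> x))\<^sup>2)" for x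
    unfolding complex_norm_square cin_cnj by (rule mult.commute)
  finally show ?thesis unfolding psd_iff_pos pos_def by (simp add: less_eq_complex_def)
qed

text \<open>Acting on the reference, \<open>R\<close> turns \<open>\<psi>\<close> into the
  unnormalized maximally entangled vector, whose output is the Choi operator of
  \<open>N\<close>.\<close>

lemma recov_id_tensor:
  assumes N: "N \<in> lmaps a b"
    and R: "\<And>i i'. i < a \<Longrightarrow> i' < a \<Longrightarrow> (\<Sum>p<a. R i p * \<psi> (p * a + i')) = (if i = i' then 1 else 0)"
    and ij: "i < a" "j < a" and kl: "k < b" "l < b"
  shows "recov a b R (ent (id_tensor a a b N (rank_one (a * a) \<psi>))) i j k l = N (unit_op a i j) $$ (k, l)"
proof -
  let ?n = "\<lambda>i' j'. N (unit_op a i' j') $$ (k, l)"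
  have "recov a b R (ent (id_tensor a a b N (rank_one (a * a) \<psi>))) i j k l
      = (\<Sum>p<a. \<Sum>q<a. \<Sum>i'<a. \<Sum>j'<a. R i p * \<psi> (p * a + i') * cnj (R j q * \<psi> (q * a + j')) * ?n i' j')"
    unfolding recov_def
  proof (rule sum.cong[OF refl], rule sum.cong[OF refl])
    fix p q assume "p \<in> {..<a}" "q \<in> {..<a}"
    then show "R i p * cnj (R j q) * id_tensor a a b N (rank_one (a * a) \<psi>) $$ (p * b + k, q * b + l)
        = (\<Sum>i'<a. \<Sum>j'<a. R i p * \<psi> (p * a + i') * cnj (R j q * \<psi> (q * a + j')) * ?n i' j')"
      using kl by (simp add: id_tensor_index[OF N rank_one_carrier] rank_one_index block_index)
        (simp add: sum_distrib_left mult_ac)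
  qed
  also have "\<dots> = (\<Sum>i'<a. \<Sum>j'<a. \<Sum>p<a. \<Sum>q<a. R i p * \<psi> (p * a + i') * cnj (R j q * \<psi> (q * a + j')) * ?n i' j')"
    by (rule sum_swap4)
  also have "\<dots> = (\<Sum>i'<a. \<Sum>j'<a. (\<Sum>p<a. R i p * \<psi> (p * a + i')) * cnj (\<Sum>q<a. R j q * \<psi> (q * a + j')) * ?n i' j')"
    by (simp only: cnj_sum sum_distrib_left sum_distrib_right)
      (rule sum.cong[OF refl], rule sum.cong[OF refl], rule sum.swap)
  also have "\<dots> = (\<Sum>i'<a. \<Sum>j'<a. if i = i' then if j = j' then ?n i' j' else 0 else 0)"
    by (rule sum.cong[OF refl], rule sum.cong[OF refl]) (use R ij in auto)
  also have "\<dots> = (\<Sum>i'<a. if i = i' then (\<Sum>j'<a. if j = j' then ?n i' j' else 0) else 0)"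
    by (rule sum.cong[OF refl]) auto
  also have "\<dots> = ?n i j" using ij by simp
  finally show ?thesis .
qed

text \<open>As in Choi's theorem, Kraus operators are eigenvectors of \<open>\<tau>\<close> scaled
  by the square roots of their eigenvalues, here with \<open>R\<close> applied on the
  reference.\<close>

lemma recov_kraus:
  assumes "pos (a * b) \<tau>"
  shows "\<exists>V. \<forall>i<a. \<forall>j<a. \<forall>k<b. \<forall>l<b.
    recov a b R \<tau> i j k l = (\<Sum>m<a * b. V m k i * cnj (V m l j :: complex))"
proof -
  obtain u d where s: "spec (a * b) \<tau> u d" using herm_spec[OF pos_herm[OF assms]] .
  define V where "V = (\<lambda>m k i. \<Sum>p<a. of_real (sqrt (d m)) * R i p * u m (p * b + k))"
  have "recov a b R \<tau> i j k l = (\<Sum>m<a * b. V m k i * cnj (V m l j))"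
    if "i < a" "j < a" "k < b" "l < b" for i j k l
  proof -
    let ?t = "\<lambda>m p q. of_real (d m) * (R i p * u m (p * b + k)) * cnj (R j q * u m (q * b + l))"
    have "recov a b R \<tau> i j k l = (\<Sum>p<a. \<Sum>q<a. \<Sum>m<a * b. ?t m p q)"
      unfolding recov_def
    proof (rule sum.cong[OF refl], rule sum.cong[OF refl])
      fix p q assume "p \<in> {..<a}" "q \<in> {..<a}"
      then have "\<tau> (p * b + k) (q * b + l) = (\<Sum>m<a * b. of_real (d m) * u m (p * b + k) * cnj (u m (q * b + l)))"
        using s that block_index[of p a k b] block_index[of q a l b] by (simp add: spec_def)
      then show "R i p * cnj (R j q) * \<tau> (p * b + k) (q * b + l) = (\<Sum>m<a * b. ?t m p q)"
        by (simp add: sum_distrib_left mult_ac)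
    qed
    also have "\<dots> = (\<Sum>m<a * b. \<Sum>p<a. \<Sum>q<a. ?t m p q)" by (rule sum3_rotate)
    also have "\<dots> = (\<Sum>m<a * b. V m k i * cnj (V m l j))"
    proof (rule sum.cong[OF refl])
      fix m assume "m \<in> {..<a * b}"
      then have "complex_of_real (d m) = of_real (sqrt (d m)) * of_real (sqrt (d m))"
        using spec_pos_nonneg[OF s assms, of m] by (simp flip: of_real_mult)
      then show "(\<Sum>p<a. \<Sum>q<a. ?t m p q) = V m k i * cnj (V m l j)"
        unfolding V_def sum_product cnj_sum by (intro sum.cong[OF refl]) (simp add: mult_ac)
    qed
    finally show ?thesis .
  qed
  then show ?thesis by blast
qed

lemma cp_kraus:
  assumes N: "cp_map a b N"
  shows "\<exists>V. \<forall>i<a. \<forall>j<a. \<forall>k<b. \<forall>l<b.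
    N (unit_op a i j) $$ (k, l) = (\<Sum>m<a * b. V m k i * cnj (V m l j :: complex))"
proof -
  \<comment> \<open>The unnormalized maximally entangled vector; its coefficient matrix is the
    identity, and so is the matching \<open>R\<close>.\<close>
  define \<psi> where "\<psi> = (\<lambda>s. if s div a = s mod a then 1 else 0 :: complex)"
  have Nl: "N \<in> lmaps a b" using N by (simp add: cp_map_def)
  have R: "(\<Sum>p<a. (if i = p then 1 else 0) * \<psi> (p * a + i')) = (if i = i' then 1 else 0)"
    if "i < a" "i' < a" for i i'
    using sum_mult_delta(1)[OF that(1), of "\<lambda>p. \<psi> (p * a + i')"] that by (simp add: \<psi>_def mult.commute)
  have "psd (a * b) (id_tensor a a b N (rank_one (a * a) \<psi>))"
    using N psd_rank_one unfolding cp_map_def by blast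
  then have p: "pos (a * b) (ent (id_tensor a a b N (rank_one (a * a) \<psi>)))" by (simp add: psd_iff_pos)
  have eq: "N (unit_op a i j) $$ (k, l) = recov a b (\<lambda>i p. if i = p then 1 else 0)
      (ent (id_tensor a a b N (rank_one (a * a) \<psi>))) i j k l"
    if "i < a" "j < a" "k < b" "l < b" for i j k l
    by (rule recov_id_tensor[OF Nl R that, symmetric])
  show ?thesis
    using recov_kraus[OF p, of "\<lambda>i p. if i = p then 1 else 0"] by (simp add: eq)
qed

section \<open>Maps given on matrix units, and functionals of Choi operators\<close>

definition lin :: "nat \<Rightarrow> nat \<Rightarrow> (nat \<Rightarrow> nat \<Rightarrow> nat \<Rightarrow> nat \<Rightarrow> complex) \<Rightarrow> complex mat \<Rightarrow> complex mat" where
  "lin a b h = (\<lambda>X\<in>carrier_mat a a. mat b b (\<lambda>(k, l). \<Sum>i<a. \<Sum>j<a. X $$ (i, j) * h i j k l))"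

lemma lin_lmaps: "lin a b h \<in> lmaps a b"
  unfolding lmaps_def lin_def
  by (auto intro!: eq_matI simp: distrib_right mult.assoc sum.distrib sum_distrib_left cong: sum.cong_simp)

lemma lin_unit:
  assumes "i < a" "j < a" "k < b" "l < b"
  shows "lin a b h (unit_op a i j) $$ (k, l) = h i j k l"
proof -
  have "lin a b h (unit_op a i j) $$ (k, l)
      = (\<Sum>i'<a. \<Sum>j'<a. (if i' = i \<and> j' = j then 1 else 0) * h i' j' k l)"
    using assms unfolding lin_def by (simp add: unit_op_index)
  also have "\<dots> = (\<Sum>i'<a. \<Sum>j'<a. if i' = i then if j' = j then h i j k l else 0 else 0)"
    by (rule sum.cong[OF refl], rule sum.cong[OF refl]) auto
  also have "\<dots> = (\<Sum>i'<a. if i' = i then (\<Sum>j'<a. if j' = j then h i j k l else 0) else 0)"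
    by (rule sum.cong[OF refl]) auto
  also have "\<dots> = h i j k l" using assms by simp
  finally show ?thesis .
qed

lemma lin_supermap:
  assumes add: "\<And>i j k l N M. i < a \<Longrightarrow> j < a \<Longrightarrow> k < b \<Longrightarrow> l < b \<Longrightarrow> N \<in> lmaps c d \<Longrightarrow> M \<in> lmaps c d \<Longrightarrow>
      h (\<lambda>X\<in>carrier_mat c c. N X + M X) i j k l = h N i j k l + h M i j k l"
    and scale: "\<And>i j k l z N. i < a \<Longrightarrow> j < a \<Longrightarrow> k < b \<Longrightarrow> l < b \<Longrightarrow> N \<in> lmaps c d \<Longrightarrow>
      h (\<lambda>X\<in>carrier_mat c c. z \<cdot>\<^sub>m N X) i j k l = z * h N i j k l"
  shows "(\<lambda>K. lin a b (h K)) \<in> supermaps c d a b"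
  unfolding supermaps_def
proof (intro CollectI conjI ballI allI)
  show "(\<lambda>K. lin a b (h K)) \<in> lmaps c d \<rightarrow> lmaps a b" by (simp add: lin_lmaps)
next
  fix N M assume "N \<in> lmaps c d" "M \<in> lmaps c d"
  then show "lin a b (h (\<lambda>X\<in>carrier_mat c c. N X + M X)) = (\<lambda>Y\<in>carrier_mat a a. lin a b (h N) Y + lin a b (h M) Y)"
    unfolding lin_def by (intro restrict_ext eq_matI) (auto simp: add distrib_left sum.distrib)
next
  fix z N assume "N \<in> lmaps c d"
  then show "lin a b (h (\<lambda>X\<in>carrier_mat c c. z \<cdot>\<^sub>m N X)) = (\<lambda>Y\<in>carrier_mat a a. z \<cdot>\<^sub>m lin a b (h N) Y)"
    unfolding lin_def by (intro restrict_ext eq_matI) (auto simp: scale sum_distrib_left mult_ac)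
qed

text \<open>When \<open>\<kappa> i j k l\<close> is the entry \<open>(k, l)\<close> of
  \<open>K (unit_op c i j)\<close>, this is the quadratic form of the Choi operator of
  \<open>K\<close> at the vector \<open>\<zeta>\<close>.\<close>

definition contr ::
  "nat \<Rightarrow> nat \<Rightarrow> (nat \<Rightarrow> nat \<Rightarrow> complex) \<Rightarrow> (nat \<Rightarrow> nat \<Rightarrow> nat \<Rightarrow> nat \<Rightarrow> complex) \<Rightarrow> complex" where
  "contr c d \<zeta> \<kappa> = (\<Sum>i<c. \<Sum>j<c. \<Sum>k<d. \<Sum>l<d. cnj (\<zeta> i k) * \<zeta> j l * \<kappa> i j k l)"

lemma contr_cong:
  "(\<And>i j k l. i < c \<Longrightarrow> j < c \<Longrightarrow> k < d \<Longrightarrow> l < d \<Longrightarrow> \<kappa> i j k l = \<kappa>' i j k l) \<Longrightarrow> contr c d \<zeta> \<kappa> = contr c d \<zeta> \<kappa>'"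
  unfolding contr_def by (intro sum.cong[OF refl]) auto

lemma contr_add: "contr c d \<zeta> (\<lambda>i j k l. \<kappa> i j k l + \<kappa>' i j k l) = contr c d \<zeta> \<kappa> + contr c d \<zeta> \<kappa>'"
  unfolding contr_def by (simp add: distrib_left sum.distrib)

lemma contr_scale: "contr c d \<zeta> (\<lambda>i j k l. z * \<kappa> i j k l) = z * contr c d \<zeta> \<kappa>"
  unfolding contr_def sum_distrib_left by (simp add: mult_ac)

lemma contr_sum: "contr c d \<zeta> (\<lambda>i j k l. \<Sum>m\<in>I. \<kappa> m i j k l) = (\<Sum>m\<in>I. contr c d \<zeta> (\<kappa> m))"
proof -
  have "contr c d \<zeta> (\<lambda>i j k l. \<Sum>m\<in>I. \<kappa> m i j k l)
      = (\<Sum>i<c. \<Sum>j<c. \<Sum>k<d. \<Sum>l<d. \<Sum>m\<in>I. cnj (\<zeta> i k) * \<zeta> j l * \<kappa> m i j k l)"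
    unfolding contr_def sum_distrib_left ..
  also have "\<dots> = (\<Sum>m\<in>I. contr c d \<zeta> (\<kappa> m))"
    unfolding contr_def by (subst sum3_rotate) (rule sum3_rotate)
  finally show ?thesis .
qed

text \<open>A Kraus term contracts to a number times a conjugate number; hence the Kraus form
  survives when only part of the indices is contracted.\<close>

lemma contr_product:
  "contr c d \<zeta> (\<lambda>i j k l. x k i * cnj (y l j))
    = (\<Sum>i<c. \<Sum>k<d. cnj (\<zeta> i k) * x k i) * cnj (\<Sum>i<c. \<Sum>k<d. cnj (\<zeta> i k) * y k i)"
proof -
  have "(\<Sum>i<c. \<Sum>k<d. cnj (\<zeta> i k) * x k i) * cnj (\<Sum>i<c. \<Sum>k<d. cnj (\<zeta> i k) * y k i)
      = (\<Sum>i<c. \<Sum>j<c. (\<Sum>k<d. cnj (\<zeta> i k) * x k i) * (\<Sum>l<d. \<zeta> j l * cnj (y l j)))"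
    by (simp add: sum_product)
  also have "\<dots> = contr c d \<zeta> (\<lambda>i j k l. x k i * cnj (y l j))"
    unfolding contr_def sum_product by (simp add: mult_ac)
  finally show ?thesis by simp
qed

text \<open>Moving the amplitudes of \<open>\<phi>\<close> into the test vector turns a form of the
  output state into a form of the Choi operator of \<open>K\<close>.\<close>

lemma qf_id_tensor_contr:
  assumes K: "K \<in> lmaps c d"
  shows "qf (c * d) (ent (id_tensor c c d K (rank_one (c * c) \<phi>))) v
    = contr c d (\<lambda>i k. \<Sum>p<c. v (p * d + k) * cnj (\<phi> (p * c + i))) (\<lambda>i j k l. K (unit_op c i j) $$ (k, l))"
proof -
  let ?t = "\<lambda>p q k l i j. cnj (v (p * d + k)) * \<phi> (p * c + i) * (v (q * d + l) * cnj (\<phi> (q * c + j))) *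
      K (unit_op c i j) $$ (k, l)"
  have "qf (c * d) (ent (id_tensor c c d K (rank_one (c * c) \<phi>))) v
      = (\<Sum>p<c. \<Sum>q<c. \<Sum>k<d. \<Sum>l<d. \<Sum>i<c. \<Sum>j<c. ?t p q k l i j)"
    unfolding qf_blocks
  proof (rule sum.cong[OF refl], rule sum.cong[OF refl], rule sum.cong[OF refl], rule sum.cong[OF refl])
    fix p q k l assume "p \<in> {..<c}" "q \<in> {..<c}" "k \<in> {..<d}" "l \<in> {..<d}"
    then show "cnj (v (p * d + k)) * id_tensor c c d K (rank_one (c * c) \<phi>) $$ (p * d + k, q * d + l) * v (q * d + l)
        = (\<Sum>i<c. \<Sum>j<c. ?t p q k l i j)"
      by (simp add: id_tensor_index[OF K rank_one_carrier] rank_one_index block_index)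
        (simp add: sum_distrib_left sum_distrib_right mult_ac)
  qed
  also have "\<dots> = (\<Sum>k<d. \<Sum>l<d. \<Sum>p<c. \<Sum>q<c. \<Sum>i<c. \<Sum>j<c. ?t p q k l i j)" by (rule sum_swap4)
  also have "\<dots> = (\<Sum>k<d. \<Sum>l<d. \<Sum>i<c. \<Sum>j<c. \<Sum>p<c. \<Sum>q<c. ?t p q k l i j)"
    by (rule sum.cong[OF refl], rule sum.cong[OF refl], rule sum_swap4)
  also have "\<dots> = (\<Sum>i<c. \<Sum>j<c. \<Sum>k<d. \<Sum>l<d. \<Sum>p<c. \<Sum>q<c. ?t p q k l i j)" by (rule sum_swap4)
  also have "\<dots> = contr c d (\<lambda>i k. \<Sum>p<c. v (p * d + k) * cnj (\<phi> (p * c + i))) (\<lambda>i j k l. K (unit_op c i j) $$ (k, l))"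
    unfolding contr_def
    by (simp only: cnj_sum complex_cnj_mult complex_cnj_cnj sum_product) (simp only: sum_distrib_right)
  finally show ?thesis .
qed

text \<open>Kraus operators of \<open>id \<otimes> \<Theta>\<close> applied to \<open>\<Lambda>\<close> are products of Kraus operators of \<open>\<Lambda>\<close>, contracted with \<open>\<zeta> x\<close>,
  and of the map prepared from \<open>\<tau> x\<close>.\<close>

lemma measure_prepare_completely_cp:
  fixes X :: "'x set"
  assumes \<tau>: "\<And>x. x \<in> X \<Longrightarrow> pos (a * b) (\<tau> x)"
  shows "completely_cp_preserving c d a b (\<lambda>K. lin a b (\<lambda>i j k l. \<Sum>x\<in>X.
    contr c d (\<zeta> x) (\<lambda>i j k l. K (unit_op c i j) $$ (k, l)) * recov a b R (\<tau> x) i j k l))"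
    (is "completely_cp_preserving c d a b ?\<Theta>")
  unfolding completely_cp_preserving_def
proof (intro conjI allI)
  show "?\<Theta> \<in> supermaps c d a b"
  proof (rule lin_supermap)
    fix i j k l N M assume N: "N \<in> lmaps c d" and M: "M \<in> lmaps c d"
    have "contr c d (\<zeta> x) (\<lambda>i j k l. (\<lambda>X\<in>carrier_mat c c. N X + M X) (unit_op c i j) $$ (k, l))
        = contr c d (\<zeta> x) (\<lambda>i j k l. N (unit_op c i j) $$ (k, l)) + contr c d (\<zeta> x) (\<lambda>i j k l. M (unit_op c i j) $$ (k, l))" for x
      unfolding contr_add[symmetric]
      by (rule contr_cong) (simp add: carrier_matD[OF lmaps_carrier[OF M unit_op_carrier]])
    then show "(\<Sum>x\<in>X. contr c d (\<zeta> x) (\<lambda>i j k l. (\<lambda>X\<in>carrier_mat c c. N X + M X) (unit_op c i j) $$ (k, l)) * recov a b R (\<tau> x) i j k l)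
      = (\<Sum>x\<in>X. contr c d (\<zeta> x) (\<lambda>i j k l. N (unit_op c i j) $$ (k, l)) * recov a b R (\<tau> x) i j k l)
      + (\<Sum>x\<in>X. contr c d (\<zeta> x) (\<lambda>i j k l. M (unit_op c i j) $$ (k, l)) * recov a b R (\<tau> x) i j k l)"
      by (simp only: distrib_right sum.distrib)
  next
    fix i j k l z N assume N: "N \<in> lmaps c d"
    have "contr c d (\<zeta> x) (\<lambda>i j k l. (\<lambda>X\<in>carrier_mat c c. z \<cdot>\<^sub>m N X) (unit_op c i j) $$ (k, l))
        = z * contr c d (\<zeta> x) (\<lambda>i j k l. N (unit_op c i j) $$ (k, l))" for x
      unfolding contr_scale[symmetric]
      by (rule contr_cong) (simp add: carrier_matD[OF lmaps_carrier[OF N unit_op_carrier]])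
    then show "(\<Sum>x\<in>X. contr c d (\<zeta> x) (\<lambda>i j k l. (\<lambda>X\<in>carrier_mat c c. z \<cdot>\<^sub>m N X) (unit_op c i j) $$ (k, l)) * recov a b R (\<tau> x) i j k l)
      = z * (\<Sum>x\<in>X. contr c d (\<zeta> x) (\<lambda>i j k l. N (unit_op c i j) $$ (k, l)) * recov a b R (\<tau> x) i j k l)"
      by (simp only: sum_distrib_left mult.assoc)
  qed
next
  fix e e' :: nat
  \<comment> \<open>\<open>g\<close> contracts the indices of \<open>c\<close> and \<open>d\<close>
    only and keeps those of \<open>e\<close> and \<open>e'\<close>; \<open>h\<close> attaches the
    prepared map by splitting composite indices. \<open>\<Xi>\<close> is the resulting candidate for
    the identity tensored with the supermap.\<close>
  define g where "g = (\<lambda>(\<Lambda> :: complex mat \<Rightarrow> complex mat) x p q s t. contr c d (\<zeta> x)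
    (\<lambda>i j k l. \<Lambda> (unit_op (e * c) (p * c + i) (q * c + j)) $$ (s * d + k, t * d + l)))"
  define h where "h = (\<lambda>\<Lambda> P Q S T. \<Sum>x\<in>X. g \<Lambda> x (P div a) (Q div a) (S div b) (T div b) *
    recov a b R (\<tau> x) (P mod a) (Q mod a) (S mod b) (T mod b))"
  define \<Xi> where "\<Xi> = (\<lambda>\<Lambda>. lin (e * a) (e' * b) (h \<Lambda>))"
  have sup: "\<Xi> \<in> supermaps (e * c) (e' * d) (e * a) (e' * b)"
    unfolding \<Xi>_def
  proof (rule lin_supermap)
    fix P Q S T N M assume *: "S < e' * b" "T < e' * b"
      and N: "N \<in> lmaps (e * c) (e' * d)" and M: "M \<in> lmaps (e * c) (e' * d)"
    have st: "S div b < e'" "T div b < e'" using * by (auto simp: less_mult_imp_div_less)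
    have "g (\<lambda>X\<in>carrier_mat (e * c) (e * c). N X + M X) x p q (S div b) (T div b)
        = g N x p q (S div b) (T div b) + g M x p q (S div b) (T div b)" for x p q
      unfolding g_def contr_add[symmetric]
      by (rule contr_cong) (use st in \<open>simp add: block_index carrier_matD[OF lmaps_carrier[OF M unit_op_carrier]]\<close>)
    then show "h (\<lambda>X\<in>carrier_mat (e * c) (e * c). N X + M X) P Q S T = h N P Q S T + h M P Q S T"
      unfolding h_def by (simp only: distrib_right sum.distrib)
  next
    fix P Q S T z N assume *: "S < e' * b" "T < e' * b" and N: "N \<in> lmaps (e * c) (e' * d)"
    have st: "S div b < e'" "T div b < e'" using * by (auto simp: less_mult_imp_div_less)
    have "g (\<lambda>X\<in>carrier_mat (e * c) (e * c). z \<cdot>\<^sub>m N X) x p q (S div b) (T div b)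
        = z * g N x p q (S div b) (T div b)" for x p q
      unfolding g_def contr_scale[symmetric]
      by (rule contr_cong) (use st in \<open>simp add: block_index carrier_matD[OF lmaps_carrier[OF N unit_op_carrier]]\<close>)
    then show "h (\<lambda>X\<in>carrier_mat (e * c) (e * c). z \<cdot>\<^sub>m N X) P Q S T = z * h N P Q S T"
      unfolding h_def by (simp only: sum_distrib_left mult.assoc)
  qed
  have tensor: "\<Xi> (tensor_map e e' c d F N) = tensor_map e e' a b F (?\<Theta> N)"
    if F: "F \<in> lmaps e e'" and N: "N \<in> lmaps c d" for F N
  proof (rule lmaps_eqI[OF _ tensor_map_lmaps])
    show "\<Xi> (tensor_map e e' c d F N) \<in> lmaps (e * a) (e' * b)" unfolding \<Xi>_def by (rule lin_lmaps)
    fix P Q S T assume PQST: "P < e * a" "Q < e * a" "S < e' * b" "T < e' * b"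
    obtain p i where P: "p < e" "i < a" "P = p * a + i" using PQST(1) by (rule block_cases)
    obtain q j where Q: "q < e" "j < a" "Q = q * a + j" using PQST(2) by (rule block_cases)
    obtain s k where S: "s < e'" "k < b" "S = s * b + k" using PQST(3) by (rule block_cases)
    obtain t l where T: "t < e'" "l < b" "T = t * b + l" using PQST(4) by (rule block_cases)
    have g: "g (tensor_map e e' c d F N) x p q s t
        = F (unit_op e p q) $$ (s, t) * contr c d (\<zeta> x) (\<lambda>i j k l. N (unit_op c i j) $$ (k, l))" for x
      unfolding g_def contr_scale[symmetric]
      by (rule contr_cong) (rule tensor_map_unit[OF F N P(1) Q(1) _ _ S(1) T(1)])
    have "\<Xi> (tensor_map e e' c d F N) (unit_op (e * a) P Q) $$ (S, T) = h (tensor_map e e' c d F N) P Q S T"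
      unfolding \<Xi>_def by (rule lin_unit[OF PQST])
    also have "\<dots> = F (unit_op e p q) $$ (s, t) * (\<Sum>x\<in>X. contr c d (\<zeta> x) (\<lambda>i j k l. N (unit_op c i j) $$ (k, l)) * recov a b R (\<tau> x) i j k l)"
      unfolding h_def using P Q S T by (simp add: g sum_distrib_left mult.assoc)
    also have "\<dots> = tensor_map e e' a b F (?\<Theta> N) (unit_op (e * a) P Q) $$ (S, T)"
      unfolding P(3) Q(3) S(3) T(3) tensor_map_unit[OF F lin_lmaps P(1) Q(1) P(2) Q(2) S(1) T(1) S(2) T(2)]
        lin_unit[OF P(2) Q(2) S(2) T(2)] ..
    finally show "\<Xi> (tensor_map e e' c d F N) (unit_op (e * a) P Q) $$ (S, T)
      = tensor_map e e' a b F (?\<Theta> N) (unit_op (e * a) P Q) $$ (S, T)" .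
  qed
  have cp: "cp_map (e * a) (e' * b) (\<Xi> \<Lambda>)" if \<Lambda>: "cp_map (e * c) (e' * d) \<Lambda>" for \<Lambda>
  proof -
    obtain W where W: "\<forall>i<e * c. \<forall>j<e * c. \<forall>k<e' * d. \<forall>l<e' * d.
      \<Lambda> (unit_op (e * c) i j) $$ (k, l) = (\<Sum>m<e * c * (e' * d). W m k i * cnj (W m l j))"
      using cp_kraus[OF \<Lambda>] by blast
    have "\<forall>x\<in>X. \<exists>V. \<forall>i<a. \<forall>j<a. \<forall>k<b. \<forall>l<b.
      recov a b R (\<tau> x) i j k l = (\<Sum>m<a * b. V m k i * cnj (V m l j))"
      using recov_kraus[OF \<tau>] by blast
    from bchoice[OF this] obtain V where V: "\<forall>x\<in>X. \<forall>i<a. \<forall>j<a. \<forall>k<b. \<forall>l<b.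
      recov a b R (\<tau> x) i j k l = (\<Sum>m<a * b. V x m k i * cnj (V x m l j))"
      by blast
    define w where "w = (\<lambda>x m s p. \<Sum>i<c. \<Sum>k<d. cnj (\<zeta> x i k) * W m (s * d + k) (p * c + i))"
    have g: "g \<Lambda> x p q s t = (\<Sum>m<e * c * (e' * d). w x m s p * cnj (w x m t q))"
      if "p < e" "q < e" "s < e'" "t < e'" for x p q s t
    proof -
      have "g \<Lambda> x p q s t = contr c d (\<zeta> x) (\<lambda>i j k l. \<Sum>m<e * c * (e' * d).
          W m (s * d + k) (p * c + i) * cnj (W m (t * d + l) (q * c + j)))"
        unfolding g_def by (rule contr_cong) (use that W in \<open>simp add: block_index\<close>)
      also have "\<dots> = (\<Sum>m<e * c * (e' * d). w x m s p * cnj (w x m t q))"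
        unfolding contr_sum w_def by (rule sum.cong[OF refl]) (rule contr_product)
      finally show ?thesis .
    qed
    show ?thesis
      unfolding \<Xi>_def
    proof (rule kraus_cp[OF lin_lmaps])
      fix P Q S T assume PQST: "P < e * a" "Q < e * a" "S < e' * b" "T < e' * b"
      obtain p i where P: "p < e" "i < a" "P = p * a + i" using PQST(1) by (rule block_cases)
      obtain q j where Q: "q < e" "j < a" "Q = q * a + j" using PQST(2) by (rule block_cases)
      obtain s k where S: "s < e'" "k < b" "S = s * b + k" using PQST(3) by (rule block_cases)
      obtain t l where T: "t < e'" "l < b" "T = t * b + l" using PQST(4) by (rule block_cases)
      let ?U = "\<lambda>(x, m, n) S P. w x m (S div b) (P div a) * V x n (S mod b) (P mod a)"
      have "lin (e * a) (e' * b) (h \<Lambda>) (unit_op (e * a) P Q) $$ (S, T) = h \<Lambda> P Q S T"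
        by (rule lin_unit[OF PQST])
      also have "\<dots> = (\<Sum>x\<in>X. (\<Sum>m<e * c * (e' * d). w x m s p * cnj (w x m t q)) * (\<Sum>n<a * b. V x n k i * cnj (V x n l j)))"
        unfolding h_def using P Q S T V by (simp add: g)
      also have "\<dots> = (\<Sum>x\<in>X. \<Sum>m<e * c * (e' * d). \<Sum>n<a * b. ?U (x, m, n) S P * cnj (?U (x, m, n) T Q))"
        unfolding sum_product using P Q S T by (simp add: mult_ac)
      also have "\<dots> = (\<Sum>y\<in>X \<times> {..<e * c * (e' * d)} \<times> {..<a * b}. ?U y S P * cnj (?U y T Q))"
        by (simp only: sum.cartesian_product) (simp add: case_prod_beta)
      finally show "lin (e * a) (e' * b) (h \<Lambda>) (unit_op (e * a) P Q) $$ (S, T)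
        = (\<Sum>y\<in>X \<times> {..<e * c * (e' * d)} \<times> {..<a * b}. ?U y S P * cnj (?U y T Q))" .
    qed
  qed
  show "\<exists>\<Xi>. is_id_tensor_super e e' c d a b ?\<Theta> \<Xi> \<and> cp_preserving (e * c) (e' * d) (e * a) (e' * b) \<Xi>"
    using sup tensor cp unfolding is_id_tensor_super_def cp_preserving_def by blast
qed

subsection \<open>Equality in the data processing inequality\<close>

lemma tp_cong:
  assumes "\<And>i j. i < n \<Longrightarrow> j < n \<Longrightarrow> A i j = B i j"
  shows "tp n A = tp n B"
proof -
  have "ip n P A = ip n P B" for P
    unfolding ip_def using assms by (auto intro!: arg_cong[where f = Re] sum.cong)
  then show ?thesis unfolding tp_def by simp
qed

lemma pos_cong:
  assumes "\<And>i j. i < n \<Longrightarrow> j < n \<Longrightarrow> A i j = B i j"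
  shows "pos n A \<longleftrightarrow> pos n B"
  unfolding pos_def using qf_cong[OF assms] by simp

lemma mtrace_ent: "A \<in> carrier_mat n n \<Longrightarrow> mtrace A = (\<Sum>i<n. A $$ (i, i))"
  by (simp add: mtrace_def)

lemma pos_antisym:
  assumes "pos n A" "pos n (\<lambda>i j. - A i j)" "i < n" "j < n"
  shows "A i j = 0"
proof -
  have "qf n A (\<lambda>l. if l = j then 1 else 0) = 0"
    using assms(1,2) unfolding pos_def qf_uminus by (metis antisym neg_0_le_iff_le)
  then have "(\<Sum>l<n. A i l * (if l = j then 1 else 0)) = 0"
    by (rule pos_qf_zero[OF assms(1) _ assms(3)])
  then show ?thesis using sum_mult_delta(2)[OF assms(4), of "A i"] by simp
qed

text \<open>In the decomposition of \<open>X\<close> into \<open>Q\<close> minus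
  \<open>Q - X\<close> both parts stay positive under \<open>T\<close>. Dropping the second can only
  increase the pairing with an effect, and \<open>T\<close> preserves the trace of the
  first.\<close>

lemma channel_tp_mono:
  assumes T: "channel n n' T" and X: "X \<in> carrier_mat n n" and h: "herm n (ent X)"
  shows "tp n' (ent (T X)) \<le> tp n (ent X)"
proof -
  have cp: "cp_map n n' T" and tp: "tp_map n n' T" using T by (simp_all add: channel_def)
  then have Tl: "T \<in> lmaps n n'" by (simp add: cp_map_def)
  obtain Q where Q: "pos n Q" "pos n (\<lambda>i j. Q i j - X $$ (i, j))" "Re (\<Sum>i<n. Q i i) = tp n (ent X)"
    using positive_part[OF h] .
  define Y where "Y = mat n n (\<lambda>(i, j). Q i j)"
  define Z where "Z = mat n n (\<lambda>(i, j). Q i j - X $$ (i, j))"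
  have car: "Y \<in> carrier_mat n n" "Z \<in> carrier_mat n n" by (simp_all add: Y_def Z_def)
  have "psd n Y" "psd n Z"
    unfolding psd_iff_pos using car Q(1,2)
      pos_cong[of n "ent Y" Q] pos_cong[of n "ent Z" "\<lambda>i j. Q i j - X $$ (i, j)"]
    by (simp_all add: Y_def Z_def)
  then have TY: "pos n' (ent (T Y))" and TZ: "pos n' (ent (T Z))"
    using cp_map_positive[OF cp] by (simp_all add: psd_iff_pos)
  note cT = lmaps_carrier[OF Tl car(1)] lmaps_carrier[OF Tl car(2)] lmaps_carrier[OF Tl X]
  have "Y = X + Z" using X by (intro eq_matI) (auto simp: Y_def Z_def)
  then have "T Y = T X + T Z" using Tl X car unfolding lmaps_def by blast
  then have eq: "T X $$ (i, j) = T Y $$ (i, j) - T Z $$ (i, j)" if "i < n'" "j < n'" for i j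
    using that cT by simp
  obtain P where P: "eff n' P" "ip n' P (\<lambda>i j. T Y $$ (i, j) - T Z $$ (i, j)) = tp n' (\<lambda>i j. T Y $$ (i, j) - T Z $$ (i, j))"
    using tp_attained[OF herm_diff[OF pos_herm[OF TY] pos_herm[OF TZ]]] .
  have "tp n' (ent (T X)) = ip n' P (\<lambda>i j. T Y $$ (i, j) - T Z $$ (i, j))"
    unfolding P(2) by (rule tp_cong) (rule eq)
  also have "\<dots> \<le> ip n' P (ent (T Y))"
    unfolding ip_diff using ip_eff_nonneg[OF P(1) TZ] by simp
  also have "\<dots> \<le> Re (mtrace (T Y))"
    unfolding mtrace_ent[OF cT(1)] by (rule ip_eff_le[OF P(1) TY])
  also have "mtrace (T Y) = mtrace Y" using tp car(1) unfolding tp_map_def by blast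
  also have "Re (mtrace Y) = tp n (ent X)"
    unfolding mtrace_ent[OF car(1)] Q(3)[symmetric] by (simp add: Y_def)
  finally show ?thesis .
qed

lemma order_interval_of_entropy_eq:
  assumes T: "channel n n' T" and \<rho>: "psd n \<rho>" and \<sigma>: "psd n \<sigma>"
    and tr: "mtrace \<rho> = 1" "mtrace \<sigma> = 1"
    and fin: "rel_entropy n \<rho> \<sigma> < \<infinity>" and eq: "rel_entropy n' (T \<rho>) (T \<sigma>) = rel_entropy n \<rho> \<sigma>"
  obtains m M v w where "m \<le> M"
    "pos n (\<lambda>i j. of_real M * \<sigma> $$ (i, j) - \<rho> $$ (i, j))" "pos n (\<lambda>i j. \<rho> $$ (i, j) - of_real m * \<sigma> $$ (i, j))"
    "Re (qf n' (ent (T \<sigma>)) v) = 1" "Re (qf n' (ent (T \<rho>)) v) = M"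
    "Re (qf n' (ent (T \<sigma>)) w) = 1" "Re (qf n' (ent (T \<rho>)) w) = m"
proof -
  have cp: "cp_map n n' T" and tpm: "tp_map n n' T" using T by (simp_all add: channel_def)
  then have Tl: "T \<in> lmaps n n'" by (simp add: cp_map_def)
  have c: "\<rho> \<in> carrier_mat n n" "\<sigma> \<in> carrier_mat n n" and p: "pos n (ent \<rho>)" "pos n (ent \<sigma>)"
    using \<rho> \<sigma> by (simp_all add: psd_iff_pos)
  have c': "T \<rho> \<in> carrier_mat n' n'" "T \<sigma> \<in> carrier_mat n' n'" and p': "pos n' (ent (T \<rho>))" "pos n' (ent (T \<sigma>))"
    using cp_map_positive[OF cp \<rho>] cp_map_positive[OF cp \<sigma>] by (simp_all add: psd_iff_pos)
  have tr': "mtrace (T \<rho>) = 1" "mtrace (T \<sigma>) = 1" using tpm tr c unfolding tp_map_def by simp_all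
  obtain w l where w: "spec n (ent \<rho>) w l" using herm_spec[OF pos_herm[OF p(1)]] .
  obtain u d where u: "spec n (ent \<sigma>) u d" using herm_spec[OF pos_herm[OF p(2)]] .
  obtain w' l' where w': "spec n' (ent (T \<rho>)) w' l'" using herm_spec[OF pos_herm[OF p'(1)]] .
  obtain u' d' where u': "spec n' (ent (T \<sigma>)) u' d'" using herm_spec[OF pos_herm[OF p'(2)]] .
  have fin': "rel_entropy n' (T \<rho>) (T \<sigma>) < \<infinity>" using fin eq by simp
  note ent = rel_entropy_finite[OF c w u fin] and ent' = rel_entropy_finite[OF c' w' u' fin']
  obtain s\<^sub>0 where s0: "0 < s\<^sub>0" and dom: "pos n (\<lambda>i j. of_real s\<^sub>0 * \<sigma> $$ (i, j) - \<rho> $$ (i, j))"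
    using dominated_of_kernel[OF pos_herm[OF p(1)] p(2) supp_subset_kernel[OF c pos_herm[OF p(1)] ent(1)]] .
  define D where "D = (\<lambda>s. \<rho> + complex_of_real (- s) \<cdot>\<^sub>m \<sigma>)"
  have D: "D s \<in> carrier_mat n n" for s using c by (simp add: D_def)
  have D_ij: "D s $$ (i, j) = \<rho> $$ (i, j) - of_real s * \<sigma> $$ (i, j)" if "i < n" "j < n" for s i j
    using that c by (simp add: D_def)
  have "T (D s) = T \<rho> + complex_of_real (- s) \<cdot>\<^sub>m T \<sigma>" for s
    using Tl c unfolding lmaps_def D_def by auto
  then have TD_ij: "T (D s) $$ (i, j) = T \<rho> $$ (i, j) - of_real s * T \<sigma> $$ (i, j)" if "i < n'" "j < n'" for s i j
    using that c' by simp
  have hD: "herm n (ent (D s))" for s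
    using herm_diff_scale[OF pos_herm[OF p(1)] pos_herm[OF p(2)], of s] D_ij by (simp add: herm_def)
  have mono: "tp n' (\<lambda>i j. T \<rho> $$ (i, j) - of_real s * T \<sigma> $$ (i, j))
      \<le> tp n (\<lambda>i j. \<rho> $$ (i, j) - of_real s * \<sigma> $$ (i, j))" for s
    using channel_tp_mono[OF T D hD, of s] tp_cong[of n' "ent (T (D s))", OF TD_ij] tp_cong[of n "ent (D s)", OF D_ij]
    by simp
  \<comment> \<open>\<open>T\<close> is linear and positive, so the same \<open>s\<^sub>0\<close>
    dominates on the output side, as \<open>tp_eq_of_entropy_eq\<close> demands.\<close>
  have dom': "pos n' (\<lambda>i j. of_real s\<^sub>0 * T \<sigma> $$ (i, j) - T \<rho> $$ (i, j))"
  proof -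
    define C where "C = complex_of_real (- 1) \<cdot>\<^sub>m D s\<^sub>0"
    have "psd n C"
      unfolding psd_iff_pos
    proof
      show "C \<in> carrier_mat n n" using D by (simp add: C_def)
      have "ent C i j = of_real s\<^sub>0 * \<sigma> $$ (i, j) - \<rho> $$ (i, j)" if "i < n" "j < n" for i j
        using that D[of s\<^sub>0] D_ij[OF that] by (simp add: C_def)
      then show "pos n (ent C)" using dom by (subst pos_cong)
    qed
    then have "pos n' (ent (T C))" using cp_map_positive[OF cp] by (simp add: psd_iff_pos)
    moreover have "T C = complex_of_real (- 1) \<cdot>\<^sub>m T (D s\<^sub>0)"
      using Tl D unfolding lmaps_def C_def by blast
    then have "ent (T C) i j = of_real s\<^sub>0 * T \<sigma> $$ (i, j) - T \<rho> $$ (i, j)" if "i < n'" "j < n'" for i j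
      using that lmaps_carrier[OF Tl D[of s\<^sub>0]] TD_ij[OF that] by simp
    ultimately show ?thesis by (subst (asm) pos_cong)
  qed
  have dp: "dominated_pair n (ent \<rho>) (ent \<sigma>) u d s\<^sub>0" "dominated_pair n' (ent (T \<rho>)) (ent (T \<sigma>)) u' d' s\<^sub>0"
    using p p' u u' s0 dom dom' by unfold_locales
  note t = tr[unfolded mtrace_ent[OF c(1)] mtrace_ent[OF c(2)]] tr'[unfolded mtrace_ent[OF c'(1)] mtrace_ent[OF c'(2)]]
  have tps: "tp n' (\<lambda>i j. T \<rho> $$ (i, j) - of_real s * T \<sigma> $$ (i, j))
      = tp n (\<lambda>i j. \<rho> $$ (i, j) - of_real s * \<sigma> $$ (i, j))" if "0 < s" "s \<le> s\<^sub>0" for s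
  proof (rule tp_eq_of_entropy_eq[OF dp w w' _ _ mono that])
    show "Re (\<Sum>i<n. \<rho> $$ (i, i)) = Re (\<Sum>i<n'. T \<rho> $$ (i, i))" using t by simp
    show "(\<Sum>i<n. l i * ln (l i)) - (\<Sum>j<n. Re (qf n (ent \<rho>) (u j)) * ln (d j))
      = (\<Sum>i<n'. l' i * ln (l' i)) - (\<Sum>j<n'. Re (qf n' (ent (T \<rho>)) (u' j)) * ln (d' j))"
      using eq unfolding ent(2) ent'(2) by simp
  qed
  have Re1: "Re (\<Sum>i<n. \<rho> $$ (i, i)) = 1" "Re (\<Sum>i<n. \<sigma> $$ (i, i)) = 1"
    "Re (\<Sum>i<n'. T \<rho> $$ (i, i)) = 1" "Re (\<Sum>i<n'. T \<sigma> $$ (i, i)) = 1" using t by simp_all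
  show thesis
    using order_interval_transfer[OF p p' Re1 dom' tps] that by blast
qed

section \<open>From states back to supermaps\<close>

lemma pure_state_rank_one:
  assumes "pure_state n P"
  obtains \<psi> where "P = rank_one n \<psi>" "mtrace P = 1"
proof -
  obtain v where v: "v \<in> carrier_vec n" "v \<bullet>c v = 1" "P = mat n n (\<lambda>(i, j). v $ i * cnj (v $ j))"
    using assms unfolding pure_state_def by blast
  have "P = rank_one n (\<lambda>i. v $ i)" unfolding v(3) rank_one_def ..
  moreover have "mtrace P = 1"
    using v(2) unfolding cscalar_prod_cin[OF v(1,1)] v(3) by (simp add: mtrace_def cin_def mult.commute)
  ultimately show thesis by (rule that)
qed

text \<open>The marginal is the product of the coefficient matrix \<open>S\<close> of
  \<open>\<psi>\<close> with its adjoint, so full rank makes \<open>S\<close> invertible.\<close>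

lemma full_rank_marginal_inverse:
  assumes "full_rank a (partial_trace2 a a (rank_one (a * a) \<psi>))"
  shows "\<exists>R. \<forall>i<a. \<forall>j<a. (\<Sum>p<a. R i p * \<psi> (p * a + j)) = (if i = j then 1 else 0)"
proof -
  define S where "S = mat a a (\<lambda>(i, k). \<psi> (i * a + k))"
  define S' where "S' = mat a a (\<lambda>(k, j). cnj (\<psi> (j * a + k)))"
  have car: "S \<in> carrier_mat a a" "S' \<in> carrier_mat a a" by (simp_all add: S_def S'_def)
  have "partial_trace2 a a (rank_one (a * a) \<psi>) = S * S'"
    by (rule eq_matI)
      (auto simp: partial_trace2_def rank_one_index block_index S_def S'_def scalar_prod_def lessThan_atLeast0)
  then have "Determinant.det (S * S') \<noteq> 0"
    using assms car vec_space.det_rank_iff[of "S * S'" a] unfolding full_rank_def by auto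
  then have "Determinant.det S \<noteq> 0" using det_mult[OF car] by auto
  then have "S \<in> Units (ring_mat TYPE(complex) a ())" by (rule det_non_zero_imp_unit[OF car(1)])
  then obtain B where B: "B \<in> carrier_mat a a" "B * S = 1\<^sub>m a"
    unfolding Units_def ring_mat_def by auto
  have "(\<Sum>p<a. B $$ (i, p) * \<psi> (p * a + j)) = (if i = j then 1 else 0)" if "i < a" "j < a" for i j
  proof -
    have "(B * S) $$ (i, j) = (1\<^sub>m a :: complex mat) $$ (i, j)" using B(2) by simp
    then show ?thesis using that B(1) by (simp add: S_def scalar_prod_def lessThan_atLeast0)
  qed
  then show ?thesis by (intro exI[of _ "\<lambda>i p. B $$ (i, p)"]) simp
qed

lemma recov_comb:
  "recov a b R (\<lambda>i j. z * \<tau> i j + w * \<tau>' i j) i j k l = z * recov a b R \<tau> i j k l + w * recov a b R \<tau>' i j k l"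
  unfolding recov_def by (simp add: sum_distrib_left distrib_left sum.distrib mult_ac)

lemma recov_cong:
  assumes "\<And>x y. x < a * b \<Longrightarrow> y < a * b \<Longrightarrow> \<tau> x y = \<tau>' x y" "k < b" "l < b"
  shows "recov a b R \<tau> i j k l = recov a b R \<tau>' i j k l"
  unfolding recov_def using assms by (auto simp: block_index intro!: sum.cong)

lemma trace_corrected_eq:
  assumes "T X \<in> carrier_mat n n" "\<sigma>\<^sub>0 \<in> carrier_mat n n" "X \<in> carrier_mat m m" "mtrace (T X) = mtrace X"
  shows "trace_corrected m T \<sigma>\<^sub>0 X = T X"
  using assms unfolding trace_corrected_def by (intro eq_matI) auto

theorem mainTheorem3:
  fixes a a' c c' :: nat
    and \<Theta> :: "(complex mat \<Rightarrow> complex mat) \<Rightarrow> (complex mat \<Rightarrow> complex mat)"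
    and \<N> \<M> :: "complex mat \<Rightarrow> complex mat"
    and \<Psi> \<Phi> :: "complex mat"
  assumes "\<Theta> \<in> SCT a a' c c'"
    and "channel a a' \<N>" and "channel a a' \<M>"
    and "pure_state (a * a) \<Psi>" and "full_rank a (partial_trace2 a a \<Psi>)"
    and "pure_state (c * c) \<Phi>" and "full_rank c (partial_trace2 c c \<Phi>)"
    and "channel_state_div a a a' \<N> \<M> \<Psi> = channel_div a a' \<N> \<M>"
    and "channel_state_div c c c' (\<Theta> \<N>) (\<Theta> \<M>) \<Phi> = channel_div c c' (\<Theta> \<N>) (\<Theta> \<M>)"
    and "\<exists>T. state_representing_map a a' c c' \<Psi> \<Phi> \<Theta> T \<and> trace_correctable (a * a') (c * c') T"
    and "channel_div a a' \<N> \<M> < \<infinity>"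
    and "channel_div a a' \<N> \<M> = channel_div c c' (\<Theta> \<N>) (\<Theta> \<M>)"
  shows "\<exists>\<Theta>\<^sub>R. completely_cp_preserving c c' a a' \<Theta>\<^sub>R \<and>
           \<Theta>\<^sub>R (\<Theta> \<N>) = \<N> \<and> \<Theta>\<^sub>R (\<Theta> \<M>) = \<M>"
proof -
  note super = assms(1) and N = assms(2) and M = assms(3)
  have sc: "superchannel a a' c c' \<Theta>" using super by (simp add: SCT_def)
  have Nl: "\<N> \<in> lmaps a a'" and Ml: "\<M> \<in> lmaps a a'"
    using N M by (simp_all add: channel_def cp_map_def)
  have tpN: "tp_map a a' \<N>" "tp_map c c' (\<Theta> \<N>)" and tpM: "tp_map a a' \<M>" "tp_map c c' (\<Theta> \<M>)"
    using N M sc by (simp_all add: channel_def superchannel_def tp_preserving_def)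
  have \<Theta>Nl: "\<Theta> \<N> \<in> lmaps c c'" and \<Theta>Ml: "\<Theta> \<M> \<in> lmaps c c'"
    using tpN tpM by (simp_all add: tp_map_def)
  obtain \<psi> where \<psi>: "\<Psi> = rank_one (a * a) \<psi>" "mtrace \<Psi> = 1" using pure_state_rank_one[OF assms(4)] .
  obtain \<phi> where \<phi>: "\<Phi> = rank_one (c * c) \<phi>" "mtrace \<Phi> = 1" using pure_state_rank_one[OF assms(6)] .
  obtain R where "\<forall>i<a. \<forall>j<a. (\<Sum>p<a. R i p * \<psi> (p * a + j)) = (if i = j then 1 else 0)"
    using full_rank_marginal_inverse[OF assms(5)[unfolded \<psi>(1)]] by (elim exE)
  then have R: "(\<Sum>p<a. R i p * \<psi> (p * a + j)) = (if i = j then 1 else 0)" if "i < a" "j < a" for i j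
    using that by blast
  obtain T \<sigma>\<^sub>0 where T: "state_representing_map a a' c c' \<Psi> \<Phi> \<Theta> T" "\<sigma>\<^sub>0 \<in> carrier_mat (c * c') (c * c')"
    "channel (a * a') (c * c') (trace_corrected (a * a') T \<sigma>\<^sub>0)"
    using assms(10) unfolding trace_correctable_def by blast
  define \<rho> where "\<rho> = id_tensor a a a' \<N> \<Psi>"
  define \<sigma> where "\<sigma> = id_tensor a a a' \<M> \<Psi>"
  define \<rho>' where "\<rho>' = id_tensor c c c' (\<Theta> \<N>) \<Phi>"
  define \<sigma>' where "\<sigma>' = id_tensor c c c' (\<Theta> \<M>) \<Phi>"
  have cPsi: "\<Psi> \<in> carrier_mat (a * a) (a * a)" and cPhi: "\<Phi> \<in> carrier_mat (c * c) (c * c)"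
    using \<psi>(1) \<phi>(1) by simp_all
  have psd: "psd (a * a') \<rho>" "psd (a * a') \<sigma>"
    using N M psd_rank_one unfolding \<rho>_def \<sigma>_def \<psi>(1) channel_def cp_map_def by blast+
  then have c: "\<rho> \<in> carrier_mat (a * a') (a * a')" "\<sigma> \<in> carrier_mat (a * a') (a * a')"
    and p: "pos (a * a') (ent \<rho>)" "pos (a * a') (ent \<sigma>)" by (simp_all add: psd_iff_pos)
  have c': "\<rho>' \<in> carrier_mat (c * c') (c * c')" "\<sigma>' \<in> carrier_mat (c * c') (c * c')"
    unfolding \<rho>'_def \<sigma>'_def by (rule lmaps_carrier[OF id_tensor_lmaps cPhi])+
  have tr: "mtrace \<rho> = 1" "mtrace \<sigma> = 1" "mtrace \<rho>' = 1" "mtrace \<sigma>' = 1"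
    unfolding \<rho>_def \<sigma>_def \<rho>'_def \<sigma>'_def
    using mtrace_id_tensor[OF tpN(1) cPsi] mtrace_id_tensor[OF tpM(1) cPsi]
      mtrace_id_tensor[OF tpN(2) cPhi] mtrace_id_tensor[OF tpM(2) cPhi] \<psi>(2) \<phi>(2) by simp_all
  let ?T = "trace_corrected (a * a') T \<sigma>\<^sub>0"
  have "T \<rho> = \<rho>'" "T \<sigma> = \<sigma>'"
    using T(1) Nl Ml unfolding state_representing_map_def \<rho>_def \<sigma>_def \<rho>'_def \<sigma>'_def by blast+
  \<comment> \<open>Inputs and outputs all have trace 1, so the correction term vanishes on
    them.\<close>
  then have T': "?T \<rho> = \<rho>'" "?T \<sigma> = \<sigma>'"
    using trace_corrected_eq[of T \<rho>, OF _ T(2) c(1)] trace_corrected_eq[of T \<sigma>, OF _ T(2) c(2)] c' tr by simp_all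
  have D: "rel_entropy (a * a') \<rho> \<sigma> = channel_div a a' \<N> \<M>"
    "rel_entropy (c * c') \<rho>' \<sigma>' = channel_div c c' (\<Theta> \<N>) (\<Theta> \<M>)"
    using assms(8,9) unfolding channel_state_div_def \<rho>_def \<sigma>_def \<rho>'_def \<sigma>'_def by simp_all
  \<comment> \<open>Finiteness will yield the inclusion of supports, and with it a multiple of
    \<open>\<sigma>\<close> above \<open>\<rho>\<close>.\<close>
  have fin: "rel_entropy (a * a') \<rho> \<sigma> < \<infinity>" using assms(11) D by simp
  have eq: "rel_entropy (c * c') (?T \<rho>) (?T \<sigma>) = rel_entropy (a * a') \<rho> \<sigma>"
    unfolding T' D using assms(12) by simp
  obtain m g v w where mg: "m \<le> g"
    "pos (a * a') (\<lambda>i j. of_real g * \<sigma> $$ (i, j) - \<rho> $$ (i, j))"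
    "pos (a * a') (\<lambda>i j. \<rho> $$ (i, j) - of_real m * \<sigma> $$ (i, j))"
    and vw: "Re (qf (c * c') (ent \<sigma>') v) = 1" "Re (qf (c * c') (ent \<rho>') v) = g"
      "Re (qf (c * c') (ent \<sigma>') w) = 1" "Re (qf (c * c') (ent \<rho>') w) = m"
    using order_interval_of_entropy_eq[OF T(3) psd tr(1,2) fin eq] unfolding T' by blast
  have "cp_map (a * a') (c * c') ?T" using T(3) by (simp add: channel_def)
  then have p': "pos (c * c') (ent \<rho>')" "pos (c * c') (ent \<sigma>')"
    using cp_map_positive psd unfolding T'[symmetric] psd_iff_pos by blast+
  have q: "qf (c * c') (ent \<sigma>') v = 1" "qf (c * c') (ent \<rho>') v = of_real g"
    "qf (c * c') (ent \<sigma>') w = 1" "qf (c * c') (ent \<rho>') w = of_real m"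
    using vw p'[THEN pos_herm, THEN herm_qf_real] by (simp_all add: complex_eq_iff)
  \<comment> \<open>In the degenerate case \<open>m = g\<close> one has \<open>\<rho> = g \<sigma>\<close>.\<close>
  have "\<exists>\<tau>. (\<forall>x. pos (a * a') (\<tau> x)) \<and> (\<forall>i<a * a'. \<forall>j<a * a'.
      of_real g * \<tau> True i j + of_real m * \<tau> False i j = \<rho> $$ (i, j) \<and> \<tau> True i j + \<tau> False i j = \<sigma> $$ (i, j))"
  proof (cases "m = g")
    case True
    have "\<rho> $$ (i, j) = of_real g * \<sigma> $$ (i, j)" if "i < a * a'" "j < a * a'" for i j
      using pos_antisym[OF mg(2) _ that] mg(3) True by simp
    \<comment> \<open>Both outcomes carry the same weight \<open>g\<close>, so
      \<open>\<sigma>\<close> is simply split into halves.\<close>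
    moreover have "pos (a * a') (\<lambda>i j. of_real (1 / 2) * \<sigma> $$ (i, j))"
      using p(2) unfolding pos_def qf_scale by (simp add: less_eq_complex_def)
    ultimately show ?thesis
      using True by (intro exI[of _ "\<lambda>x i j. of_real (1 / 2) * \<sigma> $$ (i, j)"]) (simp add: field_simps)
  next
    case False
    define e where "e = 1 / (g - m)"
    have e: "0 \<le> e" "complex_of_real e * (of_real g - of_real m) = 1"
      using mg(1) False by (simp_all add: e_def flip: of_real_diff)
    \<comment> \<open>The solution of the two linear equations for \<open>\<tau> True\<close> and
      \<open>\<tau> False\<close>, positive by the order interval.\<close>
    let ?\<tau> = "\<lambda>x i j. of_real e * (if x then \<rho> $$ (i, j) - of_real m * \<sigma> $$ (i, j)
      else of_real g * \<sigma> $$ (i, j) - \<rho> $$ (i, j))"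
    have "pos (a * a') (?\<tau> x)" for x
      using mg(2,3) e(1) unfolding pos_def qf_scale by (cases x) (simp_all add: less_eq_complex_def)
    moreover have "of_real g * ?\<tau> True i j + of_real m * ?\<tau> False i j
        = (of_real e * (of_real g - of_real m)) * \<rho> $$ (i, j)"
      "?\<tau> True i j + ?\<tau> False i j = (of_real e * (of_real g - of_real m)) * \<sigma> $$ (i, j)" for i j
      by (simp_all add: algebra_simps)
    ultimately show ?thesis unfolding e(2) by (intro exI[of _ ?\<tau>]) simp
  qed
  then obtain \<tau> where \<tau>: "\<And>x. pos (a * a') (\<tau> x)"
    "\<And>i j. i < a * a' \<Longrightarrow> j < a * a' \<Longrightarrow> of_real g * \<tau> True i j + of_real m * \<tau> False i j = \<rho> $$ (i, j)"
    "\<And>i j. i < a * a' \<Longrightarrow> j < a * a' \<Longrightarrow> 1 * \<tau> True i j + 1 * \<tau> False i j = \<sigma> $$ (i, j)" by auto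
  \<comment> \<open>Contraction with \<open>\<zeta> x\<close> evaluates the form of the output state
    at \<open>v\<close> or \<open>w\<close>.\<close>
  define \<zeta> where "\<zeta> = (\<lambda>x i k. \<Sum>p<c. (if x then v else w) (p * c' + k) * cnj (\<phi> (p * c + i)))"
  define h where "h = (\<lambda>K i j k l. \<Sum>x\<in>UNIV. contr c c' (\<zeta> x) (\<lambda>i j k l. K (unit_op c i j) $$ (k, l)) *
    recov a a' R (\<tau> x) i j k l)"
  have \<zeta>: "contr c c' (\<zeta> x) (\<lambda>i j k l. K (unit_op c i j) $$ (k, l))
      = qf (c * c') (ent (id_tensor c c c' K \<Phi>)) (if x then v else w)" if "K \<in> lmaps c c'" for K x
    unfolding \<zeta>_def \<phi>(1) by (rule qf_id_tensor_contr[OF that, symmetric])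
  have "lin a a' (h (\<Theta> \<N>)) = \<N>"
  proof (rule lmaps_eqI[OF lin_lmaps Nl])
    fix i j k l assume ij: "i < a" "j < a" and kl: "k < a'" "l < a'"
    \<comment> \<open>The outcomes on \<open>\<rho>'\<close> are \<open>g\<close> and
      \<open>m\<close>, so the prepared combination is \<open>\<rho>\<close>; on
      \<open>\<sigma>'\<close> both are 1, which gives \<open>\<sigma>\<close> in the case of
      \<open>\<M>\<close>.\<close>
    have "h (\<Theta> \<N>) i j k l = recov a a' R (\<lambda>i j. of_real g * \<tau> True i j + of_real m * \<tau> False i j) i j k l"
      unfolding h_def recov_comb \<zeta>[OF \<Theta>Nl] \<rho>'_def[symmetric] by (simp add: UNIV_bool q add.commute)
    also have "\<dots> = recov a a' R (ent \<rho>) i j k l" by (rule recov_cong[OF \<tau>(2) kl])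
    also have "\<dots> = \<N> (unit_op a i j) $$ (k, l)"
      unfolding \<rho>_def \<psi>(1) by (rule recov_id_tensor[OF Nl R ij kl])
    finally show "lin a a' (h (\<Theta> \<N>)) (unit_op a i j) $$ (k, l) = \<N> (unit_op a i j) $$ (k, l)"
      unfolding lin_unit[OF ij kl] .
  qed
  moreover have "lin a a' (h (\<Theta> \<M>)) = \<M>"
  proof (rule lmaps_eqI[OF lin_lmaps Ml])
    fix i j k l assume ij: "i < a" "j < a" and kl: "k < a'" "l < a'"
    have "h (\<Theta> \<M>) i j k l = recov a a' R (\<lambda>i j. 1 * \<tau> True i j + 1 * \<tau> False i j) i j k l"
      unfolding h_def recov_comb \<zeta>[OF \<Theta>Ml] \<sigma>'_def[symmetric] by (simp add: UNIV_bool q add.commute)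
    also have "\<dots> = recov a a' R (ent \<sigma>) i j k l" by (rule recov_cong[OF \<tau>(3) kl])
    also have "\<dots> = \<M> (unit_op a i j) $$ (k, l)"
      unfolding \<sigma>_def \<psi>(1) by (rule recov_id_tensor[OF Ml R ij kl])
    finally show "lin a a' (h (\<Theta> \<M>)) (unit_op a i j) $$ (k, l) = \<M> (unit_op a i j) $$ (k, l)"
      unfolding lin_unit[OF ij kl] .
  qed
  moreover have "completely_cp_preserving c c' a a' (\<lambda>K. lin a a' (h K))"
    unfolding h_def by (rule measure_prepare_completely_cp[OF \<tau>(1)])
  ultimately show ?thesis by (intro exI[of _ "\<lambda>K. lin a a' (h K)"]) simp
qed

end
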